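(* Let $\nu$ be a probability measure on $\mathbb{R}^d$, and let $a$ be a nonnegative function defined on some subset of the set of probability measures on $\mathbb{R}^d$, this subset containing $\nu$ and the probability measures with densities $\Gamma(\beta,\cdot)*_x\nu$, $\beta>0$, such that $\nu$ is the only zero of $a$. For $\beta\ge 0$ let $f(\beta)$ be the value of the functional $a$ at the measure with density $\Gamma(\beta,\cdot)*_x\nu$ (at the measure $\nu$ if $\beta=0$). Consider the Cauchy problem with diffusion matrix $A=a(\mu_t)I$ and drift $b=0$, that is, $$\partial_t\mu=\Delta\bigl(a(\mu_t)\mu\bigr),\qquad \mu|_{t=0}=\nu.$$ This problem has at least two solutions (one of which is the stationary solution $\mu_t\equiv\nu$) in each neighbourhood of zero (in the time variable $t\ge 0$) if and only if for sufficiently small $\varepsilon>0$ the following integral converges: $$\int_0^\varepsilon\frac{dt}{f(t)}<+\infty.$$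
   Context: $\Gamma(t,x)$ is the fundamental solution of the heat operator $\partial_t-\Delta$ on $\mathbb{R}^d$, and $*_x$ denotes convolution in the variable $x$. $I$ is the identity matrix. A solution on a time interval $[0,T]$ is a measure $\mu(dx\,dt)=\mu_t(dx)\,dt$ given by a flow of probability measures $(\mu_t)_{t\in[0,T]}$ on $\mathbb{R}^d$ (each $\mu_t$ is a probability measure and $t\mapsto\mu_t(B)$ is measurable for each Borel set $B$), with $\mu_t$ in the domain of $a$, such that the coefficient $t\mapsto a(\mu_t)$ is in $L^1(\mu,U\times[0,T])$ for each ball $U\subset\mathbb{R}^d$ and for every $\varphi\in C_0^\infty(\mathbb{R}^d)$ $$\int\varphi\,d\mu_t=\int\varphi\,d\nu+\int_0^t\int a(\mu_s)\Delta\varphi\,d\mu_s\,ds\quad\text{for all }t\in[0,T].$$ *)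

theory Defs
  imports "HOL-Probability.Probability"
begin

definition borel_prob :: "'a::topological_space measure \<Rightarrow> bool" where
  "borel_prob M \<longleftrightarrow> prob_space M \<and> sets M = sets borel"

subsection \<open>Test functions and the Laplacian\<close>

definition partial_deriv :: "'a::euclidean_space \<Rightarrow> ('a \<Rightarrow> real) \<Rightarrow> 'a \<Rightarrow> real" where
  "partial_deriv b f x = frechet_derivative f (at x) b"

primrec C_k :: "nat \<Rightarrow> ('a::euclidean_space \<Rightarrow> real) \<Rightarrow> bool" where
  "C_k 0 f \<longleftrightarrow> continuous_on UNIV f"
| "C_k (Suc k) f \<longleftrightarrow> f differentiable_on UNIV \<and> (\<forall>b\<in>Basis. C_k k (partial_deriv b f))"

definition test_function :: "('a::euclidean_space \<Rightarrow> real) \<Rightarrow> bool" where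
  "test_function \<phi> \<longleftrightarrow> (\<forall>k. C_k k \<phi>) \<and> compact (closure {x. \<phi> x \<noteq> 0})"

definition laplacian :: "('a::euclidean_space \<Rightarrow> real) \<Rightarrow> 'a \<Rightarrow> real" where
  "laplacian \<phi> x = (\<Sum>b\<in>Basis. partial_deriv b (partial_deriv b \<phi>) x)"

subsection \<open>The heat kernel\<close>

text \<open>Fundamental solution of the operator \<open>\<partial>\<^sub>t - \<Delta>\<close> (without the factor 1/2 in
  front of the Laplacian), for positive time.\<close>

definition heat_kernel :: "real \<Rightarrow> 'a::euclidean_space \<Rightarrow> real" where
  "heat_kernel t x = (4 * pi * t) powr (- (real DIM('a) / 2)) * exp (- ((norm x)\<^sup>2 / (4 * t)))"

definition heat_flow :: "'a::euclidean_space measure \<Rightarrow> real \<Rightarrow> 'a measure" where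
  "heat_flow \<nu> \<beta> = (if \<beta> = 0 then \<nu>
     else density lborel (\<lambda>x. \<integral>\<^sup>+ y. ennreal (heat_kernel \<beta> (x - y)) \<partial>\<nu>))"

subsection \<open>Solutions of the Cauchy problem\<close>

definition prob_flow :: "real \<Rightarrow> (real \<Rightarrow> 'a::euclidean_space measure) \<Rightarrow> bool" where
  "prob_flow T \<mu> \<longleftrightarrow> (\<forall>t\<in>{0..T}. borel_prob (\<mu> t)) \<and>
     (\<forall>B\<in>sets borel. (\<lambda>t. measure (\<mu> t) B) \<in> borel_measurable (restrict_space borel {0..T}))"

text \<open>The measure \<open>\<mu>(dx dt) = \<mu>\<^sub>t(dx) dt\<close> on \<open>\<real>\<^sup>d \<times> [0,T]\<close>, extended by zero;
  see \<open>emeasure_spacetime_measure\<close> for its values.\<close>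

definition spacetime_measure ::
    "real \<Rightarrow> (real \<Rightarrow> 'a::euclidean_space measure) \<Rightarrow> ('a \<times> real) measure" where
  "spacetime_measure T \<mu> = restrict_space lborel {0..T} \<bind> (\<lambda>t. distr (\<mu> t) borel (\<lambda>x. (x, t)))"

lemma prob_flow_measurable:
  assumes "prob_flow T \<mu>"
  shows "\<mu> \<in> restrict_space lborel {0..T} \<rightarrow>\<^sub>M subprob_algebra borel"
proof (rule measurable_subprob_algebra)
  fix t assume "t \<in> space (restrict_space lborel {0..T})"
  then have t: "borel_prob (\<mu> t)"
    using assms by (auto simp: prob_flow_def space_restrict_space)
  then show "subprob_space (\<mu> t)"
    by (auto simp: borel_prob_def intro: prob_space_imp_subprob_space)
  show "sets (\<mu> t) = sets borel"
    using t by (simp add: borel_prob_def)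
next
  fix B :: "'a set" assume "B \<in> sets borel"
  then have "(\<lambda>t. measure (\<mu> t) B) \<in> borel_measurable (restrict_space borel {0..T})"
    using assms by (simp add: prob_flow_def)
  moreover have "sets (restrict_space borel {0..T}) = sets (restrict_space lborel {0..T})"
    by (rule sets_restrict_space_cong) simp
  ultimately have "(\<lambda>t. ennreal (measure (\<mu> t) B)) \<in> borel_measurable (restrict_space lborel {0..T})"
    using measurable_cong_sets[of "restrict_space borel {0..T}" "restrict_space lborel {0..T}" borel borel]
    by simp
  moreover have "emeasure (\<mu> t) B = ennreal (measure (\<mu> t) B)"
    if "t \<in> space (restrict_space lborel {0..T})" for t
  proof -
    interpret prob_space "\<mu> t"
      using assms that by (auto simp: prob_flow_def borel_prob_def space_restrict_space)
    show ?thesis by (rule emeasure_eq_measure)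
  qed
  ultimately show "(\<lambda>t. emeasure (\<mu> t) B) \<in> borel_measurable (restrict_space lborel {0..T})"
    by (subst measurable_cong) auto
qed

lemma emeasure_spacetime_measure:
  assumes "prob_flow T \<mu>" "0 \<le> T" "X \<in> sets borel"
  shows "emeasure (spacetime_measure T \<mu>) X = (\<integral>\<^sup>+ t\<in>{0..T}. emeasure (\<mu> t) {x. (x, t) \<in> X} \<partial>lborel)"
proof -
  let ?R = "restrict_space lborel {0..T}"
  have m: "(\<lambda>t. distr (\<mu> t) borel (\<lambda>x. (x, t))) \<in> ?R \<rightarrow>\<^sub>M subprob_algebra borel"
  proof (rule measurable_distr2[OF _ prob_flow_measurable[OF assms(1)]])
    have "(\<lambda>p. p) \<in> ?R \<rightarrow>\<^sub>M lborel"
      by (rule measurable_restrict_space1) simp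
    then have [measurable]: "(\<lambda>p. p) \<in> ?R \<rightarrow>\<^sub>M borel" by simp
    show "(\<lambda>(t, x). (x, t)) \<in> ?R \<Otimes>\<^sub>M borel \<rightarrow>\<^sub>M (borel :: ('a \<times> real) measure)"
      unfolding borel_prod[symmetric] by measurable
  qed
  have "emeasure (spacetime_measure T \<mu>) X =
      (\<integral>\<^sup>+ t. emeasure (distr (\<mu> t) borel (\<lambda>x. (x, t))) X \<partial>?R)"
    unfolding spacetime_measure_def using assms
    by (intro emeasure_bind[OF _ m]) (auto simp: space_restrict_space)
  also have "\<dots> = (\<integral>\<^sup>+ t. emeasure (\<mu> t) {x. (x, t) \<in> X} \<partial>?R)"
  proof (rule nn_integral_cong)
    fix t assume "t \<in> space ?R"
    then have s: "sets (\<mu> t) = sets borel"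
      using assms by (auto simp: prob_flow_def borel_prob_def space_restrict_space)
    have sp: "space (\<mu> t) = UNIV" using sets_eq_imp_space_eq[OF s] by simp
    have "(\<lambda>x. (x, t)) \<in> \<mu> t \<rightarrow>\<^sub>M borel"
      unfolding measurable_cong_sets[OF s refl] borel_prod[symmetric] by measurable
    then show "emeasure (distr (\<mu> t) borel (\<lambda>x. (x, t))) X = emeasure (\<mu> t) {x. (x, t) \<in> X}"
      using assms(3) by (simp add: emeasure_distr vimage_def sp)
  qed
  also have "\<dots> = (\<integral>\<^sup>+ t\<in>{0..T}. emeasure (\<mu> t) {x. (x, t) \<in> X} \<partial>lborel)"
    by (rule nn_integral_restrict_space) simp
  finally show ?thesis .
qed

text \<open>Solutions on \<open>[0,T]\<close> of \<open>\<partial>\<^sub>t\<mu> = \<Delta>(a(\<mu>\<^sub>t)\<mu>)\<close>, \<open>\<mu>\<^sub>0 = \<nu>\<close>, where the functional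
  \<open>a\<close> has domain \<open>D\<close>; values of \<open>\<mu>\<close> outside \<open>[0,T]\<close> play no role.  Neither
  \<open>t \<mapsto> a(\<mu>\<^sub>t)\<close> nor the domain is assumed to be regular, so measurability of the coefficient
  is Lebesgue (completed) measurability, and the time integral is taken with respect to
  \<open>lebesgue\<close>: the Bochner integral over \<open>lborel\<close> of a non-Borel function is 0.\<close>

definition is_solution ::
    "'a::euclidean_space measure set \<Rightarrow> ('a measure \<Rightarrow> real) \<Rightarrow> 'a measure \<Rightarrow> real
      \<Rightarrow> (real \<Rightarrow> 'a measure) \<Rightarrow> bool" where
  "is_solution D a \<nu> T \<mu> \<longleftrightarrow>
     prob_flow T \<mu> \<and>
     (\<forall>t\<in>{0..T}. \<mu> t \<in> D) \<and>
     (\<forall>c r. set_integrable (completion (spacetime_measure T \<mu>)) (ball c r \<times> {0..T})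
        (\<lambda>(x, t). a (\<mu> t))) \<and>
     (\<forall>\<phi>. test_function \<phi> \<longrightarrow> (\<forall>t\<in>{0..T}.
        (LINT x|\<mu> t. \<phi> x) = (LINT x|\<nu>. \<phi> x)
          + (LINT s:{0..t}|lebesgue. (LINT x|\<mu> s. a (\<mu> s) * laplacian \<phi> x))))"

end

theory Submission
  imports Defs
begin

text \<open>Once the coefficient \<open>\<alpha>(t) = a(\<mu>\<^sub>t)\<close> is known to be integrable in time, the equation is
  linear.  Testing with \<open>cos (x \<bullet> \<xi> + \<theta>)\<close>, an eigenfunction of the Laplacian, gives a scalar
  Volterra equation, so \<open>\<mu>\<^sub>t\<close> is the heat flow of \<open>\<nu>\<close> at the time
  \<open>\<beta>(t) = \<integral>\<^sub>0\<^sup>t \<alpha>\<close>, and the nonlinear problem becomes the scalar equation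
  \<open>\<beta>(t) = \<integral>\<^sub>0\<^sup>t f(\<beta>(s)) ds\<close> with \<open>f(0) = 0 < f(\<beta>)\<close> for \<open>\<beta> > 0\<close>.  A solution that leaves
  zero is, from the moment it leaves, the inverse function of \<open>\<integral> d\<beta> / f(\<beta>)\<close>, so it
  exists exactly when this integral converges at zero.  As \<open>f\<close> is merely Lebesgue
  measurable, the inverse function is handled by pushing measures forward instead of
  differentiating.\<close>

section \<open>Smooth functions\<close>

text \<open>Integrability of the coefficient in time is itself delicate. A solution controls only
  the coefficient times the mass of a ball, and that mass could degenerate along the flow;
  continuity in time of the integrals of test functions has to be extracted from this weighted
  control before a uniform lower bound on the mass is available. Cosines with a free phase replace
  complex exponentials: they are real, their derivatives and products are again combinations of such
  cosines, and the phases 0 and -pi/2 recover the characteristic function. They lack compact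
  support, so they enter as bounded limits of dilated cutoffs. Both directions of the equivalence
  use one inversion lemma with exchanged roles: once the density is the coefficient and the inverse
  gives the time at which a level is reached, once the density is 1/f and the inverse gives the
  level reached at a time.\<close>

lemma partial_deriv_eqI:
  assumes "(f has_derivative f') (at x)"
  shows "partial_deriv b f x = f' b"
  using frechet_derivative_at[OF assms] by (simp add: partial_deriv_def)

lemma C_k_SucD: "C_k (Suc k) f \<Longrightarrow> C_k k f"
proof (induction k arbitrary: f)
  case 0
  then show ?case by (simp add: differentiable_imp_continuous_on)
next
  case (Suc k)
  then have "C_k k (partial_deriv b f)" if "b \<in> Basis" for b
    using that by (intro Suc.IH) simp
  with Suc.prems show ?case by simp
qed

text \<open>Inductive smoothness proofs can exhibit a derivative and check its values on
  \<open>Basis\<close>, without evaluating \<open>frechet_derivative\<close>.\<close>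

lemma C_k_SucI:
  assumes "\<And>x. (f has_derivative f' x) (at x)"
    and "\<And>b. b \<in> Basis \<Longrightarrow> C_k k (\<lambda>x. f' x b)"
  shows "C_k (Suc k) f"
proof -
  have "partial_deriv b f = (\<lambda>x. f' x b)" for b
    using assms(1) by (intro ext partial_deriv_eqI)
  moreover have "f differentiable_on UNIV"
    using assms(1) by (auto simp: differentiable_on_def differentiable_def)
  ultimately show ?thesis using assms(2) by simp
qed

text \<open>Linearity determines the derivative by its values on the basis. In this form it is built
  from partial derivatives, the objects about which the induction hypotheses below speak.\<close>

lemma C_k_Suc_has_derivative:
  assumes "C_k (Suc k) f"
  shows "(f has_derivative (\<lambda>h. \<Sum>b\<in>Basis. (h \<bullet> b) * partial_deriv b f x)) (at x)"
proof -
  let ?F = "frechet_derivative f (at x)"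
  have "f differentiable at x"
    using assms by (simp add: differentiable_on_def)
  then have d: "(f has_derivative ?F) (at x)" by (simp add: frechet_derivative_works)
  then interpret bounded_linear ?F by (rule has_derivative_bounded_linear)
  have "?F h = (\<Sum>b\<in>Basis. (h \<bullet> b) * partial_deriv b f x)" for h
  proof -
    have "?F h = ?F (\<Sum>b\<in>Basis. (h \<bullet> b) *\<^sub>R b)" by (simp add: euclidean_representation)
    also have "\<dots> = (\<Sum>b\<in>Basis. (h \<bullet> b) * partial_deriv b f x)"
      by (simp add: sum scale partial_deriv_def)
    finally show ?thesis .
  qed
  then have "?F = (\<lambda>h. \<Sum>b\<in>Basis. (h \<bullet> b) * partial_deriv b f x)" by blast
  with d show ?thesis by simp
qed

section \<open>Closure properties of smooth functions\<close>

lemma C_k_const: "C_k k (\<lambda>_. c)"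
proof (induction k arbitrary: c)
  case (Suc k)
  show ?case by (rule C_k_SucI[where f' = "\<lambda>_ _. 0"]) (use Suc in auto)
qed simp

lemma sum_Basis_inner: "c \<in> Basis \<Longrightarrow> (\<Sum>b\<in>Basis. (c \<bullet> b) * F b) = (F c :: real)"
  by (simp add: inner_Basis if_distrib[of "\<lambda>x. x * _"] cong: if_cong)

lemma C_k_add: "C_k k f \<Longrightarrow> C_k k g \<Longrightarrow> C_k k (\<lambda>x. f x + g x)"
proof (induction k arbitrary: f g)
  case 0
  then show ?case by (simp add: continuous_on_add)
next
  case (Suc k)
  show ?case
  proof (rule C_k_SucI)
    show "((\<lambda>x. f x + g x) has_derivative
        (\<lambda>h. (\<Sum>b\<in>Basis. (h \<bullet> b) * partial_deriv b f x) + (\<Sum>b\<in>Basis. (h \<bullet> b) * partial_deriv b g x))) (at x)" for x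
      by (intro has_derivative_add C_k_Suc_has_derivative[OF Suc.prems(1)] C_k_Suc_has_derivative[OF Suc.prems(2)])
    show "C_k k (\<lambda>x. (\<Sum>b\<in>Basis. (c \<bullet> b) * partial_deriv b f x) + (\<Sum>b\<in>Basis. (c \<bullet> b) * partial_deriv b g x))"
      if "c \<in> Basis" for c :: 'a
      using Suc.prems that by (simp add: sum_Basis_inner Suc.IH)
  qed
qed

lemma C_k_mult: "C_k k f \<Longrightarrow> C_k k g \<Longrightarrow> C_k k (\<lambda>x. f x * g x)"
proof (induction k arbitrary: f g)
  case 0
  then show ?case by (simp add: continuous_on_mult)
next
  case (Suc k)
  show ?case
  proof (rule C_k_SucI)
    show "((\<lambda>x. f x * g x) has_derivative
        (\<lambda>h. f x * (\<Sum>b\<in>Basis. (h \<bullet> b) * partial_deriv b g x) + (\<Sum>b\<in>Basis. (h \<bullet> b) * partial_deriv b f x) * g x)) (at x)" for x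
      by (intro has_derivative_mult C_k_Suc_has_derivative[OF Suc.prems(1)] C_k_Suc_has_derivative[OF Suc.prems(2)])
    show "C_k k (\<lambda>x. f x * (\<Sum>b\<in>Basis. (c \<bullet> b) * partial_deriv b g x) + (\<Sum>b\<in>Basis. (c \<bullet> b) * partial_deriv b f x) * g x)"
      if "c \<in> Basis" for c :: 'a
      using Suc.prems that C_k_SucD[OF Suc.prems(1)] C_k_SucD[OF Suc.prems(2)]
      by (simp add: sum_Basis_inner Suc.IH C_k_add)
  qed
qed

lemma C_k_prod: "(\<And>i. i \<in> I \<Longrightarrow> C_k k (f i)) \<Longrightarrow> C_k k (\<lambda>x. \<Prod>i\<in>I. f i x)"
  by (induction I rule: infinite_finite_induct) (auto simp: C_k_const C_k_mult)

lemma C_k_scale: "C_k k f \<Longrightarrow> C_k k (\<lambda>x. f (c *\<^sub>R x))"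
proof (induction k arbitrary: f)
  case 0
  then have "continuous_on UNIV f" by simp
  then have "continuous_on UNIV (\<lambda>x. f (c *\<^sub>R x))"
    by (rule continuous_on_compose2) (auto intro!: continuous_intros)
  then show ?case by simp
next
  case (Suc k)
  show ?case
  proof (rule C_k_SucI)
    show "((\<lambda>x. f (c *\<^sub>R x)) has_derivative
        (\<lambda>h. \<Sum>b\<in>Basis. ((c *\<^sub>R h) \<bullet> b) * partial_deriv b f (c *\<^sub>R x))) (at x)" for x
      by (rule has_derivative_compose[OF _ C_k_Suc_has_derivative[OF Suc.prems]])
         (auto intro!: derivative_eq_intros)
    show "C_k k (\<lambda>x. \<Sum>b\<in>Basis. ((c *\<^sub>R d) \<bullet> b) * partial_deriv b f (c *\<^sub>R x))" if "d \<in> Basis" for d :: 'a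
    proof -
      have "(\<Sum>b\<in>Basis. ((c *\<^sub>R d) \<bullet> b) * F b) = c * F d" for F :: "'a \<Rightarrow> real"
        using sum_Basis_inner[OF that, of F] by (simp add: mult.assoc flip: sum_distrib_left)
      then show ?thesis using Suc.prems that by (auto intro!: C_k_mult C_k_const Suc.IH)
    qed
  qed
qed

text \<open>The whole tower of derivatives of a one-variable function is carried along:
  differentiating gives a constant times a ridge function of the same tower, and the induction on
  \<open>k\<close> closes by moving from \<open>n\<close> to \<open>Suc n\<close>.\<close>

lemma C_k_ridge:
  fixes D :: "nat \<Rightarrow> real \<Rightarrow> real"
  assumes "\<And>n u. (D n has_real_derivative D (Suc n) u) (at u)"
  shows "C_k k (\<lambda>x. D n (x \<bullet> v + \<theta>))"
proof (induction k arbitrary: n)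
  case 0
  have "continuous_on UNIV (D n)"
    using assms by (meson DERIV_continuous_on has_field_derivative_at_within)
  then have "continuous_on UNIV (\<lambda>x. D n (x \<bullet> v + \<theta>))"
    by (rule continuous_on_compose2) (auto intro!: continuous_intros)
  then show ?case by simp
next
  case (Suc k)
  show ?case
  proof (rule C_k_SucI)
    show "((\<lambda>x. D n (x \<bullet> v + \<theta>)) has_derivative (\<lambda>h. (h \<bullet> v) * D (Suc n) (x \<bullet> v + \<theta>))) (at x)" for x
      by (rule has_derivative_eq_rhs[OF has_derivative_compose[OF _ assms[unfolded has_field_derivative_def]]])
         (auto intro!: derivative_eq_intros simp: mult.commute)
    show "C_k k (\<lambda>x. (b \<bullet> v) * D (Suc n) (x \<bullet> v + \<theta>))" for b
      by (intro C_k_mult C_k_const Suc.IH)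
  qed
qed

lemma C_k_cos: "C_k k (\<lambda>x. cos (x \<bullet> v + \<theta>))"
proof -
  \<comment> \<open>Each derivative of the cosine is a phase shift by pi/2, which puts all
    derivatives into one formula.\<close>
  have "C_k k (\<lambda>x. (\<lambda>n u. cos (u + real n * pi / 2)) 0 (x \<bullet> v + \<theta>))"
  proof (rule C_k_ridge)
    fix n u
    have "cos (u + real (Suc n) * pi / 2) = - sin (u + real n * pi / 2)"
      using cos_add[of "u + real n * pi / 2" "pi / 2"] by (simp add: algebra_simps add_divide_distrib)
    then show "((\<lambda>u. cos (u + real n * pi / 2)) has_real_derivative cos (u + real (Suc n) * pi / 2)) (at u)"
      by (auto intro!: derivative_eq_intros)
  qed
  then show ?thesis by simp
qed

subsection \<open>Compactly supported smooth functions\<close>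

text \<open>The classical flat function exp(-1/u), continued by zero. The polynomial factor in 1/u
  makes the class stable under differentiation, so it supplies its own tower for
  \<open>C_k_ridge\<close>.\<close>

definition flat_exp :: "real poly \<Rightarrow> real \<Rightarrow> real" where
  "flat_exp p u = (if u > 0 then poly p (1 / u) * exp (- (1 / u)) else 0)"

lemma poly_mult_exp_minus_tendsto_0: "((\<lambda>y. poly p y * exp (- y)) \<longlongrightarrow> (0::real)) at_top"
proof -
  have "((\<lambda>y. \<Sum>i\<le>degree p. coeff p i * (y ^ i / exp y)) \<longlongrightarrow> (\<Sum>i\<le>degree p. coeff p i * 0)) at_top"
    by (intro tendsto_intros tendsto_power_div_exp_0)
  then show ?thesis
    by (simp add: poly_altdef sum_distrib_left exp_minus divide_inverse mult_ac)
qed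

text \<open>For u > 0 the chain rule turns the polynomial p into X^2 (p - p'), where p' is the
  formal derivative; at zero the exponential beats every power of 1/u.\<close>

lemma flat_exp_has_derivative:
  "(flat_exp p has_real_derivative flat_exp (monom 1 2 * (p - pderiv p)) u) (at u)"
proof -
  consider "u > 0" | "u < 0" | "u = 0" by linarith
  then show ?thesis
  proof cases
    case 1
    have "((\<lambda>u. poly p (1 / u) * exp (- (1 / u))) has_real_derivative
        flat_exp (monom 1 2 * (p - pderiv p)) u) (at u)"
      using 1 by (auto intro!: derivative_eq_intros poly_DERIV DERIV_chain'[where g = "poly p"]
          simp: flat_exp_def poly_monom field_simps power2_eq_square)
    then show ?thesis
      by (rule DERIV_cong_ev[OF refl _ refl, THEN iffD2, rotated])
         (use 1 in \<open>auto simp: flat_exp_def eventually_at intro: eventually_mono[OF eventually_nhds_in_open[of "{0<..}"]]\<close>)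
  next
    case 2
    have "((\<lambda>u. 0) has_real_derivative flat_exp (monom 1 2 * (p - pderiv p)) u) (at u)"
      using 2 by (simp add: flat_exp_def)
    then show ?thesis
      by (rule DERIV_cong_ev[OF refl _ refl, THEN iffD2, rotated])
         (use 2 in \<open>auto simp: flat_exp_def intro: eventually_mono[OF eventually_nhds_in_open[of "{..<0}"]]\<close>)
  next
    case 3
    \<comment> \<open>The division by h in the difference quotient is absorbed as one more factor X
      of the polynomial.\<close>
    have "((\<lambda>h. poly ([:0, 1:] * p) (1 / h) * exp (- (1 / h))) \<longlongrightarrow> 0) (at_right (0::real))"
      by (rule filterlim_compose[OF poly_mult_exp_minus_tendsto_0])
         (simp add: divide_inverse filterlim_inverse_at_top_right)
    then have "((\<lambda>h. flat_exp p h / h) \<longlongrightarrow> 0) (at_right 0)"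
      by (rule Lim_transform_eventually)
         (rule eventually_mono[OF eventually_at_right_less], simp add: flat_exp_def)
    moreover have "((\<lambda>h. flat_exp p h / h) \<longlongrightarrow> 0) (at_left 0)"
      by (rule tendsto_eventually) (auto simp: flat_exp_def eventually_at_left_field intro: exI[of _ "-1"])
    ultimately have "((\<lambda>h. flat_exp p h / h) \<longlongrightarrow> 0) (at 0)"
      by (simp add: filterlim_split_at)
    then show ?thesis
      using 3 by (simp add: DERIV_def flat_exp_def)
  qed
qed

lemma C_k_flat_exp: "C_k k (\<lambda>x. flat_exp p (x \<bullet> v + \<theta>))"
proof -
  let ?q = "\<lambda>n. ((\<lambda>p. monom 1 2 * (p - pderiv p)) ^^ n) p"
  have "C_k k (\<lambda>x. (\<lambda>n. flat_exp (?q n)) 0 (x \<bullet> v + \<theta>))"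
    by (rule C_k_ridge) (simp add: flat_exp_has_derivative)
  then show ?thesis by simp
qed

lemma test_function_iff: "test_function \<phi> \<longleftrightarrow> (\<forall>k. C_k k \<phi>) \<and> bounded {x. \<phi> x \<noteq> 0}"
  unfolding test_function_def by (simp add: compact_eq_bounded_closed bounded_closure_image)
     (meson bounded_closure bounded_subset closure_subset)

text \<open>The value at \<open>0\<close> is all that matters: under dilation \<open>\<eta> (x / n)\<close> tends boundedly to \<open>\<eta> 0\<close>.\<close>

lemma ex_bump: "\<exists>\<eta> :: 'a::euclidean_space \<Rightarrow> real. test_function \<eta> \<and> \<eta> 0 = 1"
proof -
  \<comment> \<open>The factor for b is nonzero exactly when the coordinate along b lies strictly
    between -1 and 1; at the origin the two values exp(-1) are cancelled by exp 2.\<close>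
  define \<eta> :: "'a \<Rightarrow> real" where
    "\<eta> x = (\<Prod>b\<in>Basis. exp 2 * (flat_exp 1 (x \<bullet> b + 1) * flat_exp 1 (x \<bullet> (- b) + 1)))" for x
  have "C_k k \<eta>" for k
    unfolding \<eta>_def by (intro C_k_prod C_k_mult C_k_const C_k_flat_exp)
  moreover have "{x. \<eta> x \<noteq> 0} \<subseteq> cbox (- One) One"
    by (auto simp: \<eta>_def flat_exp_def mem_box split: if_splits) force+
  then have "bounded {x. \<eta> x \<noteq> 0}"
    using bounded_cbox bounded_subset by blast
  moreover have "\<eta> 0 = 1"
    by (simp add: \<eta>_def flat_exp_def flip: exp_add)
  ultimately show ?thesis by (auto simp: test_function_iff)
qed

lemma test_function_scale:
  assumes "test_function \<phi>" "c \<noteq> 0"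
  shows "test_function (\<lambda>x. \<phi> (c *\<^sub>R x))"
proof -
  have "{x. \<phi> (c *\<^sub>R x) \<noteq> 0} = (\<lambda>x. (1 / c) *\<^sub>R x) ` {x. \<phi> x \<noteq> 0}"
    using assms(2) by (auto simp: image_iff intro!: exI[of _ "c *\<^sub>R _"])
  then show ?thesis
    using assms by (auto simp: test_function_iff intro!: C_k_scale bounded_scaling)
qed

lemma test_function_mult:
  assumes "test_function \<phi>" "\<And>k. C_k k g"
  shows "test_function (\<lambda>x. \<phi> x * g x)"
  using assms by (auto simp: test_function_iff intro!: C_k_mult elim: bounded_subset)

lemma C_k_partial_deriv: "C_k (Suc k) f \<Longrightarrow> b \<in> Basis \<Longrightarrow> C_k k (partial_deriv b f)"
  by simp

lemma C_k_imp_continuous_on: "C_k k f \<Longrightarrow> continuous_on A f"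
proof (induction k)
  case 0
  then show ?case by (auto intro: continuous_on_subset)
qed (use C_k_SucD in blast)

text \<open>Off the closed support the function is locally zero, hence so is its derivative.\<close>

lemma test_function_partial_deriv:
  assumes "test_function \<phi>" "b \<in> Basis"
  shows "test_function (partial_deriv b \<phi>)"
proof -
  have "partial_deriv b \<phi> x = 0" if "x \<notin> closure {x. \<phi> x \<noteq> 0}" for x
  proof (rule partial_deriv_eqI[where f' = "\<lambda>_. 0"])
    show "(\<phi> has_derivative (\<lambda>_. 0)) (at x)"
      by (rule has_derivative_transform_within_open[where s = "- closure {x. \<phi> x \<noteq> 0}" and f = "\<lambda>_. 0"])
         (use that closure_subset[of "{x. \<phi> x \<noteq> 0}"] in auto)
  qed
  then have "{x. partial_deriv b \<phi> x \<noteq> 0} \<subseteq> closure {x. \<phi> x \<noteq> 0}" by auto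
  moreover have "bounded (closure {x. \<phi> x \<noteq> 0})"
    using assms by (simp add: test_function_iff bounded_closure)
  ultimately show ?thesis
    using assms by (metis C_k_partial_deriv bounded_subset test_function_iff)
qed

lemma test_function_continuous: "test_function \<phi> \<Longrightarrow> continuous_on A \<phi>"
  by (meson C_k_imp_continuous_on test_function_def)

lemma test_function_bounded:
  assumes "test_function \<phi>"
  obtains M where "M > 0" "\<And>x. \<bar>\<phi> x\<bar> \<le> M"
proof -
  have "compact (\<phi> ` closure {x. \<phi> x \<noteq> 0})"
    using assms by (intro compact_continuous_image test_function_continuous) (auto simp: test_function_def)
  then obtain M where M: "M > 0" "\<And>x. x \<in> closure {x. \<phi> x \<noteq> 0} \<Longrightarrow> \<bar>\<phi> x\<bar> \<le> M"
    by (auto dest!: compact_imp_bounded simp: bounded_pos)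
  have "\<bar>\<phi> x\<bar> \<le> M" for x
    using M closure_subset[of "{x. \<phi> x \<noteq> 0}"] by (cases "\<phi> x = 0") auto
  with M(1) show ?thesis by (rule that)
qed

lemma test_function_add: "test_function f \<Longrightarrow> test_function g \<Longrightarrow> test_function (\<lambda>x. f x + g x)"
  by (auto simp: test_function_iff intro!: C_k_add intro: bounded_subset[of "{x. f x \<noteq> 0} \<union> {x. g x \<noteq> 0}"])

lemma test_function_laplacian:
  assumes "test_function \<phi>"
  shows "test_function (laplacian \<phi>)"
proof -
  have *: "test_function (\<lambda>x. \<Sum>b\<in>B. g b x)"
    if "finite B" "\<And>b. test_function (g b)" for B :: "'a set" and g :: "'a \<Rightarrow> 'a \<Rightarrow> real"
    using that(1)
  proof (induction B rule: finite_induct)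
    case empty
    then show ?case by (simp add: test_function_iff C_k_const)
  next
    case (insert b B)
    then show ?case by (simp add: test_function_add that(2))
  qed
  \<comment> \<open>The guard makes every summand a test function, also for indices outside
    \<open>Basis\<close>, as the auxiliary claim demands.\<close>
  have "laplacian \<phi> = (\<lambda>x. \<Sum>b\<in>Basis. if b \<in> Basis then partial_deriv b (partial_deriv b \<phi>) x else 0)"
    by (simp add: laplacian_def[abs_def])
  moreover have "test_function (\<lambda>x. \<Sum>b\<in>Basis. if b \<in> Basis then partial_deriv b (partial_deriv b \<phi>) x else 0)"
  proof (rule *)
    show "test_function (\<lambda>x. if b \<in> Basis then partial_deriv b (partial_deriv b \<phi>) x else 0)" for b
      using assms by (cases "b \<in> Basis")
        (simp_all add: test_function_partial_deriv test_function_iff[of "\<lambda>_. 0"] C_k_const)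
  qed simp
  ultimately show ?thesis by simp
qed

section \<open>Fourier uniqueness on Euclidean space\<close>

text \<open>The phases 0 and -pi/2 give the real and imaginary parts of the characteristic function.
  Frequency 0 gives equal masses, so division by the common mass reduces the claim to uniqueness for
  probability laws; mass zero is treated apart.\<close>

lemma integral_cos_eq_imp_measure_eq_real:
  fixes M N :: "real measure"
  assumes "finite_measure M" "finite_measure N" and [measurable_cong, simp]: "sets M = sets borel" "sets N = sets borel"
    and eq: "\<And>t \<theta>. (LINT x|M. cos (t * x + \<theta>)) = (LINT x|N. cos (t * x + \<theta>))"
  shows "M = N"
proof -
  interpret M: finite_measure M by fact
  interpret N: finite_measure N by fact
  have sp: "space M = UNIV" "space N = UNIV"
    by (simp_all add: sets_eq_imp_space_eq[where M' = borel])
  define m where "m = measure M UNIV"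
  have mN: "measure N UNIV = m"
    using eq[of 0 0] by (simp add: m_def sp)
  have em: "emeasure M UNIV = ennreal m" "emeasure N UNIV = ennreal m"
    using mN M.emeasure_eq_measure N.emeasure_eq_measure by (simp_all add: m_def)
  show ?thesis
  proof (cases "m = 0")
    case True
    have "emeasure M A = 0" "emeasure N A = 0" for A
      using emeasure_space[of M A] emeasure_space[of N A] True em by (auto simp: sp)
    then show ?thesis by (intro measure_eqI) auto
  next
    case False
    then have m: "m > 0" by (simp add: m_def order_less_le)
    define M' where "M' = density M (\<lambda>_. ennreal (1 / m))"
    define N' where "N' = density N (\<lambda>_. ennreal (1 / m))"
    have eM: "emeasure M' A = ennreal (1 / m) * emeasure M A" if "A \<in> sets borel" for A
      using that by (simp add: M'_def emeasure_density_const)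
    have eN: "emeasure N' A = ennreal (1 / m) * emeasure N A" if "A \<in> sets borel" for A
      using that by (simp add: N'_def emeasure_density_const)
    have "M' = N'"
    proof (rule Levy_uniqueness)
      have 1: "ennreal (1 / m) * ennreal m = 1"
        using m by (simp flip: ennreal_mult')
      show "real_distribution M'"
        by (intro real_distribution.intro prob_spaceI real_distribution_axioms.intro)
           (simp_all add: M'_def eM[unfolded M'_def] sp em 1)
      show "real_distribution N'"
        by (intro real_distribution.intro prob_spaceI real_distribution_axioms.intro)
           (simp_all add: N'_def eN[unfolded N'_def] sp em 1)
      have iM: "integrable M (\<lambda>x. iexp (t * x))" for t
        by (rule M.integrable_const_bound[where B = 1]) auto
      have iN: "integrable N (\<lambda>x. iexp (t * x))" for t
        by (rule N.integrable_const_bound[where B = 1]) auto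
      have "(CLINT x|M. iexp (t * x)) = (CLINT x|N. iexp (t * x))" for t
      proof (rule complex_eqI)
        show "Re (CLINT x|M. iexp (t * x)) = Re (CLINT x|N. iexp (t * x))"
          using eq[of t 0] iM[of t] iN[of t] by (simp flip: integral_Re add: Re_exp)
        show "Im (CLINT x|M. iexp (t * x)) = Im (CLINT x|N. iexp (t * x))"
          using eq[of t "- pi / 2"] iM[of t] iN[of t]
          by (simp flip: integral_Im add: Im_exp cos_diff)
      qed
      then show "char M' = char N'"
        using m by (simp add: char_def[abs_def] M'_def N'_def integral_density)
    qed
    then have "emeasure M A = emeasure N A" if "A \<in> sets borel" for A
    proof -
      have "ennreal m * (ennreal (1 / m) * emeasure M A) = ennreal m * (ennreal (1 / m) * emeasure N A)"
        using \<open>M' = N'\<close> eM[OF that] eN[OF that] by simp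
      moreover have "ennreal m * ennreal (1 / m) = 1"
        using m by (simp flip: ennreal_mult')
      ultimately show ?thesis by (simp flip: mult.assoc)
    qed
    then show ?thesis by (intro measure_eqI) auto
  qed
qed

text \<open>One coordinate is treated at a time: weighting the measure by the nonnegative density
  \<open>1\<^sub>A (1 + cos)\<close> and projecting to the coordinate reduces the claim to the line.\<close>

lemma integral_cos_indicator_coordinate:
  fixes M N :: "'a::euclidean_space measure"
  assumes "borel_prob M" "borel_prob N" and A[measurable]: "A \<in> sets borel" and B[measurable]: "B \<in> sets borel"
    and eq: "\<And>\<xi> \<theta>. (LINT x|M. indicator A x * cos (x \<bullet> \<xi> + \<theta>)) = (LINT x|N. indicator A x * cos (x \<bullet> \<xi> + \<theta>))"
  shows "(LINT x|M. indicator (A \<inter> {x. x \<bullet> b \<in> B}) x * cos (x \<bullet> \<xi> + \<theta>)) =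
    (LINT x|N. indicator (A \<inter> {x. x \<bullet> b \<in> B}) x * cos (x \<bullet> \<xi> + \<theta>))"
proof -
  define w :: "'a \<Rightarrow> real \<Rightarrow> 'a \<Rightarrow> real" where
    "w \<xi> \<theta> x = indicator A x * (1 + cos (x \<bullet> \<xi> + \<theta>))" for \<xi> \<theta> x
  have w0: "0 \<le> w \<xi> \<theta> x" for \<xi> \<theta> x
    using cos_ge_minus_one[of "x \<bullet> \<xi> + \<theta>"] unfolding w_def by (intro mult_nonneg_nonneg; linarith?) auto
  have w2: "w \<xi> \<theta> x \<le> 2" for \<xi> \<theta> x
    using cos_le_one[of "x \<bullet> \<xi> + \<theta>"] by (auto simp: w_def split: split_indicator)
  have [measurable]: "w \<xi> \<theta> \<in> borel_measurable borel" for \<xi> \<theta>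
    unfolding w_def[abs_def] by measurable
  define proj where "proj K \<xi> \<theta> = distr (density K (\<lambda>x. ennreal (w \<xi> \<theta> x))) borel (\<lambda>x. x \<bullet> b)"
    for K and \<xi> \<theta>
  have fin: "finite_measure (proj K \<xi> \<theta>)"
    and int: "\<And>g. g \<in> borel_measurable borel \<Longrightarrow>
      (LINT y|proj K \<xi> \<theta>. g y) = (LINT x|K. w \<xi> \<theta> x * (g (x \<bullet> b) :: real))"
    and cint: "\<And>\<xi> \<theta>. integrable K (\<lambda>x. indicator A x * cos (x \<bullet> \<xi> + \<theta>))"
    and bint: "\<And>g. g \<in> borel_measurable borel \<Longrightarrow> (\<And>x. \<bar>g x :: real\<bar> \<le> 1) \<Longrightarrow>
        integrable K g"
    if K: "borel_prob K" for K \<xi> \<theta>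
  proof -
    interpret prob_space K using K by (simp add: borel_prob_def)
    have [measurable_cong, simp]: "sets K = sets borel" using K by (simp add: borel_prob_def)
    have [simp]: "space K = UNIV" by (simp add: sets_eq_imp_space_eq[where M' = borel])
    have "emeasure (proj K \<xi> \<theta>) UNIV = (\<integral>\<^sup>+x. ennreal (w \<xi> \<theta> x) \<partial>K)"
      unfolding proj_def by (subst emeasure_distr) (auto simp: emeasure_density)
    also have "\<dots> \<le> (\<integral>\<^sup>+x. 2 \<partial>K)"
      by (intro nn_integral_mono) (metis w2 ennreal_leI ennreal_numeral)
    also have "\<dots> < \<infinity>" by (simp add: emeasure_space_1[simplified])
    finally show "finite_measure (proj K \<xi> \<theta>)"
      by (intro finite_measureI) (simp add: proj_def)
    show "(LINT y|proj K \<xi> \<theta>. g y) = (LINT x|K. w \<xi> \<theta> x * g (x \<bullet> b))"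
      if [measurable]: "g \<in> borel_measurable borel" for g
      unfolding proj_def by (subst integral_distr; (subst integral_density)?) (auto simp: w0)
    show "integrable K (\<lambda>x. indicator A x * cos (x \<bullet> \<xi> + \<theta>))" for \<xi> \<theta>
      by (rule integrable_const_bound[where B = 1]) (auto split: split_indicator)
    show "integrable K g" if [measurable]: "g \<in> borel_measurable borel" and "\<And>x. \<bar>g x\<bar> \<le> 1" for g :: "'a \<Rightarrow> real"
      by (rule integrable_const_bound[where B = 1]) (use that in auto)
  qed
  have proj_eq: "proj M \<xi> \<theta> = proj N \<xi> \<theta>" for \<xi> \<theta>
  proof (rule integral_cos_eq_imp_measure_eq_real)
    fix t \<theta>'
    \<comment> \<open>Product to sum: the weight 1 + cos times a cosine is a combination of three
      cosines, each covered by the hypothesis.\<close>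
    have pt: "w \<xi> \<theta> x * cos (t * (x \<bullet> b) + \<theta>') = indicator A x * cos (x \<bullet> (t *\<^sub>R b) + \<theta>') +
        (1 / 2 * (indicator A x * cos (x \<bullet> (\<xi> + t *\<^sub>R b) + (\<theta> + \<theta>'))) +
         1 / 2 * (indicator A x * cos (x \<bullet> (\<xi> - t *\<^sub>R b) + (\<theta> - \<theta>'))))" for x
    proof -
      have "cos (x \<bullet> \<xi> + \<theta>) * cos (t * (x \<bullet> b) + \<theta>') =
        1 / 2 * cos (x \<bullet> (\<xi> + t *\<^sub>R b) + (\<theta> + \<theta>')) + 1 / 2 * cos (x \<bullet> (\<xi> - t *\<^sub>R b) + (\<theta> - \<theta>'))"
        by (subst cos_times_cos) (simp add: inner_simps algebra_simps add_divide_distrib)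
      then show ?thesis by (auto simp: w_def inner_simps algebra_simps split: split_indicator)
    qed
    have "(LINT y|proj K \<xi> \<theta>. cos (t * y + \<theta>')) = (LINT x|K. indicator A x * cos (x \<bullet> (t *\<^sub>R b) + \<theta>')) +
        (1 / 2 * (LINT x|K. indicator A x * cos (x \<bullet> (\<xi> + t *\<^sub>R b) + (\<theta> + \<theta>'))) +
         1 / 2 * (LINT x|K. indicator A x * cos (x \<bullet> (\<xi> - t *\<^sub>R b) + (\<theta> - \<theta>'))))"
      if K: "borel_prob K" for K
      by (subst int[OF K]) (simp_all only: pt Bochner_Integration.integral_add Bochner_Integration.integrable_add
            integrable_mult_right cint[OF K] integral_mult_right_zero, measurable)
    then show "(LINT y|proj M \<xi> \<theta>. cos (t * y + \<theta>')) = (LINT y|proj N \<xi> \<theta>. cos (t * y + \<theta>'))"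
      using assms(1,2) by (simp only: eq)
  qed (simp_all add: fin[OF assms(1)] fin[OF assms(2)], simp_all add: proj_def)
  have *: "(LINT x|M. w \<xi> \<theta> x * indicator B (x \<bullet> b)) = (LINT x|N. w \<xi> \<theta> x * indicator B (x \<bullet> b))" for \<xi> \<theta>
    using proj_eq[of \<xi> \<theta>] int[OF assms(1), of "indicator B" \<xi> \<theta>] int[OF assms(2), of "indicator B" \<xi> \<theta>] by simp
  \<comment> \<open>Frequency 0 with phase pi/2 leaves the indicator of A as weight; subtracting it
    removes the summand 1 that kept the weight nonnegative.\<close>
  have pt: "indicator (A \<inter> {x. x \<bullet> b \<in> B}) x * cos (x \<bullet> \<xi> + \<theta>) =
      w \<xi> \<theta> x * indicator B (x \<bullet> b) - w 0 (pi / 2) x * indicator B (x \<bullet> b)" for x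
    by (auto simp: w_def split: split_indicator)
  have "(LINT x|K. indicator (A \<inter> {x. x \<bullet> b \<in> B}) x * cos (x \<bullet> \<xi> + \<theta>)) =
      (LINT x|K. w \<xi> \<theta> x * indicator B (x \<bullet> b)) - (LINT x|K. w 0 (pi / 2) x * indicator B (x \<bullet> b))"
    if K: "borel_prob K" for K
  proof -
    \<comment> \<open>\<open>bint\<close> covers functions bounded by 1 whereas the weight is only
      bounded by 2, hence the division and multiplication by 2.\<close>
    have "integrable K (\<lambda>x. 2 * (w \<xi> \<theta> x * indicator B (x \<bullet> b) / 2))" for \<xi> \<theta>
      by (rule integrable_mult_right[OF bint[OF K]])
         (use w0[of \<xi> \<theta>] w2[of \<xi> \<theta>] in \<open>auto split: split_indicator simp: field_simps\<close>)
    then show ?thesis unfolding pt by (intro Bochner_Integration.integral_diff) simp_all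
  qed
  then show ?thesis using assms(1,2) by (simp add: *)
qed

text \<open>Coordinates are confined to intervals one after another; the cosine factor keeps an
  arbitrary frequency and phase so that the next restriction can use it. At the end frequency and
  phase 0 turn it into 1 and leave the measures of open boxes, an intersection-stable
  generator.\<close>

theorem integral_cos_eq_imp_measure_eq:
  fixes M N :: "'a::euclidean_space measure"
  assumes MN: "borel_prob M" "borel_prob N"
    and eq: "\<And>\<xi> \<theta>. (LINT x|M. cos (x \<bullet> \<xi> + \<theta>)) = (LINT x|N. cos (x \<bullet> \<xi> + \<theta>))"
  shows "M = N"
proof -
  interpret M: prob_space M using MN by (simp add: borel_prob_def)
  interpret N: prob_space N using MN by (simp add: borel_prob_def)
  have [simp]: "sets M = sets borel" "sets N = sets borel" using MN by (auto simp: borel_prob_def)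
  have *: "(LINT x|M. indicator {x. \<forall>b\<in>S. x \<bullet> b \<in> {l \<bullet> b<..<u \<bullet> b}} x * cos (x \<bullet> \<xi> + \<theta>)) =
      (LINT x|N. indicator {x. \<forall>b\<in>S. x \<bullet> b \<in> {l \<bullet> b<..<u \<bullet> b}} x * cos (x \<bullet> \<xi> + \<theta>))"
    if "finite S" for S and l u \<xi> :: 'a and \<theta>
    using that
  proof (induction S arbitrary: \<xi> \<theta> rule: finite_induct)
    case empty
    then show ?case using eq by simp
  next
    case (insert b S)
    have s: "{x. \<forall>b\<in>insert b S. x \<bullet> b \<in> {l \<bullet> b<..<u \<bullet> b}} =
        {x. \<forall>b\<in>S. x \<bullet> b \<in> {l \<bullet> b<..<u \<bullet> b}} \<inter> {x. x \<bullet> b \<in> {l \<bullet> b<..<u \<bullet> b}}" by auto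
    have "open (\<Inter>b\<in>S. {x. x \<bullet> b \<in> {l \<bullet> b<..<u \<bullet> b}})"
      using insert.hyps by (intro open_INT) (auto intro!: open_Collect_conj open_Collect_less continuous_intros)
    also have "(\<Inter>b\<in>S. {x. x \<bullet> b \<in> {l \<bullet> b<..<u \<bullet> b}}) = {x. \<forall>b\<in>S. x \<bullet> b \<in> {l \<bullet> b<..<u \<bullet> b}}" by auto
    finally show ?case
      unfolding s by (intro integral_cos_indicator_coordinate MN insert.IH) auto
  qed
  have box: "emeasure M (box l u) = emeasure N (box l u)" for l u :: 'a
  proof -
    have "{x. \<forall>b\<in>Basis. x \<bullet> b \<in> {l \<bullet> b<..<u \<bullet> b}} = box l u" by (auto simp: box_def)
    with *[of Basis l u 0 0] show ?thesis
      by (simp add: M.emeasure_eq_measure N.emeasure_eq_measure)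
  qed
  show ?thesis
  proof (rule measure_eqI_generator_eq)
    let ?E = "range (\<lambda>(a, b). box a b::'a set)"
    show "Int_stable ?E" by (auto simp: Int_stable_def box_Int_box)
    show "?E \<subseteq> Pow UNIV" "sets M = sigma_sets UNIV ?E" "sets N = sigma_sets UNIV ?E"
      by (simp_all add: borel_eq_box)
    let ?A = "\<lambda>n::nat. box (- (real n *\<^sub>R One)) (real n *\<^sub>R One) :: 'a set"
    show "range ?A \<subseteq> ?E" "(\<Union>i. ?A i) = UNIV" unfolding UN_box_eq_UNIV by auto
    show "emeasure M (?A i) \<noteq> \<infinity>" for i by simp
    show "emeasure M X = emeasure N X" if "X \<in> ?E" for X using that box by auto
  qed
qed

section \<open>The heat flow and its weak equation\<close>

text \<open>The mean value inequality turns the bound \<open>h\<close> on the derivative into the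
  same bound on difference quotients, so dominated convergence applies along every sequence tending
  to \<open>r0\<close>.\<close>

lemma has_real_derivative_integral:
  fixes f f' :: "real \<Rightarrow> 'b \<Rightarrow> real"
  assumes \<delta>: "\<delta> > 0"
    and int: "\<And>r. r \<in> ball r0 \<delta> \<Longrightarrow> integrable M (f r)"
    and der: "\<And>r x. r \<in> ball r0 \<delta> \<Longrightarrow> x \<in> space M \<Longrightarrow> ((\<lambda>r. f r x) has_real_derivative f' r x) (at r)"
    and bound: "\<And>r x. r \<in> ball r0 \<delta> \<Longrightarrow> x \<in> space M \<Longrightarrow> \<bar>f' r x\<bar> \<le> h x"
    and h: "integrable M h"
    and [measurable]: "f' r0 \<in> borel_measurable M"
  shows "((\<lambda>r. integral\<^sup>L M (f r)) has_real_derivative integral\<^sup>L M (f' r0)) (at r0)"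
proof -
  let ?B = "ball r0 \<delta>"
  have r0: "r0 \<in> ?B" using \<delta> by simp
  have "((\<lambda>r. (integral\<^sup>L M (f r) - integral\<^sup>L M (f r0)) / (r - r0)) \<longlongrightarrow> integral\<^sup>L M (f' r0)) (at r0 within ?B)"
    unfolding tendsto_at_iff_sequentially comp_def
  proof (intro allI impI)
    fix X assume X: "\<forall>i. X i \<in> ?B - {r0}" and lim: "X \<longlonglongrightarrow> r0"
    have "(\<lambda>i. LINT x|M. (f (X i) x - f r0 x) / (X i - r0)) \<longlonglongrightarrow> integral\<^sup>L M (f' r0)"
    proof (rule integral_dominated_convergence[where w = h])
      show "(\<lambda>x. (f (X i) x - f r0 x) / (X i - r0)) \<in> borel_measurable M" for i
        using int[of "X i"] int[OF r0] X by (intro borel_measurable_divide borel_measurable_diff) auto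
      show "AE x in M. (\<lambda>i. (f (X i) x - f r0 x) / (X i - r0)) \<longlonglongrightarrow> f' r0 x"
      proof (rule AE_I2)
        fix x assume x: "x \<in> space M"
        have "((\<lambda>r. (f r x - f r0 x) / (r - r0)) \<longlongrightarrow> f' r0 x) (at r0)"
          using der[OF r0 x] by (simp add: has_field_derivative_iff)
        moreover have "filterlim X (at r0) sequentially"
          using X lim by (auto simp: filterlim_at)
        ultimately show "(\<lambda>i. (f (X i) x - f r0 x) / (X i - r0)) \<longlonglongrightarrow> f' r0 x"
          by (rule filterlim_compose)
      qed
      show "AE x in M. norm ((f (X i) x - f r0 x) / (X i - r0)) \<le> h x" for i
      proof (rule AE_I2)
        fix x assume x: "x \<in> space M"
        have "norm (f (X i) x - f r0 x) \<le> h x * norm (X i - r0)"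
        proof (rule field_differentiable_bound[where S = ?B and f' = "\<lambda>r. f' r x"])
          show "((\<lambda>r. f r x) has_real_derivative f' r x) (at r within ?B)" if "r \<in> ?B" for r
            by (rule has_field_derivative_at_within[OF der[OF that x]])
          show "norm (f' r x) \<le> h x" if "r \<in> ?B" for r
            using bound[OF that x] by simp
        qed (use X r0 in auto)
        then show "norm ((f (X i) x - f r0 x) / (X i - r0)) \<le> h x"
          using X by (auto simp: divide_le_eq)
      qed
    qed (use h in auto)
    moreover have "(LINT x|M. (f (X i) x - f r0 x) / (X i - r0)) =
        (integral\<^sup>L M (f (X i)) - integral\<^sup>L M (f r0)) / (X i - r0)" for i
    proof -
      have "X i \<in> ?B" using X by auto
      then show ?thesis using int int[OF r0] by simp
    qed
    ultimately show "(\<lambda>i. (integral\<^sup>L M (f (X i)) - integral\<^sup>L M (f r0)) / (X i - r0)) \<longlonglongrightarrow> integral\<^sup>L M (f' r0)"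
      by (simp only:)
  qed
  then show ?thesis
    using r0 by (simp add: has_field_derivative_iff at_within_open[of r0 ?B])
qed

lemma lborel_integral_translate:
  fixes f :: "'a::euclidean_space \<Rightarrow> real"
  assumes [measurable]: "f \<in> borel_measurable borel"
  shows "(LINT x|lborel. f (x + c)) = (LINT x|lborel. f x)"
proof -
  have "(LINT x|lborel. f x) = (LINT x|distr lborel borel ((+) c). f x)"
    by (simp add: lborel_distr_plus)
  also have "\<dots> = (LINT x|lborel. f (x + c))"
    by (subst integral_distr) (auto simp: add.commute)
  finally show ?thesis by simp
qed

text \<open>\<open>\<integral>F(x + h b) dx\<close> does not depend on \<open>h\<close>; differentiate under the integral at \<open>h = 0\<close>.\<close>

lemma integral_directional_derivative_eq_0:
  fixes F G :: "'a::euclidean_space \<Rightarrow> real"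
  assumes b: "norm b = 1" and cont: "continuous_on UNIV F" "continuous_on UNIV G"
    and der: "\<And>x. ((\<lambda>h. F (x + h *\<^sub>R b)) has_real_derivative G x) (at 0)"
    and supp: "\<And>x. x \<notin> cball 0 R \<Longrightarrow> F x = 0" "\<And>x. x \<notin> cball 0 R \<Longrightarrow> G x = 0"
  shows "(LINT x|lborel. G x) = 0"
proof -
  have "bounded (G ` cball 0 R)"
    by (intro compact_imp_bounded compact_continuous_image continuous_on_subset[OF cont(2)]) auto
  then obtain B where "B > 0" "\<forall>y\<in>G ` cball 0 R. norm y \<le> B"
    unfolding bounded_pos by blast
  then have B: "\<And>x. x \<in> cball 0 R \<Longrightarrow> \<bar>G x\<bar> \<le> B" "B \<ge> 0" by auto
  have [measurable]: "F \<in> borel_measurable borel" "G \<in> borel_measurable borel"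
    using cont by (auto intro: borel_measurable_continuous_onI)
  have intF: "integrable lborel F"
  proof -
    have "integrable lborel (\<lambda>x. indicator (cball 0 R) x *\<^sub>R F x)"
      by (rule borel_integrable_compact) (use cont(1) continuous_on_subset in auto)
    also have "(\<lambda>x. indicator (cball 0 R) x *\<^sub>R F x) = F"
      using supp(1) by (auto split: split_indicator)
    finally show ?thesis .
  qed
  have "((\<lambda>h. LINT x|lborel. F (x + h *\<^sub>R b)) has_real_derivative (LINT x|lborel. G (x + 0 *\<^sub>R b))) (at 0)"
  proof (rule has_real_derivative_integral[where \<delta> = 1 and f = "\<lambda>h x. F (x + h *\<^sub>R b)" and f' = "\<lambda>h x. G (x + h *\<^sub>R b)"
        and h = "\<lambda>x. B * indicator (cball 0 (R + 1)) x"])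
    show "integrable lborel (\<lambda>x. F (x + r *\<^sub>R b))" for r
    proof -
      have "integrable (distr lborel borel ((+) (r *\<^sub>R b))) F" using intF by (simp add: lborel_distr_plus)
      then show ?thesis by (subst (asm) integrable_distr_eq) (auto simp: add.commute)
    qed
    show "((\<lambda>r. F (x + r *\<^sub>R b)) has_real_derivative G (x + r *\<^sub>R b)) (at r)" for r x
    proof -
      have "((\<lambda>s. F ((x + r *\<^sub>R b) + s *\<^sub>R b)) has_real_derivative G (x + r *\<^sub>R b)) (at (r + - r))"
        using der by simp
      then have "((\<lambda>s. F ((x + r *\<^sub>R b) + (s + - r) *\<^sub>R b)) has_real_derivative G (x + r *\<^sub>R b)) (at r)"
        unfolding DERIV_shift .
      then show ?thesis by (simp add: algebra_simps)
    qed
    \<comment> \<open>A shift by r b with |r| < 1 moves a point by less than 1, hence the radius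
      \<open>R + 1\<close> of the dominating indicator.\<close>
    show "\<bar>G (x + r *\<^sub>R b)\<bar> \<le> B * indicator (cball 0 (R + 1)) x" if "r \<in> ball 0 1" for r x
    proof (cases "x + r *\<^sub>R b \<in> cball 0 R")
      case True
      have "norm x \<le> norm (x + r *\<^sub>R b) + norm (r *\<^sub>R b)"
        by (metis norm_triangle_ineq4 add_diff_cancel)
      with True that b B show ?thesis by auto
    qed (use supp B in auto)
    show "integrable lborel (\<lambda>x::'a. B * indicator (cball 0 (R + 1)) x)"
      by (intro integrable_mult_right integrable_real_indicator) (auto intro: emeasure_bounded_finite[OF bounded_cball, simplified])
  qed auto
  moreover have "((\<lambda>h. LINT x|lborel. F (x + h *\<^sub>R b)) has_real_derivative 0) (at 0)"
    by (simp add: lborel_integral_translate)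
  ultimately show ?thesis using DERIV_unique by fastforce
qed

subsection \<open>The heat flow as the law of a sum\<close>

text \<open>With no factor 1/2 in front of the Laplacian, time 1 corresponds to variance 2 in each
  coordinate; this is the source of the standard deviation \<open>sqrt 2\<close> and of the factor 2
  in the integration by parts below.\<close>

definition gaussian :: "'a::euclidean_space measure" where
  "gaussian = density lborel (\<lambda>z. ennreal (heat_kernel 1 z))"

lemma heat_kernel_measurable[measurable]: "heat_kernel t \<in> borel_measurable borel"
  unfolding heat_kernel_def[abs_def] by measurable

lemma heat_kernel_nonneg: "heat_kernel t x \<ge> 0"
  by (simp add: heat_kernel_def)

lemma sets_gaussian[measurable_cong, simp]: "sets gaussian = sets borel"
  by (simp add: gaussian_def)

lemma space_gaussian[simp]: "space gaussian = UNIV"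
  by (simp add: gaussian_def)

lemma heat_kernel_1_eq_prod: "heat_kernel 1 z = (\<Prod>b\<in>Basis. normal_density 0 (sqrt 2) (z \<bullet> b))"
proof -
  have "(4 * pi) powr (- (real DIM('a) / 2)) = (1 / sqrt (4 * pi)) ^ DIM('a)"
  proof -
    have "1 / sqrt (4 * pi) = (4 * pi) powr (- (1/2))"
      by (simp add: powr_minus_divide powr_half_sqrt)
    also have "\<dots> ^ DIM('a) = (4 * pi) powr (- (real DIM('a) / 2))"
      by (subst powr_realpow[symmetric]) (simp_all add: powr_powr)
    finally show ?thesis ..
  qed
  moreover have "(norm z)\<^sup>2 = (\<Sum>b\<in>Basis. (z \<bullet> b)\<^sup>2)"
    unfolding power2_norm_eq_inner by (subst euclidean_inner) (simp add: power2_eq_square)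
  ultimately show ?thesis
    by (simp add: heat_kernel_def normal_density_def prod.distrib prod_dividef power_one_over sum_divide_distrib sum_negf
        flip: exp_sum)
qed

lemma prob_space_gaussian: "prob_space (gaussian :: 'a::euclidean_space measure)"
proof
  have "emeasure gaussian (space (gaussian :: 'a measure)) = (\<integral>\<^sup>+z. ennreal (heat_kernel 1 (z :: 'a)) \<partial>lborel)"
    by (simp add: gaussian_def emeasure_density)
  also have "\<dots> = (\<integral>\<^sup>+z. (\<Prod>b\<in>Basis. ennreal (normal_density 0 (sqrt 2) ((z :: 'a) \<bullet> b))) \<partial>lborel)"
    by (simp add: heat_kernel_1_eq_prod prod_ennreal)
  also have "\<dots> = (\<Prod>b\<in>(Basis :: 'a set). \<integral>\<^sup>+x. ennreal (normal_density 0 (sqrt 2) x) \<partial>lborel)"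
    by (rule nn_integral_lborel_prod) auto
  also have "(\<integral>\<^sup>+x. ennreal (normal_density 0 (sqrt 2) x) \<partial>lborel) = 1"
    using prob_space.emeasure_space_1[OF prob_space_normal_density[of "sqrt 2" 0]] by (simp add: emeasure_density)
  finally show "emeasure gaussian (space (gaussian :: 'a measure)) = 1" by simp
qed

interpretation gaussian: prob_space gaussian by (rule prob_space_gaussian)

text \<open>The power of \<open>sqrt \<beta>\<close> is the Jacobian of the dilation that relates
  the kernels at times 1 and \<beta>.\<close>

lemma heat_kernel_scale:
  fixes z :: "'a::euclidean_space"
  assumes "\<beta> > 0"
  shows "heat_kernel \<beta> (sqrt \<beta> *\<^sub>R z) * sqrt \<beta> ^ DIM('a) = heat_kernel 1 z"
proof -
  have "sqrt \<beta> ^ DIM('a) = \<beta> powr (real DIM('a) / 2)"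
    using assms by (simp add: powr_realpow[symmetric] powr_half_sqrt[symmetric] powr_powr)
  then have "(4 * pi * \<beta>) powr (- (real DIM('a) / 2)) * sqrt \<beta> ^ DIM('a) = (4 * pi) powr (- (real DIM('a) / 2))"
    using assms by (simp add: powr_mult powr_minus field_simps)
  moreover have "(norm (sqrt \<beta> *\<^sub>R z))\<^sup>2 / (4 * \<beta>) = (norm z)\<^sup>2 / 4"
    using assms by (simp add: power_mult_distrib)
  ultimately show ?thesis
    unfolding heat_kernel_def by (simp add: mult.assoc mult.left_commute[of _ "exp _"])
qed

text \<open>This is the law of Y + sqrt(\<beta>) Z with Y distributed as \<nu> and Z an independent
  Gaussian. The probability space no longer depends on the time, so continuity, differentiability
  and measurability in \<beta> become statements about integrands, and \<beta> = 0 is no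
  exception.\<close>

lemma heat_flow_eq_distr:
  fixes \<nu> :: "'a::euclidean_space measure"
  assumes \<nu>: "borel_prob \<nu>" and "\<beta> \<ge> 0"
  shows "heat_flow \<nu> \<beta> = distr (\<nu> \<Otimes>\<^sub>M gaussian) borel (\<lambda>p. fst p + sqrt \<beta> *\<^sub>R snd p)"
proof -
  interpret prob_space \<nu> using \<nu> by (simp add: borel_prob_def)
  have [measurable_cong, simp]: "sets \<nu> = sets borel" using \<nu> by (simp add: borel_prob_def)
  interpret P: pair_sigma_finite \<nu> "gaussian :: 'a measure" ..
  interpret Q: pair_sigma_finite \<nu> "lborel :: 'a measure" ..
  show ?thesis
  proof (cases "\<beta> = 0")
    case True
    have "distr (\<nu> \<Otimes>\<^sub>M (gaussian :: 'a measure)) borel fst = distr (\<nu> \<Otimes>\<^sub>M (gaussian :: 'a measure)) \<nu> fst"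
      by (rule distr_cong) auto
    also have "\<dots> = \<nu>"
    proof (rule measure_eqI)
      fix A assume "A \<in> sets (distr (\<nu> \<Otimes>\<^sub>M (gaussian :: 'a measure)) \<nu> fst)"
      then have A: "A \<in> sets \<nu>" by simp
      have "emeasure (\<nu> \<Otimes>\<^sub>M gaussian) (A \<times> (UNIV :: 'a set)) = emeasure \<nu> A"
        using A gaussian.emeasure_pair_measure_Times[of A \<nu> "UNIV :: 'a set"]
          gaussian.emeasure_space_1[where 'a = 'a] by simp
      moreover have "fst -` A \<inter> space (\<nu> \<Otimes>\<^sub>M (gaussian :: 'a measure)) = A \<times> UNIV"
        using sets.sets_into_space[OF A] by (auto simp: space_pair_measure)
      ultimately show "emeasure (distr (\<nu> \<Otimes>\<^sub>M (gaussian :: 'a measure)) \<nu> fst) A = emeasure \<nu> A"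
        using A by (simp add: emeasure_distr)
    qed simp
    finally show ?thesis using True by (simp add: heat_flow_def)
  next
    case False
    with assms have \<beta>: "\<beta> > 0" by simp
    show ?thesis
    proof (rule measure_eqI)
      fix A assume "A \<in> sets (heat_flow \<nu> \<beta>)"
      then have [measurable]: "A \<in> sets borel" using False by (simp add: heat_flow_def)
      have "emeasure (heat_flow \<nu> \<beta>) A =
          (\<integral>\<^sup>+x. (\<integral>\<^sup>+y. ennreal (heat_kernel \<beta> (x - y)) \<partial>\<nu>) * indicator A x \<partial>lborel)"
        using False by (simp add: heat_flow_def emeasure_density)
      also have "\<dots> = (\<integral>\<^sup>+x. (\<integral>\<^sup>+y. ennreal (heat_kernel \<beta> (x - y)) * indicator A x \<partial>\<nu>) \<partial>lborel)"
        by (intro nn_integral_cong nn_integral_multc[symmetric]) measurable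
      also have "\<dots> = (\<integral>\<^sup>+y. (\<integral>\<^sup>+x. ennreal (heat_kernel \<beta> (x - y)) * indicator A x \<partial>lborel) \<partial>\<nu>)"
        by (rule Q.Fubini') measurable
      also have "\<dots> = (\<integral>\<^sup>+y. (\<integral>\<^sup>+z. indicator A (y + sqrt \<beta> *\<^sub>R z) \<partial>gaussian) \<partial>\<nu>)"
      proof (rule nn_integral_cong)
        fix y
        have "(\<integral>\<^sup>+x. ennreal (heat_kernel \<beta> (x - y)) * indicator A x \<partial>lborel) =
            (\<integral>\<^sup>+z. ennreal (sqrt \<beta> ^ DIM('a)) *
               (ennreal (heat_kernel \<beta> (sqrt \<beta> *\<^sub>R z)) * indicator A (y + sqrt \<beta> *\<^sub>R z)) \<partial>lborel)"
          using \<beta> by (subst lborel_affine[of "sqrt \<beta>" y]) (auto simp: nn_integral_density nn_integral_distr)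
        also have "\<dots> = (\<integral>\<^sup>+z. ennreal (heat_kernel 1 z) * indicator A (y + sqrt \<beta> *\<^sub>R z) \<partial>lborel)"
          using \<beta> by (simp flip: heat_kernel_scale add: ennreal_mult heat_kernel_nonneg mult_ac)
        finally show "(\<integral>\<^sup>+x. ennreal (heat_kernel \<beta> (x - y)) * indicator A x \<partial>lborel) =
            (\<integral>\<^sup>+z. indicator A (y + sqrt \<beta> *\<^sub>R z) \<partial>gaussian)"
          by (simp add: gaussian_def nn_integral_density)
      qed
      also have "\<dots> = (\<integral>\<^sup>+p. indicator A (fst p + sqrt \<beta> *\<^sub>R snd p) \<partial>(\<nu> \<Otimes>\<^sub>M gaussian))"
        by (subst gaussian.nn_integral_fst[symmetric]) auto
      also have "\<dots> = (\<integral>\<^sup>+x. indicator A x \<partial>distr (\<nu> \<Otimes>\<^sub>M gaussian) borel (\<lambda>p. fst p + sqrt \<beta> *\<^sub>R snd p))"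
        by (subst nn_integral_distr) auto
      also have "\<dots> = emeasure (distr (\<nu> \<Otimes>\<^sub>M gaussian) borel (\<lambda>p. fst p + sqrt \<beta> *\<^sub>R snd p)) A"
        by simp
      finally show "emeasure (heat_flow \<nu> \<beta>) A = \<dots>" .
    qed (use False in \<open>simp add: heat_flow_def\<close>)
  qed
qed


section \<open>Integrals of functions against the heat flow\<close>

lemma
  fixes \<nu> :: "'a::euclidean_space measure"
  assumes "borel_prob \<nu>"
  shows prob_space_pair_gaussian: "prob_space (\<nu> \<Otimes>\<^sub>M (gaussian :: 'a measure))"
    and sets_pair_gaussian: "sets (\<nu> \<Otimes>\<^sub>M (gaussian :: 'a measure)) = sets (borel \<Otimes>\<^sub>M borel)"
proof -
  interpret prob_space \<nu> using assms by (simp add: borel_prob_def)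
  show "prob_space (\<nu> \<Otimes>\<^sub>M (gaussian :: 'a measure))"
    by (intro prob_space_pair prob_space_axioms prob_space_gaussian)
  show "sets (\<nu> \<Otimes>\<^sub>M (gaussian :: 'a measure)) = sets (borel \<Otimes>\<^sub>M borel)"
    using assms by (intro sets_pair_measure_cong) (auto simp: borel_prob_def)
qed

lemma borel_prob_heat_flow:
  fixes \<nu> :: "'a::euclidean_space measure"
  assumes "borel_prob \<nu>" "\<beta> \<ge> 0"
  shows "borel_prob (heat_flow \<nu> \<beta>)"
proof -
  note [measurable_cong] = sets_pair_gaussian[OF assms(1)]
  interpret prob_space "\<nu> \<Otimes>\<^sub>M (gaussian :: 'a measure)" using assms(1) by (rule prob_space_pair_gaussian)
  show ?thesis
    by (simp add: heat_flow_eq_distr[OF assms] borel_prob_def prob_space_distr)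
qed

lemma integral_heat_flow:
  fixes g :: "'a::euclidean_space \<Rightarrow> real"
  assumes "borel_prob \<nu>" "\<beta> \<ge> 0" and [measurable]: "g \<in> borel_measurable borel"
  shows "(LINT x|heat_flow \<nu> \<beta>. g x) = (LINT p|(\<nu> \<Otimes>\<^sub>M gaussian). g (fst p + sqrt \<beta> *\<^sub>R snd p))"
proof -
  note [measurable_cong] = sets_pair_gaussian[OF assms(1)]
  show ?thesis
    by (simp add: heat_flow_eq_distr[OF assms(1,2)] integral_distr)
qed

text \<open>On the product space the integral makes sense for every real argument,
  \<open>sqrt\<close> being odd, so Borel measurability can be claimed on the whole line and then
  composed with a clock.\<close>

lemma measurable_integral_pair_gaussian:
  fixes g :: "'a::euclidean_space \<Rightarrow> real"
  assumes "borel_prob \<nu>" and [measurable]: "g \<in> borel_measurable borel"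
  shows "(\<lambda>\<beta>. LINT p|(\<nu> \<Otimes>\<^sub>M gaussian). g (fst p + sqrt \<beta> *\<^sub>R snd p)) \<in> borel_measurable borel"
proof -
  note [measurable_cong] = sets_pair_gaussian[OF assms(1)]
  interpret prob_space "\<nu> \<Otimes>\<^sub>M (gaussian :: 'a measure)" using assms(1) by (rule prob_space_pair_gaussian)
  show ?thesis by measurable
qed

text \<open>Since |z| <= 2 exp(|z|^2 / 8), the kernel at time 1 times |z| is at most a constant
  multiple of the kernel at time 2. The latter has mass 1, being the density of the heat flow of a
  Dirac measure. \<open>C\<close> is that factor 2 times the quotient of the normalising
  constants.\<close>

lemma integrable_norm_gaussian: "integrable gaussian (\<lambda>z::'a::euclidean_space. norm z)"
proof (rule integrableI_bounded)
  have "borel_prob (heat_flow (return borel (0::'a)) 2)"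
    by (intro borel_prob_heat_flow) (auto simp: borel_prob_def prob_space_return)
  then have "emeasure (heat_flow (return borel (0::'a)) 2) UNIV = 1"
    using prob_space.emeasure_space_1[of "heat_flow (return borel (0::'a)) 2"]
    by (simp add: borel_prob_def sets_eq_imp_space_eq[where M' = borel])
  then have hk2: "(\<integral>\<^sup>+z. ennreal (heat_kernel 2 (z::'a)) \<partial>lborel) = 1"
    by (simp add: heat_flow_def emeasure_density nn_integral_return)
  define C where "C = 2 * (4 * pi) powr (- (real DIM('a) / 2)) / (4 * pi * 2) powr (- (real DIM('a) / 2))"
  have C: "heat_kernel 1 z * norm z \<le> C * heat_kernel 2 z" for z :: 'a
  proof -
    have "norm z \<le> 2 * (1 + (norm z)\<^sup>2 / 8)"
      using zero_le_power2[of "norm z / 2 - 1"] by (simp add: power2_eq_square field_simps)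
    also have "\<dots> \<le> 2 * exp ((norm z)\<^sup>2 / 8)"
      by (intro mult_left_mono exp_ge_add_one_self) simp
    finally have "heat_kernel 1 z * norm z \<le> heat_kernel 1 z * (2 * exp ((norm z)\<^sup>2 / 8))"
      by (intro mult_left_mono heat_kernel_nonneg)
    also have "\<dots> = C * heat_kernel 2 z"
      by (simp add: C_def heat_kernel_def flip: exp_add)
    finally show ?thesis .
  qed
  have "C \<ge> 0" by (simp add: C_def)
  have "(\<integral>\<^sup>+z. ennreal (norm (norm (z::'a))) \<partial>gaussian) = (\<integral>\<^sup>+z. ennreal (heat_kernel 1 (z::'a) * norm z) \<partial>lborel)"
    unfolding gaussian_def by (subst nn_integral_density) (auto simp: ennreal_mult heat_kernel_nonneg)
  also have "\<dots> \<le> (\<integral>\<^sup>+z. ennreal C * ennreal (heat_kernel 2 (z::'a)) \<partial>lborel)"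
    using C \<open>C \<ge> 0\<close> by (intro nn_integral_mono) (simp add: heat_kernel_nonneg flip: ennreal_mult)
  also have "\<dots> = ennreal C" by (simp add: nn_integral_cmult hk2)
  finally show "(\<integral>\<^sup>+z. ennreal (norm (norm (z::'a))) \<partial>gaussian) < \<infinity>"
    by (simp add: order.strict_trans1)
qed simp

section \<open>Gaussian integration by parts and the weak heat equation\<close>

lemma integral_gaussian:
  fixes g :: "'a::euclidean_space \<Rightarrow> real"
  assumes "g \<in> borel_measurable borel"
  shows "(LINT z|gaussian. g z) = (LINT z|lborel. heat_kernel 1 z * g z)"
  unfolding gaussian_def using assms by (subst integral_density) (auto simp: heat_kernel_nonneg)

lemma test_function_measurable: "test_function \<phi> \<Longrightarrow> \<phi> \<in> borel_measurable borel"
  by (rule borel_measurable_continuous_onI) (rule test_function_continuous)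

text \<open>Stein's identity: the b-derivative of the kernel at time 1 is -(z . b)/2 times the
  kernel, and the b-derivative of the compactly supported product of \<psi>(y + r z) with the kernel
  integrates to zero.\<close>

lemma gaussian_integration_by_parts:
  fixes \<psi> :: "'a::euclidean_space \<Rightarrow> real"
  assumes \<psi>: "test_function \<psi>" and b: "b \<in> Basis" and r: "r > 0"
  shows "(LINT z|gaussian. \<psi> (y + r *\<^sub>R z) * (z \<bullet> b)) = 2 * r * (LINT z|gaussian. partial_deriv b \<psi> (y + r *\<^sub>R z))"
proof -
  let ?\<psi>' = "partial_deriv b \<psi>"
  have \<psi>': "test_function ?\<psi>'" using \<psi> b by (rule test_function_partial_deriv)
  have "bounded ({x. \<psi> x \<noteq> 0} \<union> {x. ?\<psi>' x \<noteq> 0})"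
    using \<psi> \<psi>' by (simp add: test_function_iff)
  then obtain R0 where R0: "\<And>x. \<psi> x \<noteq> 0 \<or> ?\<psi>' x \<noteq> 0 \<Longrightarrow> norm x \<le> R0"
    by (auto simp: bounded_iff)
  \<comment> \<open>Beyond this radius y + r z has norm above \<open>R0\<close>, where \<psi> and
    its partial derivative vanish.\<close>
  define R where "R = (R0 + norm y) / r"
  have R: "\<psi> (y + r *\<^sub>R z) = 0 \<and> ?\<psi>' (y + r *\<^sub>R z) = 0" if "norm z > R" for z
  proof (rule ccontr)
    assume "\<not> ?thesis"
    then have "norm (y + r *\<^sub>R z) \<le> R0" by (intro R0) auto
    moreover have "norm (r *\<^sub>R z) \<le> norm (y + r *\<^sub>R z) + norm y"
      by (metis add.commute add_diff_cancel_left' norm_triangle_ineq4)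
    ultimately show False using that r by (simp add: R_def field_simps)
  qed
  have [measurable]: "\<psi> \<in> borel_measurable borel" "?\<psi>' \<in> borel_measurable borel"
    using \<psi> \<psi>' by (auto intro: test_function_measurable)
  have c: "continuous_on UNIV (\<lambda>z. \<psi> (y + r *\<^sub>R z))" "continuous_on UNIV (\<lambda>z. ?\<psi>' (y + r *\<^sub>R z))"
    by (rule continuous_on_compose2[OF test_function_continuous[OF \<psi>]] continuous_on_compose2[OF test_function_continuous[OF \<psi>']];
        auto intro!: continuous_intros)+
  have ck: "continuous_on UNIV (heat_kernel 1 :: 'a \<Rightarrow> real)"
    unfolding heat_kernel_def[abs_def] by (intro continuous_intros) auto
  have "(LINT z|lborel. (r * ?\<psi>' (y + r *\<^sub>R z) - \<psi> (y + r *\<^sub>R z) * (z \<bullet> b) / 2) * heat_kernel 1 z) = 0"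
  proof (rule integral_directional_derivative_eq_0[where F = "\<lambda>z. \<psi> (y + r *\<^sub>R z) * heat_kernel 1 z" and b = b and R = R])
    fix z
    have "(\<psi> has_derivative (\<lambda>h. \<Sum>b\<in>Basis. (h \<bullet> b) * partial_deriv b \<psi> (y + r *\<^sub>R z))) (at (y + r *\<^sub>R z))"
      by (rule C_k_Suc_has_derivative[where k = 0]) (use \<psi> in \<open>auto simp only: test_function_iff\<close>)
    then have "(\<psi> has_derivative (\<lambda>h. \<Sum>b\<in>Basis. (h \<bullet> b) * partial_deriv b \<psi> (y + r *\<^sub>R z))) (at (y + r *\<^sub>R (z + 0 *\<^sub>R b)))"
      by simp
    moreover have "((\<lambda>h. y + r *\<^sub>R (z + h *\<^sub>R b)) has_derivative (\<lambda>h. r *\<^sub>R (h *\<^sub>R b))) (at 0)"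
      by (auto intro!: derivative_eq_intros)
    ultimately have "((\<lambda>h. \<psi> (y + r *\<^sub>R (z + h *\<^sub>R b))) has_derivative
        (\<lambda>h. \<Sum>c\<in>Basis. (r *\<^sub>R (h *\<^sub>R b) \<bullet> c) * partial_deriv c \<psi> (y + r *\<^sub>R z))) (at 0)"
      by (rule has_derivative_compose[rotated])
    also have "(\<lambda>h. \<Sum>c\<in>Basis. (r *\<^sub>R (h *\<^sub>R b) \<bullet> c) * partial_deriv c \<psi> (y + r *\<^sub>R z)) =
        (\<lambda>h. h * (r * ?\<psi>' (y + r *\<^sub>R z)))"
      using sum_Basis_inner[OF b, of "\<lambda>b. partial_deriv b \<psi> (y + r *\<^sub>R z)"]
      by (simp add: mult.assoc mult.left_commute flip: sum_distrib_left)
    finally have "((\<lambda>h. \<psi> (y + r *\<^sub>R (z + h *\<^sub>R b))) has_derivative (\<lambda>h. h * (r * ?\<psi>' (y + r *\<^sub>R z)))) (at 0)" .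
    then have d1: "((\<lambda>h. \<psi> (y + r *\<^sub>R (z + h *\<^sub>R b))) has_real_derivative r * ?\<psi>' (y + r *\<^sub>R z)) (at 0)"
      by (simp add: has_field_derivative_def mult.commute[of _ "r * _"])
    have n: "(norm (z + h *\<^sub>R b))\<^sup>2 = (norm z)\<^sup>2 + 2 * h * (z \<bullet> b) + h\<^sup>2" for h
      unfolding power2_norm_eq_inner using b by (simp add: inner_simps inner_commute power2_eq_square algebra_simps)
    have d2: "((\<lambda>h. heat_kernel 1 (z + h *\<^sub>R b)) has_real_derivative - (z \<bullet> b) / 2 * heat_kernel 1 z) (at 0)"
      unfolding heat_kernel_def n by (auto intro!: derivative_eq_intros)
    show "((\<lambda>h. \<psi> (y + r *\<^sub>R (z + h *\<^sub>R b)) * heat_kernel 1 (z + h *\<^sub>R b)) has_real_derivative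
        (r * ?\<psi>' (y + r *\<^sub>R z) - \<psi> (y + r *\<^sub>R z) * (z \<bullet> b) / 2) * heat_kernel 1 z) (at 0)"
      using DERIV_mult[OF d1 d2] by (simp add: algebra_simps)
  qed (use b R c ck in \<open>auto intro!: continuous_intros\<close>)
  moreover have "(LINT z|lborel. (r * ?\<psi>' (y + r *\<^sub>R z) - \<psi> (y + r *\<^sub>R z) * (z \<bullet> b) / 2) * heat_kernel 1 z) =
      (LINT z|gaussian. r * ?\<psi>' (y + r *\<^sub>R z) - \<psi> (y + r *\<^sub>R z) * (z \<bullet> b) / 2)"
    by (subst integral_gaussian) (auto simp: mult.commute)
  moreover have "integrable gaussian (\<lambda>z. r * ?\<psi>' (y + r *\<^sub>R z))"
  proof -
    obtain M where "\<And>x. \<bar>?\<psi>' x\<bar> \<le> M" using test_function_bounded[OF \<psi>'] by blast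
    then show ?thesis by (intro integrable_mult_right gaussian.integrable_const_bound[where B = M]) auto
  qed
  moreover have "integrable gaussian (\<lambda>z. \<psi> (y + r *\<^sub>R z) * (z \<bullet> b))"
  proof -
    obtain M where M: "\<And>x. \<bar>\<psi> x\<bar> \<le> M" using test_function_bounded[OF \<psi>] by blast
    show ?thesis
    proof (rule Bochner_Integration.integrable_bound[OF integrable_mult_right[OF integrable_norm_gaussian, of M]])
      show "AE z in gaussian. norm (\<psi> (y + r *\<^sub>R z) * (z \<bullet> b)) \<le> norm (M * norm z)"
        using M b by (auto simp: abs_mult intro!: mult_mono Basis_le_norm order_trans[OF M abs_ge_self])
    qed auto
  qed
  ultimately show ?thesis using r by simp
qed

text \<open>The derivative in r of the mean of \<phi>(Y + sqrt(r) Z) is the mean of Z . grad \<phi>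
  divided by 2 sqrt(r). Integration by parts trades each coordinate of Z for 2 sqrt(r) times a
  derivative, which cancels the singular factor and leaves the Laplacian.\<close>

theorem integral_heat_flow_test_function:
  fixes \<phi> :: "'a::euclidean_space \<Rightarrow> real"
  assumes \<nu>: "borel_prob \<nu>" and \<phi>: "test_function \<phi>" and \<beta>: "\<beta> \<ge> 0"
  shows "(LINT x|heat_flow \<nu> \<beta>. \<phi> x) =
    (LINT x|\<nu>. \<phi> x) + (LINT r:{0..\<beta>}|lborel. (LINT x|heat_flow \<nu> r. laplacian \<phi> x))"
proof -
  let ?P = "\<nu> \<Otimes>\<^sub>M (gaussian :: 'a measure)"
  note [measurable_cong] = sets_pair_gaussian[OF \<nu>]
  interpret P: prob_space ?P using \<nu> by (rule prob_space_pair_gaussian)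
  interpret N: prob_space \<nu> using \<nu> by (simp add: borel_prob_def)
  interpret PP: pair_sigma_finite \<nu> "gaussian :: 'a measure" ..
  define g where "g \<psi> r = (LINT p|?P. \<psi> (fst p + sqrt r *\<^sub>R snd p))" for \<psi> :: "'a \<Rightarrow> real" and r
  have g: "(LINT x|heat_flow \<nu> r. \<psi> x) = g \<psi> r" if "test_function \<psi>" "r \<ge> 0" for \<psi> r
    unfolding g_def by (rule integral_heat_flow[OF \<nu> that(2) test_function_measurable[OF that(1)]])
  have cont: "continuous_on A (g \<psi>)" if \<psi>: "test_function \<psi>" for \<psi> A
  proof (rule continuous_at_imp_continuous_on, rule ballI)
    fix r
    obtain M where M: "\<And>x. \<bar>\<psi> x\<bar> \<le> M" using test_function_bounded[OF \<psi>] by blast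
    have [measurable]: "\<psi> \<in> borel_measurable borel" using \<psi> by (rule test_function_measurable)
    show "isCont (g \<psi>) r"
      unfolding continuous_at_sequentially comp_def g_def
    proof (intro allI impI)
      fix X assume X: "X \<longlonglongrightarrow> r"
      show "(\<lambda>n. LINT p|?P. \<psi> (fst p + sqrt (X n) *\<^sub>R snd p)) \<longlonglongrightarrow> (LINT p|?P. \<psi> (fst p + sqrt r *\<^sub>R snd p))"
      proof (rule integral_dominated_convergence[where w = "\<lambda>_. M"])
        have "isCont \<psi> x" for x
          using test_function_continuous[OF \<psi>, of UNIV] by (simp add: continuous_on_eq_continuous_at)
        then show "AE p in ?P. (\<lambda>n. \<psi> (fst p + sqrt (X n) *\<^sub>R snd p)) \<longlonglongrightarrow> \<psi> (fst p + sqrt r *\<^sub>R snd p)"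
          by (intro AE_I2 isCont_tendsto_compose[where g = \<psi>] tendsto_intros X)
      qed (use M in auto)
    qed
  qed
  have L: "test_function (laplacian \<phi>)" using \<phi> by (rule test_function_laplacian)
  have d: "(g \<phi> has_real_derivative g (laplacian \<phi>) r0) (at r0)" if r0: "r0 > 0" for r0
  proof -
    have t1: "test_function (partial_deriv b \<phi>)" if "b \<in> Basis" for b
      using \<phi> that by (rule test_function_partial_deriv)
    have t2: "test_function (partial_deriv b (partial_deriv b \<phi>))" if "b \<in> Basis" for b
      using t1[OF that] that by (rule test_function_partial_deriv)
    note m [measurable] = test_function_measurable[OF \<phi>] test_function_measurable[OF L]
      test_function_measurable[OF t1] test_function_measurable[OF t2]
    have "\<forall>b\<in>Basis. \<exists>M. \<forall>x. \<bar>partial_deriv b \<phi> x\<bar> \<le> M"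
      using test_function_bounded[OF t1] by metis
    then obtain M where M: "\<And>b x. b \<in> Basis \<Longrightarrow> \<bar>partial_deriv b \<phi> x\<bar> \<le> M b" by metis
    define f' where "f' r p = (\<Sum>b\<in>Basis. (snd p \<bullet> b) * partial_deriv b \<phi> (fst p + sqrt r *\<^sub>R snd p)) / (2 * sqrt r)"
      for r and p :: "'a \<times> 'a"
    have int_norm: "integrable ?P (\<lambda>p. norm (snd p))"
      using integrable_norm_gaussian[where 'a = 'a] by (intro PP.Fubini_integrable) auto
    have "((\<lambda>r. LINT p|?P. \<phi> (fst p + sqrt r *\<^sub>R snd p)) has_real_derivative (LINT p|?P. f' r0 p)) (at r0)"
    \<comment> \<open>On this ball r >= r0/2, so the factor 1/(2 sqrt(r)) is bounded by its value at
      r0/2.\<close>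
    proof (rule has_real_derivative_integral[where \<delta> = "r0 / 2" and f = "\<lambda>r p. \<phi> (fst p + sqrt r *\<^sub>R snd p)"
          and h = "\<lambda>p. (\<Sum>b\<in>Basis. M b) / (2 * sqrt (r0 / 2)) * norm (snd p)"])
      show "integrable ?P (\<lambda>p. \<phi> (fst p + sqrt r *\<^sub>R snd p))" for r
      proof -
        obtain M where "\<And>x. \<bar>\<phi> x\<bar> \<le> M" using test_function_bounded[OF \<phi>] by blast
        then show ?thesis by (intro P.integrable_const_bound[where B = M]) auto
      qed
      fix r and p :: "'a \<times> 'a" assume "r \<in> ball r0 (r0 / 2)"
      then have "\<bar>r0 - r\<bar> < r0 / 2" by (simp add: dist_real_def)
      then have r: "r0 / 2 \<le> r" "r > 0" using r0 by linarith+
      have "(\<phi> has_derivative (\<lambda>h. \<Sum>b\<in>Basis. (h \<bullet> b) * partial_deriv b \<phi> (fst p + sqrt r *\<^sub>R snd p))) (at (fst p + sqrt r *\<^sub>R snd p))"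
        by (rule C_k_Suc_has_derivative[where k = 0]) (use \<phi> in \<open>auto simp only: test_function_iff\<close>)
      moreover have "((\<lambda>r. fst p + sqrt r *\<^sub>R snd p) has_derivative (\<lambda>h. (h / (2 * sqrt r)) *\<^sub>R snd p)) (at r)"
        using r by (auto intro!: derivative_eq_intros simp: field_simps)
      ultimately have "((\<lambda>r. \<phi> (fst p + sqrt r *\<^sub>R snd p)) has_derivative
          (\<lambda>h. \<Sum>b\<in>Basis. ((h / (2 * sqrt r)) *\<^sub>R snd p \<bullet> b) * partial_deriv b \<phi> (fst p + sqrt r *\<^sub>R snd p))) (at r)"
        by (rule has_derivative_compose[rotated])
      also have "(\<lambda>h. \<Sum>b\<in>Basis. ((h / (2 * sqrt r)) *\<^sub>R snd p \<bullet> b) * partial_deriv b \<phi> (fst p + sqrt r *\<^sub>R snd p)) = (*) (f' r p)"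
        by (auto simp: f'_def sum_distrib_left sum_distrib_right sum_divide_distrib mult_ac intro!: ext sum.cong)
      finally show "((\<lambda>r. \<phi> (fst p + sqrt r *\<^sub>R snd p)) has_real_derivative f' r p) (at r)"
        by (simp add: has_field_derivative_def)
      have "\<bar>\<Sum>b\<in>Basis. (snd p \<bullet> b) * partial_deriv b \<phi> (fst p + sqrt r *\<^sub>R snd p)\<bar> \<le> (\<Sum>b\<in>Basis. norm (snd p) * M b)"
        by (intro order_trans[OF sum_abs] sum_mono) (auto simp: abs_mult intro!: mult_mono M Basis_le_norm)
      then have "\<bar>f' r p\<bar> \<le> (\<Sum>b\<in>Basis. norm (snd p) * M b) / (2 * sqrt r)"
        using r by (simp add: f'_def divide_right_mono)
      also have "\<dots> \<le> (\<Sum>b\<in>Basis. norm (snd p) * M b) / (2 * sqrt (r0 / 2))"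
        using r r0 M by (intro divide_left_mono sum_nonneg mult_nonneg_nonneg) (auto intro: order_trans[OF abs_ge_zero M])
      finally show "\<bar>f' r p\<bar> \<le> (\<Sum>b\<in>Basis. M b) / (2 * sqrt (r0 / 2)) * norm (snd p)"
        by (simp add: mult.commute flip: sum_distrib_left sum_distrib_right)
    next
      show "integrable ?P (\<lambda>p. (\<Sum>b\<in>Basis. M b) / (2 * sqrt (r0 / 2)) * norm (snd p))"
        using int_norm by (rule integrable_mult_right)
    next
      show "f' r0 \<in> borel_measurable ?P" unfolding f'_def[abs_def] by measurable
    qed (use r0 in auto)
    moreover have "(LINT p|?P. f' r0 p) = g (laplacian \<phi>) r0"
    proof -
      have i1: "integrable ?P (\<lambda>p. (snd p \<bullet> b) * partial_deriv b \<phi> (fst p + sqrt r0 *\<^sub>R snd p))" if "b \<in> Basis" for b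
      proof (rule Bochner_Integration.integrable_bound[OF integrable_mult_right[OF int_norm, of "M b"]])
        show "AE p in ?P. norm ((snd p \<bullet> b) * partial_deriv b \<phi> (fst p + sqrt r0 *\<^sub>R snd p)) \<le> norm (M b * norm (snd p))"
          using M[OF that] that
          by (auto simp: abs_mult mult.commute[of "\<bar>snd _ \<bullet> b\<bar>"] intro!: mult_mono Basis_le_norm order_trans[OF M[OF that] abs_ge_self])
      qed (use that in measurable)
      have i2: "integrable ?P (\<lambda>p. partial_deriv b (partial_deriv b \<phi>) (fst p + sqrt r0 *\<^sub>R snd p))" if b: "b \<in> Basis" for b
      proof -
        obtain M where "\<And>x. \<bar>partial_deriv b (partial_deriv b \<phi>) x\<bar> \<le> M" using test_function_bounded[OF t2[OF b]] by blast
        then show ?thesis using b by (intro P.integrable_const_bound[where B = M]) auto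
      qed
      have "(LINT p|?P. (snd p \<bullet> b) * partial_deriv b \<phi> (fst p + sqrt r0 *\<^sub>R snd p)) =
          2 * sqrt r0 * (LINT p|?P. partial_deriv b (partial_deriv b \<phi>) (fst p + sqrt r0 *\<^sub>R snd p))" if b: "b \<in> Basis" for b
      proof -
        have "(LINT p|?P. (snd p \<bullet> b) * partial_deriv b \<phi> (fst p + sqrt r0 *\<^sub>R snd p)) =
            (LINT y|\<nu>. LINT z|gaussian. partial_deriv b \<phi> (y + sqrt r0 *\<^sub>R z) * (z \<bullet> b))"
          using PP.integral_fst'[OF i1[OF b]] by (simp add: mult.commute)
        also have "\<dots> = (LINT y|\<nu>. 2 * sqrt r0 * (LINT z|gaussian. partial_deriv b (partial_deriv b \<phi>) (y + sqrt r0 *\<^sub>R z)))"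
          using r0 by (simp add: gaussian_integration_by_parts[OF t1[OF b] b])
        also have "\<dots> = 2 * sqrt r0 * (LINT p|?P. partial_deriv b (partial_deriv b \<phi>) (fst p + sqrt r0 *\<^sub>R snd p))"
          using PP.integral_fst'[OF i2[OF b]] by simp
        finally show ?thesis .
      qed
      then show ?thesis
        using r0 i1 i2 by (simp add: f'_def g_def laplacian_def sum_distrib_left[symmetric])
    qed
    ultimately show ?thesis by (simp add: g_def[abs_def])
  qed
  \<comment> \<open>The derivative is known only at positive times; at 0 the interior form of the
    fundamental theorem asks for continuity alone.\<close>
  have "(g (laplacian \<phi>) has_integral (g \<phi> \<beta> - g \<phi> 0)) {0..\<beta>}"
    using \<beta> d by (intro fundamental_theorem_of_calculus_interior cont \<phi>)
      (auto simp flip: has_real_derivative_iff_has_vector_derivative)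
  moreover have "set_integrable lborel {0..\<beta>} (g (laplacian \<phi>))"
    by (rule borel_integrable_atLeastAtMost') (rule cont[OF L])
  ultimately have "(LINT r:{0..\<beta>}|lborel. g (laplacian \<phi>) r) = g \<phi> \<beta> - g \<phi> 0"
    by (simp add: set_borel_integral_eq_integral integral_unique)
  moreover have "(LINT r:{0..\<beta>}|lborel. (LINT x|heat_flow \<nu> r. laplacian \<phi> x)) = (LINT r:{0..\<beta>}|lborel. g (laplacian \<phi>) r)"
    by (intro set_lebesgue_integral_cong) (auto simp: g[OF L])
  moreover have "g \<phi> 0 = (LINT x|\<nu>. \<phi> x)"
    using g[OF \<phi>, of 0] by (simp add: heat_flow_def)
  ultimately show ?thesis using g[OF \<phi> \<beta>] by simp
qed

section \<open>Time changes\<close>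

lemma borel_measurable_completion_AE:
  fixes f g :: "'b \<Rightarrow> 'c::topological_space"
  assumes f: "f \<in> borel_measurable M" and eq: "AE x in M. f x = g x"
  shows "g \<in> borel_measurable (completion M)"
proof (rule measurableI)
  fix A :: "'c set" assume "A \<in> sets borel"
  then have *: "f -` A \<inter> space M \<in> sets (completion M)"
    using f by (auto intro: measurable_sets)
  show "g -` A \<inter> space (completion M) \<in> sets (completion M)"
    by (rule completion.in_sets_AE[OF _ *]) (use eq in \<open>auto intro!: AE_completion elim: AE_mp\<close>)
qed simp

lemma has_bochner_integral_completion_AE:
  fixes f g :: "'b \<Rightarrow> real"
  assumes "has_bochner_integral M f I" and eq: "AE x in M. f x = g x"
  shows "has_bochner_integral (completion M) g I"
proof -
  have f: "f \<in> borel_measurable M" using assms(1) by (auto simp: has_bochner_integral_iff)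
  have "has_bochner_integral (completion M) f I"
    using assms(1) f by (simp add: has_bochner_integral_iff integrable_completion integral_completion)
  moreover have "g \<in> borel_measurable (completion M)"
    using f eq by (rule borel_measurable_completion_AE)
  moreover have "AE x in completion M. f x = g x" using eq by (rule AE_completion)
  ultimately show ?thesis
    by (subst has_bochner_integral_cong_AE[of g _ f]) (auto simp: f measurable_completion)
qed

text \<open>The truncation at zero and the cutoff to \<open>S\<close> make sign and support hold
  everywhere; an arbitrary Borel representative has them only almost everywhere.\<close>

lemma set_integrable_lebesgue_borel_version:
  fixes w :: "real \<Rightarrow> real"
  assumes w: "set_integrable lebesgue S w" and [measurable]: "S \<in> sets borel"
    and nonneg: "\<forall>s\<in>S. w s \<ge> 0"
  obtains w0 where "w0 \<in> borel_measurable borel" "\<And>s. w0 s \<ge> 0" "integrable lborel w0"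
    "\<And>s. s \<notin> S \<Longrightarrow> w0 s = 0" "AE s in lborel. s \<in> S \<longrightarrow> w0 s = w s"
proof -
  from w have "(\<lambda>s. indicator S s * w s) \<in> borel_measurable (completion lborel)"
    by (auto simp: set_integrable_def)
  from completion_ex_borel_measurable_real[OF this]
  obtain g where g: "g \<in> borel_measurable lborel" and ae: "AE s in lborel. indicator S s * w s = g s"
    by blast
  have [measurable]: "g \<in> borel_measurable borel" using g by simp
  define w0 where "w0 s = indicator S s * max 0 (g s)" for s
  have ae0: "AE s in lborel. w0 s = indicator S s * w s"
    using ae
  proof eventually_elim
    case (elim s)
    then show ?case using bspec[OF nonneg, of s] by (auto simp: w0_def split: split_indicator_asm)
  qed
  show ?thesis
  proof (rule that[of w0])
    show m: "w0 \<in> borel_measurable borel" unfolding w0_def[abs_def] by measurable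
    have "integrable (completion lborel) w0"
      using w ae0 unfolding set_integrable_def
      by (subst integrable_cong_AE[of w0 _ "\<lambda>s. indicator S s *\<^sub>R w s"])
         (auto intro!: AE_completion simp: m measurable_completion)
    then show "integrable lborel w0" using m by (simp add: integrable_completion)
    show "AE s in lborel. s \<in> S \<longrightarrow> w0 s = w s"
      using ae0 by eventually_elim auto
  qed (auto simp: w0_def)
qed

text \<open>Time changes are studied first for a Borel density that is nonnegative and integrable on
  the whole line. Lebesgue measurable coefficients are fed in through a representative: integrals,
  hence clocks, do not see the difference.\<close>

locale density_clock =
  fixes w :: "real \<Rightarrow> real" and p c :: real
  assumes w_borel[measurable]: "w \<in> borel_measurable borel" and w_nonneg: "w s \<ge> 0"
    and w_int: "integrable lborel w"
begin

definition W :: "real \<Rightarrow> real" where "W t = c + (LINT s:{p..t}|lborel. w s)"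

lemma set_int: "A \<in> sets borel \<Longrightarrow> set_integrable lborel A w"
  unfolding set_integrable_def by (rule integrable_mult_indicator) (auto simp: w_int)

lemma W_diff:
  assumes "p \<le> s" "s \<le> t"
  shows "W t - W s = (LINT u:{s<..t}|lborel. w u)"
proof -
  have "{p..t} = {p..s} \<union> {s<..t}" using assms by auto
  then have "(LINT u:{p..t}|lborel. w u) = (LINT u:{p..s}|lborel. w u) + (LINT u:{s<..t}|lborel. w u)"
    by (metis (no_types, lifting) set_integral_Un set_int Int_emptyI atLeastAtMost_borel atLeastAtMost_iff
        greaterThanAtMost_borel greaterThanAtMost_iff not_less)
  then show ?thesis by (simp add: W_def)
qed

lemma nn_integral_Ioc:
  assumes "p \<le> s" "s \<le> t"
  shows "(\<integral>\<^sup>+u\<in>{s<..t}. ennreal (w u) \<partial>lborel) = ennreal (W t - W s)"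
proof -
  have "(\<integral>\<^sup>+u\<in>{s<..t}. ennreal (w u) \<partial>lborel) = (\<integral>\<^sup>+u. ennreal (indicator {s<..t} u *\<^sub>R w u) \<partial>lborel)"
    by (intro nn_integral_cong) (auto split: split_indicator)
  also have "\<dots> = ennreal (LINT u:{s<..t}|lborel. w u)"
    unfolding set_lebesgue_integral_def using set_int[of "{s<..t}"]
    by (intro nn_integral_eq_integral) (auto simp: w_nonneg set_integrable_def)
  finally show ?thesis using W_diff[OF assms] by simp
qed

text \<open>Up to time \<open>p\<close> the clock rests, which makes it monotone, and therefore
  Borel, on the whole line.\<close>

lemma W_start: "t \<le> p \<Longrightarrow> W t = c"
proof -
  assume "t \<le> p"
  then have "AE s in lborel. indicator {p..t} s *\<^sub>R w s = 0"
    using AE_lborel_singleton[of p] by (auto split: split_indicator)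
  then have "(LINT s:{p..t}|lborel. w s) = 0"
    unfolding set_lebesgue_integral_def by (rule integral_eq_zero_AE)
  then show ?thesis by (simp add: W_def)
qed

lemma W_mono: "mono W"
proof (rule monoI)
  fix s t :: real assume "s \<le> t"
  have *: "W s \<le> W t" if "p \<le> s" "s \<le> t" for s t
  proof -
    have "(LINT u:{s<..t}|lborel. w u) \<ge> 0"
      unfolding set_lebesgue_integral_def by (intro integral_nonneg_AE) (auto simp: w_nonneg)
    then show ?thesis using W_diff[OF that] by simp
  qed
  show "W s \<le> W t"
  proof (cases "p \<le> s")
    case False
    then show ?thesis using *[of p "max p t"] W_start[of s] W_start[of p] W_start[of t] \<open>s \<le> t\<close>
      by (cases "p \<le> t") auto
  qed (use * \<open>s \<le> t\<close> in blast)
qed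

lemma W_borel[measurable]: "W \<in> borel_measurable borel"
  by (rule borel_measurable_mono) (rule W_mono)

lemma W_cont: "continuous_on {p..q} W"
proof -
  have s: "set_integrable lborel {p..t} w" for t by (rule set_int) simp
  have "continuous_on {p..q} (\<lambda>t. integral {p..t} w)"
    by (rule indefinite_integral_continuous_1) (rule set_borel_integral_eq_integral(1)[OF s])
  then show ?thesis
    unfolding W_def[abs_def] set_borel_integral_eq_integral(2)[OF s] by (intro continuous_intros)
qed

text \<open>It suffices to compare the masses of half-lines. For a level x between c and W t let s0
  be the last time in [p,t] at which the clock shows x. Then W > x holds exactly on (s0,t], whose
  mass is W t - W s0 = W t - x. Flat pieces of the clock do no harm, and nothing is
  differentiated.\<close>

theorem distr_W:
  assumes pt: "p \<le> t"
  shows "distr (density lborel (\<lambda>s. ennreal (indicator {p..t} s * w s))) borel W =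
    density lborel (\<lambda>r. ennreal (indicator {c..W t} r))" (is "?L = ?R")
proof (rule measure_eqI_lessThan)
  have cW: "c \<le> W s" for s using monoD[OF W_mono, of "min p s" s] W_start[of "min p s"] by simp
  have L: "emeasure ?L {x<..} = (\<integral>\<^sup>+s. ennreal (w s) * indicator {s\<in>{p..t}. x < W s} s \<partial>lborel)" for x
  proof -
    have "emeasure ?L {x<..} = (\<integral>\<^sup>+s. ennreal (indicator {p..t} s * w s) * indicator (W -` {x<..}) s \<partial>lborel)"
      using measurable_sets[OF W_borel, of "{x<..}"] by (subst emeasure_distr) (auto simp: emeasure_density)
    also have "\<dots> = (\<integral>\<^sup>+s. ennreal (w s) * indicator {s\<in>{p..t}. x < W s} s \<partial>lborel)"
      by (intro nn_integral_cong) (auto split: split_indicator)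
    finally show ?thesis .
  qed
  have R: "emeasure ?R {x<..} = emeasure lborel ({c..W t} \<inter> {x<..})" for x
  proof -
    have "emeasure ?R {x<..} = (\<integral>\<^sup>+r. indicator ({c..W t} \<inter> {x<..}) r \<partial>lborel)"
      by (subst emeasure_density, simp, simp, intro nn_integral_cong) (auto split: split_indicator)
    then show ?thesis by simp
  qed
  show eq: "emeasure ?L {x<..} = emeasure ?R {x<..}" for x
  proof -
    consider "W t \<le> x" | "x < c" | "c \<le> x" "x < W t" by linarith
    then show ?thesis
    proof cases
      case 1
      then have "\<not> x < W s" if "s \<in> {p..t}" for s using monoD[OF W_mono, of s t] that by auto
      then have "{s\<in>{p..t}. x < W s} = {}" by blast
      moreover have "{c..W t} \<inter> {x<..} = {}" using 1 by auto
      ultimately show ?thesis by (simp add: L R)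
    next
      case 2
      then have e: "{s\<in>{p..t}. x < W s} = {p..t}" "{c..W t} \<inter> {x<..} = {c..W t}"
        using cW by (auto intro: less_le_trans)
      have "(\<integral>\<^sup>+s. ennreal (w s) * indicator {p..t} s \<partial>lborel) = (\<integral>\<^sup>+s. ennreal (w s) * indicator {p<..t} s \<partial>lborel)"
        by (rule nn_integral_cong_AE) (use AE_lborel_singleton[of p] in \<open>auto split: split_indicator\<close>)
      then show ?thesis unfolding L R e using nn_integral_Ioc[OF order_refl pt] W_start[of p] cW by simp
    next
      case 3
      let ?S = "{s\<in>{p..t}. W s = x}"
      have "?S \<noteq> {}"
        using IVT'[of W p x t] 3 pt W_start[of p] W_cont by auto
      moreover have "compact ?S"
      proof -
        have "closed ({p..t} \<inter> W -` {x})"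
          by (rule continuous_closed_preimage[OF W_cont]) auto
        moreover have "{p..t} \<inter> W -` {x} = ?S" by auto
        moreover have "bounded ?S" by (rule bounded_subset[of "{p..t}"]) auto
        ultimately show ?thesis by (simp add: compact_eq_bounded_closed)
      qed
      ultimately obtain s0 where s0: "s0 \<in> ?S" "\<forall>s\<in>?S. s \<le> s0" using compact_attains_sup by blast
      have e: "{s\<in>{p..t}. x < W s} = {s0<..t}"
      proof (intro equalityI subsetI)
        fix s assume "s \<in> {s\<in>{p..t}. x < W s}"
        then show "s \<in> {s0<..t}" using s0(1) monoD[OF W_mono, of s s0] by (cases "s \<le> s0") auto
      next
        fix s assume s: "s \<in> {s0<..t}"
        then have "x \<le> W s" using s0(1) monoD[OF W_mono, of s0 s] by auto
        moreover have "W s \<noteq> x"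
        proof
          assume "W s = x"
          with s s0(1) have "s \<in> ?S" by simp
          then have "s \<le> s0" using s0(2) by blast
          with s show False by simp
        qed
        ultimately show "s \<in> {s\<in>{p..t}. x < W s}" using s s0(1) by auto
      qed
      have "{c..W t} \<inter> {x<..} = {x<..W t}" using 3 by auto
      then show ?thesis unfolding L R e using nn_integral_Ioc[of s0 t] s0(1) 3 by simp
    qed
  qed
  show "emeasure ?L {x<..} < \<infinity>" for x
  proof -
    have "emeasure lborel ({c..W t} \<inter> {x<..}) \<le> emeasure lborel {c..W t}" by (intro emeasure_mono) auto
    also have "\<dots> < \<infinity>" by (simp add: emeasure_lborel_Icc_eq)
    finally show ?thesis by (simp only: eq R)
  qed
qed auto

lemma nn_integral_substitution:
  assumes "p \<le> t" and [measurable]: "k \<in> borel_measurable borel"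
  shows "(\<integral>\<^sup>+s\<in>{p..t}. ennreal (w s) * k (W s) \<partial>lborel) = (\<integral>\<^sup>+r\<in>{c..W t}. k r \<partial>lborel)"
proof -
  have "(\<integral>\<^sup>+s\<in>{p..t}. ennreal (w s) * k (W s) \<partial>lborel) =
      (\<integral>\<^sup>+r. k r \<partial>distr (density lborel (\<lambda>s. ennreal (indicator {p..t} s * w s))) borel W)"
    by (subst nn_integral_distr, measurable, subst nn_integral_density)
       (auto intro!: nn_integral_cong split: split_indicator)
  also have "\<dots> = (\<integral>\<^sup>+r\<in>{c..W t}. k r \<partial>lborel)"
    unfolding distr_W[OF assms(1)] by (subst nn_integral_density) (auto intro!: nn_integral_cong split: split_indicator)
  finally show ?thesis .
qed

lemma integral_substitution:
  fixes k :: "real \<Rightarrow> real"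
  assumes "p \<le> t" and [measurable]: "k \<in> borel_measurable borel"
  shows "(LINT s:{p..t}|lborel. w s * k (W s)) = (LINT r:{c..W t}|lborel. k r)"
proof -
  have "(LINT s:{p..t}|lborel. w s * k (W s)) =
      (LINT r|distr (density lborel (\<lambda>s. ennreal (indicator {p..t} s * w s))) borel W. k r)"
    unfolding set_lebesgue_integral_def
    by (subst integral_distr, measurable, subst integral_density)
       (auto simp: w_nonneg mult.assoc)
  also have "\<dots> = (LINT r:{c..W t}|lborel. k r)"
    unfolding distr_W[OF assms(1)] set_lebesgue_integral_def by (subst integral_density) auto
  finally show ?thesis .
qed

end

section \<open>Clocks with a Lebesgue measurable density\<close>

lemma set_integral_lebesgue_AE:
  fixes f g :: "real \<Rightarrow> real"
  assumes "set_integrable lborel S f" and "AE s in lborel. s \<in> S \<longrightarrow> f s = g s"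
  shows "set_integrable lebesgue S g" "(LINT s:S|lebesgue. g s) = (LINT s:S|lborel. f s)"
proof -
  have "has_bochner_integral (completion lborel) (\<lambda>s. indicator S s *\<^sub>R g s) (LINT s:S|lborel. f s)"
    by (rule has_bochner_integral_completion_AE[where f = "\<lambda>s. indicator S s *\<^sub>R f s"])
       (use assms in \<open>auto simp: has_bochner_integral_iff set_integrable_def set_lebesgue_integral_def split: split_indicator\<close>)
  then show "set_integrable lebesgue S g" "(LINT s:S|lebesgue. g s) = (LINT s:S|lborel. f s)"
    by (auto simp: has_bochner_integral_iff set_integrable_def set_lebesgue_integral_def)
qed

text \<open>Boundedness of \<open>k\<close> gives integrability by comparison with a multiple of the
  density; that \<open>k\<close> is Borel makes its composition with the clock measurable. The last
  three conclusions concern the clock alone, and later proofs extract them by taking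
  \<open>k\<close> to be zero.\<close>

theorem clock_substitution:
  fixes \<alpha> k :: "real \<Rightarrow> real"
  assumes \<alpha>: "set_integrable lebesgue {0..T} \<alpha>" "\<forall>s\<in>{0..T}. \<alpha> s \<ge> 0"
    and k[measurable]: "k \<in> borel_measurable borel" and t: "t \<in> {0..T}"
    and bound: "\<And>r. \<bar>k r\<bar> \<le> B"
  defines "\<beta> \<equiv> \<lambda>t. LINT s:{0..t}|lebesgue. \<alpha> s"
  shows "set_integrable lebesgue {0..t} (\<lambda>s. \<alpha> s * k (\<beta> s))"
    and "(LINT s:{0..t}|lebesgue. \<alpha> s * k (\<beta> s)) = (LINT r:{0..\<beta> t}|lborel. k r)"
    and "continuous_on {0..T} \<beta>" and "mono_on {0..T} \<beta>" and "\<beta> 0 = 0"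
proof -
  obtain w where w: "w \<in> borel_measurable borel" "\<And>s. w s \<ge> 0" "integrable lborel w"
    "\<And>s. s \<notin> {0..T} \<Longrightarrow> w s = 0" "AE s in lborel. s \<in> {0..T} \<longrightarrow> w s = \<alpha> s"
    by (rule set_integrable_lebesgue_borel_version[OF \<alpha>(1) atLeastAtMost_borel \<alpha>(2)]) (rule that; assumption)
  interpret density_clock w 0 0 by unfold_locales (use w in auto)
  \<comment> \<open>Replacing the coefficient by its representative leaves the clock unchanged at
    every time, not just at almost every time.\<close>
  have \<beta>: "\<beta> s = W s" if "s \<in> {0..T}" for s
  proof -
    have "(LINT u:{0..s}|lebesgue. \<alpha> u) = (LINT u:{0..s}|lborel. w u)"
      by (rule set_integral_lebesgue_AE(2)[OF set_int]) (use w(5) that in auto)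
    then show ?thesis by (simp add: \<beta>_def W_def)
  qed
  have i: "set_integrable lborel {0..t} (\<lambda>s. w s * k (W s))"
    unfolding set_integrable_def
  proof (rule Bochner_Integration.integrable_bound[OF integrable_mult_right[OF w_int, of B]])
    show "AE s in lborel. norm (indicator {0..t} s *\<^sub>R (w s * k (W s))) \<le> norm (B * w s)"
    proof (rule AE_I2)
      fix s
      have "\<bar>k (W s)\<bar> \<le> \<bar>B\<bar>" using bound[of "W s"] by linarith
      then have "w s * \<bar>k (W s)\<bar> \<le> w s * \<bar>B\<bar>" by (rule mult_left_mono) (rule w_nonneg)
      then show "norm (indicator {0..t} s *\<^sub>R (w s * k (W s))) \<le> norm (B * w s)"
        using w_nonneg[of s] by (simp add: abs_mult mult.commute split: split_indicator)
    qed
  qed measurable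
  have ae: "AE s in lborel. s \<in> {0..t} \<longrightarrow> w s * k (W s) = \<alpha> s * k (\<beta> s)"
    using w(5)
  proof eventually_elim
    case (elim s)
    show ?case
    proof
      assume "s \<in> {0..t}"
      then have "s \<in> {0..T}" using t by simp
      then show "w s * k (W s) = \<alpha> s * k (\<beta> s)" using elim \<beta> by simp
    qed
  qed
  show "set_integrable lebesgue {0..t} (\<lambda>s. \<alpha> s * k (\<beta> s))"
    using i ae by (rule set_integral_lebesgue_AE(1))
  show "(LINT s:{0..t}|lebesgue. \<alpha> s * k (\<beta> s)) = (LINT r:{0..\<beta> t}|lborel. k r)"
    unfolding set_integral_lebesgue_AE(2)[OF i ae] \<beta>[OF t] by (rule integral_substitution) (use t in auto)
  show "continuous_on {0..T} \<beta>"
    using W_cont[of T] by (rule continuous_on_eq) (simp add: \<beta>)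
  show "mono_on {0..T} \<beta>"
    using W_mono by (auto simp: mono_on_def mono_def \<beta>)
  show "\<beta> 0 = 0" using \<beta>[of 0] W_start[of 0] t by auto
qed

text \<open>\<open>w\<close> is only Lebesgue measurable, so measurability of \<open>w \<circ> V\<close> needs that \<open>W\<close> maps
  null sets to null sets; the substitution rule for indicators provides this.\<close>

theorem inverse_clock:
  fixes w :: "real \<Rightarrow> real" and p q c :: real
  assumes "p < q" and w: "set_integrable lebesgue {p..q} w" and pos: "\<forall>s\<in>{p<..q}. w s > 0"
    and wp: "w p \<ge> 0"
  defines "W \<equiv> \<lambda>t. c + (LINT s:{p..t}|lebesgue. w s)"
  obtains V where "continuous_on {c..W q} V" "\<And>s. s \<in> {p..q} \<Longrightarrow> V (W s) = s"
    "\<And>s. s \<in> {p..q} \<Longrightarrow> W s \<in> {c..W q}"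
    "\<And>r. r \<in> {c..W q} \<Longrightarrow> V r \<in> {p..q} \<and> W (V r) = r"
    "set_integrable lebesgue {c..W q} (\<lambda>r. 1 / w (V r))"
    "\<And>t. t \<in> {p..q} \<Longrightarrow> (LINT r:{c..W t}|lebesgue. 1 / w (V r)) = t - p"
proof -
  \<comment> \<open>The left end point stands apart because the density is zero there in both
    applications: once as \<open>f 0\<close>, once as \<open>1 / f 0\<close>, a division by
    zero.\<close>
  have nonneg: "\<forall>s\<in>{p..q}. w s \<ge> 0"
  proof
    fix s assume "s \<in> {p..q}"
    then show "w s \<ge> 0" using bspec[OF pos, of s] wp by (cases "s = p") auto
  qed
  obtain w0 where w0: "w0 \<in> borel_measurable borel" "\<And>s. w0 s \<ge> 0" "integrable lborel w0"
    "\<And>s. s \<notin> {p..q} \<Longrightarrow> w0 s = 0" and ae: "AE s in lborel. s \<in> {p..q} \<longrightarrow> w0 s = w s"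
    by (rule set_integrable_lebesgue_borel_version[OF w atLeastAtMost_borel nonneg]) (rule that; assumption)
  interpret C: density_clock w0 p c by unfold_locales (use w0 in auto)
  have W: "W s = C.W s" if "s \<in> {p..q}" for s
  proof -
    have "(LINT u:{p..s}|lebesgue. w u) = (LINT u:{p..s}|lborel. w0 u)"
      by (rule set_integral_lebesgue_AE(2)[OF C.set_int]) (use ae that in auto)
    then show ?thesis by (simp add: W_def C.W_def)
  qed
  have ae_pos: "AE s in lborel. s \<in> {p..q} \<longrightarrow> w0 s > 0"
    using ae AE_lborel_singleton[of p] by eventually_elim (use pos in auto)
  \<comment> \<open>If the clock stood still on (s,t], its density would vanish almost everywhere
    there, against almost sure positivity.\<close>
  have strict: "C.W s < C.W t" if st: "p \<le> s" "s < t" "t \<le> q" for s t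
  proof (rule ccontr)
    assume "\<not> C.W s < C.W t"
    then have "(\<integral>\<^sup>+u\<in>{s<..t}. ennreal (w0 u) \<partial>lborel) = 0"
      using C.nn_integral_Ioc[of s t] st by (simp add: ennreal_neg)
    then have "AE u in lborel. ennreal (w0 u) * indicator {s<..t} u = 0"
      by (subst (asm) nn_integral_0_iff_AE) auto
    with ae_pos have "AE u in lborel. u \<notin> {s<..t}"
      by eventually_elim (use st in \<open>auto split: split_indicator_asm\<close>)
    then have "emeasure lborel {s<..t} = 0"
      by (subst (asm) AE_iff_measurable[of "{s<..t}"]) auto
    with st show False by simp
  qed
  have inj: "inj_on C.W {p..q}"
    by (intro linorder_inj_onI') (use strict in force)
  define V where "V = the_inv_into {p..q} C.W"
  have img: "C.W ` {p..q} = {c..C.W q}"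
  proof
    show "C.W ` {p..q} \<subseteq> {c..C.W q}"
    proof
      fix r assume "r \<in> C.W ` {p..q}"
      then obtain s where s: "s \<in> {p..q}" "r = C.W s" by blast
      then have "C.W p \<le> C.W s" "C.W s \<le> C.W q" by (auto intro: monoD[OF C.W_mono])
      with s C.W_start[of p] show "r \<in> {c..C.W q}" by simp
    qed
    show "{c..C.W q} \<subseteq> C.W ` {p..q}"
    proof
      fix r assume "r \<in> {c..C.W q}"
      then have "\<exists>s\<ge>p. s \<le> q \<and> C.W s = r"
        using IVT'[of C.W p r q] C.W_start[of p] C.W_cont \<open>p < q\<close> by simp
      then show "r \<in> C.W ` {p..q}" by auto
    qed
  qed
  have VW: "V (C.W s) = s" if "s \<in> {p..q}" for s
    unfolding V_def using inj that by (rule the_inv_into_f_f)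
  have WV: "V r \<in> {p..q} \<and> C.W (V r) = r" if "r \<in> {c..C.W q}" for r
  proof -
    from that img obtain s where "s \<in> {p..q}" "r = C.W s" by blast
    then show ?thesis using VW by simp
  qed
  have cont: "continuous_on {c..C.W q} V"
    using continuous_on_inv[OF C.W_cont[of q], of V] VW img by auto
  have cq: "c \<le> C.W q" using monoD[OF C.W_mono, of p q] C.W_start[of p] \<open>p < q\<close> by simp
  \<comment> \<open>Clamping the argument extends the inverse to a continuous function on the line,
    so that its compositions with Borel functions are Borel and the substitution rule applies to
    them.\<close>
  define V' where "V' r = V (max c (min (C.W q) r))" for r
  have "continuous_on UNIV V'"
    unfolding V'_def[abs_def]
    by (rule continuous_on_compose2[OF cont]) (use cq in \<open>auto intro!: continuous_intros\<close>)
  then have [measurable]: "V' \<in> borel_measurable borel" by (rule borel_measurable_continuous_onI)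
  have V': "V' r = V r" if "r \<in> {c..C.W q}" for r using that by (simp add: V'_def)
  have Wr: "C.W s \<in> {c..C.W q}" if "s \<in> {p..q}" for s using img that by blast
  have V'W: "V' (C.W s) = s" if "s \<in> {p..q}" for s using V'[OF Wr[OF that]] VW[OF that] by simp
  from ae obtain N where N: "N \<in> null_sets lborel" "{s. \<not> (s \<in> {p..q} \<longrightarrow> w0 s = w s)} \<subseteq> N"
    by (auto simp: eventually_ae_filter)
  then have [measurable]: "N \<in> sets borel" by auto
  have "(\<integral>\<^sup>+r\<in>{c..C.W q}. indicator N (V' r) \<partial>lborel) = (\<integral>\<^sup>+s\<in>{p..q}. ennreal (w0 s) * indicator N (V' (C.W s)) \<partial>lborel)"
    using \<open>p < q\<close> by (intro C.nn_integral_substitution[symmetric]) auto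
  also have "\<dots> = (\<integral>\<^sup>+s. 0 \<partial>(lborel :: real measure))"
  proof (rule nn_integral_cong_AE)
    show "AE s in lborel. ennreal (w0 s) * indicator N (V' (C.W s)) * indicator {p..q} s = 0"
      using AE_not_in[OF N(1)]
    proof eventually_elim
      case (elim s)
      then show ?case by (cases "s \<in> {p..q}") (simp_all add: V'W)
    qed
  qed
  also have "\<dots> = 0" by simp
  finally have "AE r in lborel. indicator N (V' r) * indicator {c..C.W q} r = (0::ennreal)"
    by (subst (asm) nn_integral_0_iff_AE) auto
  then have ae1: "AE r in lborel. r \<in> {c..C.W q} \<longrightarrow> 1 / w0 (V' r) = 1 / w (V r)"
  proof eventually_elim
    case (elim r)
    show ?case
    proof
      assume r: "r \<in> {c..C.W q}"
      with elim have "V r \<notin> N" by (auto simp: V' split: split_indicator_asm)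
      then show "1 / w0 (V' r) = 1 / w (V r)" using N(2) WV[OF r] V'[OF r] by auto
    qed
  qed
  \<comment> \<open>Substitution with 1/w0 composed with the inverse makes the integrand w0(s)/w0(s)
    = 1. The nonnegative form of the rule is used since 1/w0 may be unbounded; integrability is part
    of the result.\<close>
  have bi: "has_bochner_integral lborel (\<lambda>r. indicator {c..C.W t} r *\<^sub>R (1 / w0 (V' r))) (t - p)" if t: "t \<in> {p..q}" for t
  proof (rule has_bochner_integral_nn_integral)
    have "(\<integral>\<^sup>+r. ennreal (indicator {c..C.W t} r *\<^sub>R (1 / w0 (V' r))) \<partial>lborel) =
        (\<integral>\<^sup>+r\<in>{c..C.W t}. ennreal (1 / w0 (V' r)) \<partial>lborel)"
      by (intro nn_integral_cong) (auto split: split_indicator)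
    also have "\<dots> = (\<integral>\<^sup>+s\<in>{p..t}. ennreal (w0 s) * ennreal (1 / w0 (V' (C.W s))) \<partial>lborel)"
      using t by (intro C.nn_integral_substitution[symmetric]) auto
    also have "\<dots> = (\<integral>\<^sup>+s. indicator {p..t} s \<partial>lborel)"
    proof (rule nn_integral_cong_AE)
      show "AE s in lborel. ennreal (w0 s) * ennreal (1 / w0 (V' (C.W s))) * indicator {p..t} s = indicator {p..t} s"
        using ae_pos
      proof eventually_elim
        case (elim s)
        show ?case
        proof (cases "s \<in> {p..t}")
          case True
          then have s: "s \<in> {p..q}" using t by auto
          then have "ennreal (w0 s) * ennreal (1 / w0 s) = 1"
            using elim by (simp flip: ennreal_mult)
          with True s show ?thesis by (simp add: V'W)
        qed simp
      qed
    qed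
    also have "\<dots> = ennreal (t - p)" using t by simp
    finally show "(\<integral>\<^sup>+r. ennreal (indicator {c..C.W t} r *\<^sub>R (1 / w0 (V' r))) \<partial>lborel) = ennreal (t - p)" .
  qed (use t w0(2) in auto)
  have ae1': "AE r in lborel. r \<in> {c..C.W t} \<longrightarrow> 1 / w0 (V' r) = 1 / w (V r)" if "t \<in> {p..q}" for t
    using ae1 by eventually_elim (use Wr[OF that] in auto)
  have si: "set_integrable lborel {c..C.W t} (\<lambda>r. 1 / w0 (V' r))" if "t \<in> {p..q}" for t
    using bi[OF that] by (auto simp: has_bochner_integral_iff set_integrable_def)
  have q: "q \<in> {p..q}" using \<open>p < q\<close> by simp
  show ?thesis
  proof (rule that[of V])
    show "set_integrable lebesgue {c..W q} (\<lambda>r. 1 / w (V r))"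
      using set_integral_lebesgue_AE(1)[OF si[OF q] ae1'[OF q]] W[OF q] by simp
    show "(LINT r:{c..W t}|lebesgue. 1 / w (V r)) = t - p" if t: "t \<in> {p..q}" for t
      using set_integral_lebesgue_AE(2)[OF si[OF t] ae1'[OF t]] W[OF t] bi[OF t]
      by (simp add: has_bochner_integral_iff set_lebesgue_integral_def)
  qed (use cont VW WV Wr W W[OF q] in auto)
qed

section \<open>The linear equation with a time-dependent coefficient\<close>

lemma partial_deriv_add:
  assumes "C_k (Suc 0) f" "C_k (Suc 0) g"
  shows "partial_deriv b (\<lambda>x. f x + g x) x = partial_deriv b f x + partial_deriv b g x"
proof -
  have "f differentiable at x" "g differentiable at x"
    using assms by (auto simp: differentiable_on_def)
  then have "((\<lambda>x. f x + g x) has_derivative (\<lambda>h. frechet_derivative f (at x) h + frechet_derivative g (at x) h)) (at x)"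
    by (intro has_derivative_add) (simp_all add: frechet_derivative_works)
  from partial_deriv_eqI[OF this] show ?thesis by (simp add: partial_deriv_def)
qed

lemma partial_deriv_mult:
  assumes "C_k (Suc 0) f" "C_k (Suc 0) g"
  shows "partial_deriv b (\<lambda>x. f x * g x) x = f x * partial_deriv b g x + partial_deriv b f x * g x"
proof -
  have "f differentiable at x" "g differentiable at x"
    using assms by (auto simp: differentiable_on_def)
  then have "((\<lambda>x. f x * g x) has_derivative (\<lambda>h. f x * frechet_derivative g (at x) h + frechet_derivative f (at x) h * g x)) (at x)"
    by (intro has_derivative_mult) (simp_all add: frechet_derivative_works)
  from partial_deriv_eqI[OF this] show ?thesis by (simp add: partial_deriv_def)
qed

lemma partial_deriv_cmult:
  assumes "C_k (Suc 0) f"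
  shows "partial_deriv b (\<lambda>x. c * f x) x = c * partial_deriv b f x"
  using partial_deriv_mult[OF C_k_const assms, of b c x] partial_deriv_eqI[OF has_derivative_const, of b c x]
  by simp

lemma partial_deriv_scale:
  assumes "C_k (Suc 0) f"
  shows "partial_deriv b (\<lambda>x. f (c *\<^sub>R x)) x = c * partial_deriv b f (c *\<^sub>R x)"
proof -
  have "f differentiable at (c *\<^sub>R x)"
    using assms by (auto simp: differentiable_on_def)
  then have f: "(f has_derivative frechet_derivative f (at (c *\<^sub>R x))) (at (c *\<^sub>R x))"
    by (simp add: frechet_derivative_works)
  then interpret bounded_linear "frechet_derivative f (at (c *\<^sub>R x))" by (rule has_derivative_bounded_linear)
  have "((\<lambda>x. f (c *\<^sub>R x)) has_derivative (\<lambda>h. frechet_derivative f (at (c *\<^sub>R x)) (c *\<^sub>R h))) (at x)"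
    by (rule has_derivative_compose[where f = "\<lambda>x. c *\<^sub>R x" and f' = "\<lambda>h. c *\<^sub>R h" and x = x and s = UNIV, OF _ f]) (auto intro!: derivative_eq_intros)
  from partial_deriv_eqI[OF this] show ?thesis by (simp add: partial_deriv_def scale)
qed

text \<open>Writing -sin as a shifted cosine lets the same rule compute the second
  derivative.\<close>

lemma partial_deriv_cos:
  "partial_deriv b (\<lambda>x. cos (x \<bullet> \<xi> + \<theta>)) x = (b \<bullet> \<xi>) * cos (x \<bullet> \<xi> + (\<theta> + pi / 2))"
proof -
  have "((\<lambda>x. cos (x \<bullet> \<xi> + \<theta>)) has_derivative (\<lambda>h. (h \<bullet> \<xi>) * - sin (x \<bullet> \<xi> + \<theta>))) (at x)"
    by (auto intro!: derivative_eq_intros)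
  moreover have "cos (x \<bullet> \<xi> + (\<theta> + pi / 2)) = - sin (x \<bullet> \<xi> + \<theta>)"
    using cos_add[of "x \<bullet> \<xi> + \<theta>" "pi / 2"] by (simp add: add.assoc)
  ultimately show ?thesis using partial_deriv_eqI by fastforce
qed

lemma laplacian_mult:
  fixes f g :: "'a::euclidean_space \<Rightarrow> real"
  assumes f: "\<And>k. C_k k f" and g: "\<And>k. C_k k g"
  shows "laplacian (\<lambda>x. f x * g x) x =
    f x * laplacian g x + 2 * (\<Sum>b\<in>Basis. partial_deriv b f x * partial_deriv b g x) + laplacian f x * g x"
proof -
  have "partial_deriv b (partial_deriv b (\<lambda>x. f x * g x)) x =
      f x * partial_deriv b (partial_deriv b g) x + 2 * (partial_deriv b f x * partial_deriv b g x) +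
      partial_deriv b (partial_deriv b f) x * g x" if b: "b \<in> Basis" for b
  proof -
    have c: "C_k k (partial_deriv b f)" "C_k k (partial_deriv b g)" for k
      using f[of "Suc k"] g[of "Suc k"] b by auto
    have "partial_deriv b (\<lambda>x. f x * g x) = (\<lambda>x. f x * partial_deriv b g x + partial_deriv b f x * g x)"
      using f g by (intro ext partial_deriv_mult)
    then show ?thesis
      using c f g by (simp only: partial_deriv_add partial_deriv_mult C_k_mult)
  qed
  then show ?thesis
    by (simp add: laplacian_def sum.distrib sum_distrib_left sum_distrib_right)
qed

lemma laplacian_scale:
  assumes f: "\<And>k. C_k k f"
  shows "laplacian (\<lambda>x. f (c *\<^sub>R x)) x = c\<^sup>2 * laplacian f (c *\<^sub>R x)"
proof -
  have "partial_deriv b (partial_deriv b (\<lambda>x. f (c *\<^sub>R x))) x = c\<^sup>2 * partial_deriv b (partial_deriv b f) (c *\<^sub>R x)"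
    if b: "b \<in> Basis" for b
  proof -
    have c: "C_k k (partial_deriv b f)" for k
      using f[of "Suc k"] b by auto
    have "partial_deriv b (\<lambda>x. f (c *\<^sub>R x)) = (\<lambda>x. c * partial_deriv b f (c *\<^sub>R x))"
      using f by (intro ext partial_deriv_scale)
    then show ?thesis
      by (simp only: partial_deriv_cmult C_k_scale[OF c] partial_deriv_scale[OF c] power2_eq_square mult.assoc)
  qed
  then show ?thesis by (simp add: laplacian_def sum_distrib_left)
qed

lemma laplacian_cos: "laplacian (\<lambda>x. cos (x \<bullet> \<xi> + \<theta>)) x = - (\<xi> \<bullet> \<xi>) * cos (x \<bullet> \<xi> + \<theta>)"
proof -
  have "partial_deriv b (partial_deriv b (\<lambda>x. cos (x \<bullet> \<xi> + \<theta>))) x = - ((\<xi> \<bullet> b) * (\<xi> \<bullet> b)) * cos (x \<bullet> \<xi> + \<theta>)" for b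
  proof -
    have "partial_deriv b (\<lambda>x. cos (x \<bullet> \<xi> + \<theta>)) = (\<lambda>x. (b \<bullet> \<xi>) * cos (x \<bullet> \<xi> + (\<theta> + pi / 2)))"
      by (intro ext partial_deriv_cos)
    moreover have "cos (x \<bullet> \<xi> + (\<theta> + pi / 2 + pi / 2)) = - cos (x \<bullet> \<xi> + \<theta>)"
      using cos_periodic_pi[of "x \<bullet> \<xi> + \<theta>"] by (simp add: add.assoc)
    ultimately show ?thesis
      by (simp only: partial_deriv_cmult[OF C_k_cos] partial_deriv_cos) (simp add: inner_commute)
  qed
  then show ?thesis
    unfolding laplacian_def by (subst euclidean_inner[of \<xi>]) (simp add: sum_distrib_right sum_negf)
qed

text \<open>The coefficient is a prescribed function of time and must be integrable over [0,T] by
  itself, whereas \<open>is_solution\<close> demands integrability only over balls times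
  [0,T].\<close>

definition linear_solution ::
    "'a::euclidean_space measure \<Rightarrow> real \<Rightarrow> (real \<Rightarrow> real) \<Rightarrow> (real \<Rightarrow> 'a measure) \<Rightarrow> bool" where
  "linear_solution \<nu> T \<alpha> \<mu> \<longleftrightarrow> borel_prob \<nu> \<and> prob_flow T \<mu> \<and>
     set_integrable lebesgue {0..T} \<alpha> \<and> (\<forall>s\<in>{0..T}. \<alpha> s \<ge> 0) \<and>
     (\<forall>\<phi>. test_function \<phi> \<longrightarrow> (\<forall>t\<in>{0..T}.
        (LINT x|\<mu> t. \<phi> x) = (LINT x|\<nu>. \<phi> x) + (LINT s:{0..t}|lebesgue. \<alpha> s * (LINT x|\<mu> s. laplacian \<phi> x))))"

lemma prob_flow_integral_measurable:
  assumes "prob_flow T \<mu>" and [measurable]: "g \<in> borel_measurable borel"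
  shows "(\<lambda>s. indicator {0..T} s * (LINT x|\<mu> s. g x :: real)) \<in> borel_measurable borel"
proof -
  have "(\<lambda>s. LINT x|\<mu> s. g x) \<in> borel_measurable (restrict_space lborel {0..T})"
    using prob_flow_measurable[OF assms(1)] by (rule measurable_compose) measurable
  then show ?thesis by (simp add: borel_measurable_restrict_space_iff)
qed

lemma abs_integral_le_bound:
  fixes M :: "'a::topological_space measure" and g :: "'a \<Rightarrow> real"
  assumes "borel_prob M" and [measurable]: "g \<in> borel_measurable borel" and B: "\<And>x. \<bar>g x\<bar> \<le> B"
  shows "\<bar>LINT x|M. g x\<bar> \<le> B"
proof -
  interpret prob_space M using assms(1) by (simp add: borel_prob_def)
  have [measurable_cong]: "sets M = sets borel" using assms(1) by (simp add: borel_prob_def)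
  have "\<bar>LINT x|M. g x\<bar> \<le> (LINT x|M. \<bar>g x\<bar>)" by (rule integral_abs_bound)
  also have "\<dots> \<le> (LINT x|M. B)"
    by (intro integral_mono integrable_const_bound[where B = B]) (use B order_trans[OF abs_ge_zero B] in auto)
  finally show ?thesis by (simp add: prob_space)
qed

lemma set_integrable_mult_bounded:
  fixes \<alpha> h :: "real \<Rightarrow> real"
  assumes \<alpha>: "set_integrable lebesgue {0..T} \<alpha>"
    and h: "(\<lambda>s. indicator {0..T} s * h s) \<in> borel_measurable borel"
    and B: "\<And>s. s \<in> {0..T} \<Longrightarrow> \<bar>h s\<bar> \<le> B" and t: "t \<in> {0..T}"
  shows "set_integrable lebesgue {0..t} (\<lambda>s. \<alpha> s * h s)"
proof -
  have e: "indicator {0..T} s *\<^sub>R (\<alpha> s * h s) = (indicator {0..T} s *\<^sub>R \<alpha> s) * (indicator {0..T} s * h s)" for s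
    by (auto split: split_indicator)
  have "set_integrable lebesgue {0..T} (\<lambda>s. \<alpha> s * h s)"
    unfolding set_integrable_def
  proof (rule Bochner_Integration.integrable_bound)
    show "integrable lebesgue (\<lambda>s. B * (indicator {0..T} s *\<^sub>R \<alpha> s))"
      using \<alpha> unfolding set_integrable_def by (rule integrable_mult_right)
    show "(\<lambda>s. indicator {0..T} s *\<^sub>R (\<alpha> s * h s)) \<in> borel_measurable lebesgue"
      unfolding e
    proof (rule borel_measurable_times)
      show "(\<lambda>s. indicator {0..T} s *\<^sub>R \<alpha> s) \<in> borel_measurable lebesgue"
        using \<alpha> unfolding set_integrable_def by (rule borel_measurable_integrable)
      show "(\<lambda>s. indicator {0..T} s * h s) \<in> borel_measurable lebesgue"
        by (rule measurable_completion) (use h in \<open>simp only: measurable_lborel1 measurable_lborel2\<close>)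
    qed
    show "AE s in lebesgue. norm (indicator {0..T} s *\<^sub>R (\<alpha> s * h s)) \<le> norm (B * (indicator {0..T} s *\<^sub>R \<alpha> s))"
    proof (rule AE_I2)
      fix s
      have "\<bar>\<alpha> s\<bar> * \<bar>h s\<bar> \<le> \<bar>\<alpha> s\<bar> * \<bar>B\<bar>" if "s \<in> {0..T}"
        using B[OF that] by (intro mult_left_mono) auto
      then show "norm (indicator {0..T} s *\<^sub>R (\<alpha> s * h s)) \<le> norm (B * (indicator {0..T} s *\<^sub>R \<alpha> s))"
        by (auto simp: abs_mult mult.commute split: split_indicator)
    qed
  qed
  then show ?thesis by (rule set_integrable_subset) (use t in auto)
qed

text \<open>Dominated convergence is used twice: in space with the constant \<open>B\<close>,
  integrable against probability measures, and in time with \<open>B\<close> times the absolute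
  value of the coefficient.\<close>

lemma linear_solution_limit:
  assumes sol: "linear_solution \<nu> T \<alpha> \<mu>" and t: "t \<in> {0..T}"
    and \<phi>: "\<And>n::nat. test_function (\<phi> n)"
    and lim: "\<And>x. (\<lambda>n. \<phi> n x) \<longlonglongrightarrow> \<psi> x" "\<And>x. (\<lambda>n. laplacian (\<phi> n) x) \<longlonglongrightarrow> \<psi>' x"
    and bound: "\<And>n x. \<bar>\<phi> n x\<bar> \<le> B" "\<And>n x. \<bar>laplacian (\<phi> n) x\<bar> \<le> B"
    and m: "\<psi> \<in> borel_measurable borel" "\<psi>' \<in> borel_measurable borel"
  shows "(LINT x|\<mu> t. \<psi> x) = (LINT x|\<nu>. \<psi> x) + (LINT s:{0..t}|lebesgue. \<alpha> s * (LINT x|\<mu> s. \<psi>' x))"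
proof -
  note m[measurable]
  have flow: "prob_flow T \<mu>" and \<nu>: "borel_prob \<nu>" and \<alpha>: "set_integrable lebesgue {0..T} \<alpha>"
    using sol by (auto simp: linear_solution_def)
  have bp: "borel_prob (\<mu> s)" if "s \<in> {0..T}" for s using flow that by (auto simp: prob_flow_def)
  have lim_int: "(\<lambda>n. LINT x|M. f n x) \<longlonglongrightarrow> (LINT x|M. g x)"
    if M: "borel_prob M" and [measurable]: "\<And>n. f n \<in> borel_measurable borel" "g \<in> borel_measurable borel"
      and "\<And>x. (\<lambda>n. f n x) \<longlonglongrightarrow> g x" and "\<And>n x. \<bar>f n x\<bar> \<le> B"
    for M :: "'a measure" and f :: "nat \<Rightarrow> 'a \<Rightarrow> real" and g
  proof -
    interpret prob_space M using M by (simp add: borel_prob_def)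
    have [measurable_cong]: "sets M = sets borel" using M by (simp add: borel_prob_def)
    show ?thesis by (rule integral_dominated_convergence[where w = "\<lambda>_. B"]) (use that in auto)
  qed
  have mt[measurable]: "\<phi> n \<in> borel_measurable borel" "laplacian (\<phi> n) \<in> borel_measurable borel" for n
    using test_function_measurable \<phi> test_function_laplacian by blast+
  have i: "set_integrable lebesgue {0..t} (\<lambda>s. \<alpha> s * (LINT x|\<mu> s. laplacian (\<phi> n) x))" for n
    by (rule set_integrable_mult_bounded[OF \<alpha> prob_flow_integral_measurable[OF flow mt(2)] _ t])
       (rule abs_integral_le_bound[OF bp mt(2) bound(2)])
  have "(\<lambda>n. LINT s:{0..t}|lebesgue. \<alpha> s * (LINT x|\<mu> s. laplacian (\<phi> n) x))
      \<longlonglongrightarrow> (LINT s:{0..t}|lebesgue. \<alpha> s * (LINT x|\<mu> s. \<psi>' x))"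
    unfolding set_lebesgue_integral_def
  proof (rule integral_dominated_convergence[where w = "\<lambda>s. B * \<bar>indicator {0..t} s *\<^sub>R \<alpha> s\<bar>"])
    have B: "\<bar>\<psi>' x\<bar> \<le> B" for x
      using bound(2)[of _ x] by (intro LIMSEQ_le_const2[OF tendsto_rabs[OF lim(2)]]) auto
    have "set_integrable lebesgue {0..t} (\<lambda>s. \<alpha> s * (LINT x|\<mu> s. \<psi>' x))"
      by (rule set_integrable_mult_bounded[OF \<alpha> prob_flow_integral_measurable[OF flow m(2)] _ t])
         (rule abs_integral_le_bound[OF bp m(2) B])
    then show "(\<lambda>s. indicator {0..t} s *\<^sub>R (\<alpha> s * (LINT x|\<mu> s. \<psi>' x))) \<in> borel_measurable lebesgue"
      by (auto simp: set_integrable_def)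
    show "(\<lambda>s. indicator {0..t} s *\<^sub>R (\<alpha> s * (LINT x|\<mu> s. laplacian (\<phi> n) x))) \<in> borel_measurable lebesgue" for n
      using i by (auto simp: set_integrable_def)
    have "set_integrable lebesgue {0..t} \<alpha>" using \<alpha> by (rule set_integrable_subset) (use t in auto)
    then show "integrable lebesgue (\<lambda>s. B * \<bar>indicator {0..t} s *\<^sub>R \<alpha> s\<bar>)"
      unfolding set_integrable_def by (intro integrable_mult_right integrable_abs)
    show "AE s in lebesgue. (\<lambda>n. indicator {0..t} s *\<^sub>R (\<alpha> s * (LINT x|\<mu> s. laplacian (\<phi> n) x)))
        \<longlonglongrightarrow> indicator {0..t} s *\<^sub>R (\<alpha> s * (LINT x|\<mu> s. \<psi>' x))"
    proof (rule AE_I2)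
      fix s
      show "(\<lambda>n. indicator {0..t} s *\<^sub>R (\<alpha> s * (LINT x|\<mu> s. laplacian (\<phi> n) x)))
          \<longlonglongrightarrow> indicator {0..t} s *\<^sub>R (\<alpha> s * (LINT x|\<mu> s. \<psi>' x))"
      proof (cases "s \<in> {0..t}")
        case True
        then have "(\<lambda>n. LINT x|\<mu> s. laplacian (\<phi> n) x) \<longlonglongrightarrow> (LINT x|\<mu> s. \<psi>' x)"
          using t by (intro lim_int bp lim bound mt m) auto
        then show ?thesis by (intro tendsto_intros)
      qed simp
    qed
    show "AE s in lebesgue. norm (indicator {0..t} s *\<^sub>R (\<alpha> s * (LINT x|\<mu> s. laplacian (\<phi> n) x)))
        \<le> B * \<bar>indicator {0..t} s *\<^sub>R \<alpha> s\<bar>" for n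
    proof (rule AE_I2)
      fix s
      have "\<bar>\<alpha> s\<bar> * \<bar>LINT x|\<mu> s. laplacian (\<phi> n) x\<bar> \<le> \<bar>\<alpha> s\<bar> * B" if "s \<in> {0..t}"
        using that t by (intro mult_left_mono abs_integral_le_bound[OF bp mt(2) bound(2)]) auto
      then show "norm (indicator {0..t} s *\<^sub>R (\<alpha> s * (LINT x|\<mu> s. laplacian (\<phi> n) x)))
          \<le> B * \<bar>indicator {0..t} s *\<^sub>R \<alpha> s\<bar>"
        by (auto simp: abs_mult mult.commute split: split_indicator)
    qed
  qed
  then have "(\<lambda>n. (LINT x|\<nu>. \<phi> n x) + (LINT s:{0..t}|lebesgue. \<alpha> s * (LINT x|\<mu> s. laplacian (\<phi> n) x)))
      \<longlonglongrightarrow> (LINT x|\<nu>. \<psi> x) + (LINT s:{0..t}|lebesgue. \<alpha> s * (LINT x|\<mu> s. \<psi>' x))"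
    by (intro tendsto_add lim_int[OF \<nu>] lim bound mt m)
  moreover have "(LINT x|\<mu> t. \<phi> n x) =
      (LINT x|\<nu>. \<phi> n x) + (LINT s:{0..t}|lebesgue. \<alpha> s * (LINT x|\<mu> s. laplacian (\<phi> n) x))" for n
    using sol t \<phi> unfolding linear_solution_def by blast
  moreover have "(\<lambda>n. LINT x|\<mu> t. \<phi> n x) \<longlonglongrightarrow> (LINT x|\<mu> t. \<psi> x)"
    by (intro lim_int bp t lim bound mt m)
  ultimately show ?thesis by (simp only: LIMSEQ_unique)
qed

text \<open>The cosine is multiplied by a bump function dilated by 1/(n+1). Derivatives that fall on
  the cutoff carry a factor 1/(n+1) or its square, so in the limit only the Laplacian of the cosine
  survives.\<close>

lemma linear_solution_cos:
  assumes sol: "linear_solution \<nu> T \<alpha> \<mu>" and t: "t \<in> {0..T}"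
  shows "(LINT x|\<mu> t. cos (x \<bullet> \<xi> + \<theta>)) = (LINT x|\<nu>. cos (x \<bullet> \<xi> + \<theta>)) -
    (\<xi> \<bullet> \<xi>) * (LINT s:{0..t}|lebesgue. \<alpha> s * (LINT x|\<mu> s. cos (x \<bullet> \<xi> + \<theta>)))"
proof -
  obtain \<eta> :: "'a \<Rightarrow> real" where \<eta>: "test_function \<eta>" "\<eta> 0 = 1" using ex_bump by blast
  have sm: "C_k k \<eta>" for k using \<eta> by (simp add: test_function_iff)
  obtain M0 where M0: "\<And>x. \<bar>\<eta> x\<bar> \<le> M0" using test_function_bounded[OF \<eta>(1)] by blast
  obtain M2 where M2: "\<And>x. \<bar>laplacian \<eta> x\<bar> \<le> M2"
    using test_function_bounded[OF test_function_laplacian[OF \<eta>(1)]] by blast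
  have "\<forall>b\<in>Basis. \<exists>M. \<forall>x. \<bar>partial_deriv b \<eta> x\<bar> \<le> M"
    using test_function_bounded[OF test_function_partial_deriv[OF \<eta>(1)]] by metis
  then obtain M1 where M1: "\<And>b x. b \<in> Basis \<Longrightarrow> \<bar>partial_deriv b \<eta> x\<bar> \<le> M1 b" by metis
  define e where "e n = 1 / real (Suc n)" for n
  have e: "0 < e n" "e n \<le> 1" for n by (auto simp: e_def)
  have e0: "e \<longlonglongrightarrow> 0" unfolding e_def by (rule LIMSEQ_Suc) (rule lim_1_over_n)
  let ?g = "\<lambda>x. cos (x \<bullet> \<xi> + \<theta>)" and ?h = "\<lambda>x. cos (x \<bullet> \<xi> + (\<theta> + pi / 2))"
  define \<phi> where "\<phi> n x = \<eta> (e n *\<^sub>R x) * ?g x" for n x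
  have L: "laplacian (\<phi> n) x = \<eta> (e n *\<^sub>R x) * (- (\<xi> \<bullet> \<xi>) * ?g x) +
      2 * (\<Sum>b\<in>Basis. (e n * partial_deriv b \<eta> (e n *\<^sub>R x)) * ((b \<bullet> \<xi>) * ?h x)) +
      (e n)\<^sup>2 * laplacian \<eta> (e n *\<^sub>R x) * ?g x" for n x
    unfolding \<phi>_def
    by (subst laplacian_mult[OF C_k_scale[OF sm] C_k_cos])
       (simp only: laplacian_scale[OF sm] laplacian_cos partial_deriv_scale[OF sm] partial_deriv_cos)
  have lim\<eta>: "(\<lambda>n. h (e n *\<^sub>R x)) \<longlonglongrightarrow> h 0" if "test_function h" for h and x :: 'a
  proof (rule isCont_tendsto_compose[where g = h])
    show "isCont h 0"
      using test_function_continuous[OF that, of UNIV] by (simp add: continuous_on_eq_continuous_at)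
    show "(\<lambda>n. e n *\<^sub>R x) \<longlonglongrightarrow> 0" using tendsto_scaleR[OF e0 tendsto_const[of x]] by simp
  qed
  \<comment> \<open>One summand for each of the three terms of the product rule in \<open>L\<close>;
    the extra \<open>M0\<close> covers the truncated cosine itself.\<close>
  define B where "B = M0 * (\<xi> \<bullet> \<xi>) + 2 * (\<Sum>b\<in>Basis. M1 b * \<bar>b \<bullet> \<xi>\<bar>) + M2 + M0"
  have nn: "M0 \<ge> 0" "M2 \<ge> 0" "\<And>b. b \<in> Basis \<Longrightarrow> M1 b \<ge> 0"
    using order_trans[OF abs_ge_zero M0] order_trans[OF abs_ge_zero M2] order_trans[OF abs_ge_zero M1] by auto
  have "(LINT x|\<mu> t. ?g x) = (LINT x|\<nu>. ?g x) + (LINT s:{0..t}|lebesgue. \<alpha> s * (LINT x|\<mu> s. - (\<xi> \<bullet> \<xi>) * ?g x))"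
  proof (rule linear_solution_limit[OF sol t, where \<phi> = \<phi> and B = B])
    show "test_function (\<phi> n)" for n
      unfolding \<phi>_def using e[of n] by (intro test_function_mult test_function_scale \<eta>(1) C_k_cos) auto
    show "(\<lambda>n. \<phi> n x) \<longlonglongrightarrow> ?g x" for x
      using tendsto_mult[OF lim\<eta>[OF \<eta>(1), of x] tendsto_const[of "?g x"]] by (simp add: \<phi>_def \<eta>(2))
    show "(\<lambda>n. laplacian (\<phi> n) x) \<longlonglongrightarrow> - (\<xi> \<bullet> \<xi>) * ?g x" for x
    proof -
      have "(\<lambda>n. laplacian (\<phi> n) x) \<longlonglongrightarrow> \<eta> 0 * (- (\<xi> \<bullet> \<xi>) * ?g x) +
          2 * (\<Sum>b\<in>Basis. (0 * partial_deriv b \<eta> 0) * ((b \<bullet> \<xi>) * ?h x)) + 0\<^sup>2 * laplacian \<eta> 0 * ?g x"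
        unfolding L
        by (intro tendsto_intros lim\<eta> e0 \<eta>(1) test_function_laplacian test_function_partial_deriv) auto
      then show ?thesis by (simp add: \<eta>(2))
    qed
    have B0: "\<bar>\<phi> n x\<bar> \<le> M0" for n x
      using mult_mono[OF M0[of "e n *\<^sub>R x"] abs_cos_le_one[of "x \<bullet> \<xi> + \<theta>"]] nn by (simp add: \<phi>_def abs_mult)
    have rest: "0 \<le> M0 * (\<xi> \<bullet> \<xi>)" "0 \<le> (\<Sum>b\<in>Basis. M1 b * \<bar>b \<bullet> \<xi>\<bar>)"
      using nn by (auto intro!: sum_nonneg mult_nonneg_nonneg)
    show "\<bar>\<phi> n x\<bar> \<le> B" for n x unfolding B_def using B0[of n x] rest nn by linarith
    show "\<bar>laplacian (\<phi> n) x\<bar> \<le> B" for n x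
    proof -
      have 1: "\<bar>\<eta> (e n *\<^sub>R x) * (- (\<xi> \<bullet> \<xi>) * ?g x)\<bar> \<le> M0 * (\<xi> \<bullet> \<xi>)"
      proof -
        have "\<bar>\<eta> (e n *\<^sub>R x) * (- (\<xi> \<bullet> \<xi>) * ?g x)\<bar> = (\<bar>\<eta> (e n *\<^sub>R x)\<bar> * (\<xi> \<bullet> \<xi>)) * \<bar>?g x\<bar>"
          by (simp add: abs_mult)
        also have "\<dots> \<le> (M0 * (\<xi> \<bullet> \<xi>)) * 1"
          using M0 nn by (intro mult_mono) auto
        finally show ?thesis by simp
      qed
      have "\<bar>(e n * partial_deriv b \<eta> (e n *\<^sub>R x)) * ((b \<bullet> \<xi>) * ?h x)\<bar> \<le> M1 b * \<bar>b \<bullet> \<xi>\<bar>" if "b \<in> Basis" for b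
      proof -
        have "\<bar>(e n * partial_deriv b \<eta> (e n *\<^sub>R x)) * ((b \<bullet> \<xi>) * ?h x)\<bar> =
            (e n * \<bar>partial_deriv b \<eta> (e n *\<^sub>R x)\<bar>) * (\<bar>b \<bullet> \<xi>\<bar> * \<bar>?h x\<bar>)"
          using e[of n] by (simp add: abs_mult)
        also have "\<dots> \<le> (1 * M1 b) * (\<bar>b \<bullet> \<xi>\<bar> * 1)"
          using M1[OF that] e[of n] nn(3)[OF that] by (intro mult_mono) auto
        finally show ?thesis by simp
      qed
      then have 2: "\<bar>\<Sum>b\<in>Basis. (e n * partial_deriv b \<eta> (e n *\<^sub>R x)) * ((b \<bullet> \<xi>) * ?h x)\<bar> \<le> (\<Sum>b\<in>Basis. M1 b * \<bar>b \<bullet> \<xi>\<bar>)"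
        by (intro order_trans[OF sum_abs] sum_mono)
      have 3: "\<bar>(e n)\<^sup>2 * laplacian \<eta> (e n *\<^sub>R x) * ?g x\<bar> \<le> M2"
      proof -
        have "\<bar>(e n)\<^sup>2 * laplacian \<eta> (e n *\<^sub>R x) * ?g x\<bar> = ((e n)\<^sup>2 * \<bar>laplacian \<eta> (e n *\<^sub>R x)\<bar>) * \<bar>?g x\<bar>"
          by (simp add: abs_mult)
        also have "\<dots> \<le> (1 * M2) * 1"
          using M2 nn e[of n] by (intro mult_mono power_le_one) auto
        finally show ?thesis by simp
      qed
      show ?thesis unfolding L B_def using 1 2 3 nn(1) by linarith
    qed
  qed auto
  also have "(LINT s:{0..t}|lebesgue. \<alpha> s * (LINT x|\<mu> s. - (\<xi> \<bullet> \<xi>) * ?g x)) =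
      - (\<xi> \<bullet> \<xi>) * (LINT s:{0..t}|lebesgue. \<alpha> s * (LINT x|\<mu> s. ?g x))"
  proof -
    have "\<alpha> s * (LINT x|\<mu> s. - (\<xi> \<bullet> \<xi>) * ?g x) = - (\<xi> \<bullet> \<xi>) * (\<alpha> s * (LINT x|\<mu> s. ?g x))" for s
      by simp
    then show ?thesis by (simp only: set_integral_mult_right)
  qed
  finally show ?thesis by simp
qed

text \<open>The substitution r = \<beta>(s) carries the weak heat equation over to the equation with
  coefficient \<alpha>, since the clock \<beta> has density \<alpha>.\<close>

lemma linear_solution_heat_flow:
  fixes \<nu> :: "'a::euclidean_space measure"
  assumes \<nu>: "borel_prob \<nu>" and \<alpha>: "set_integrable lebesgue {0..T} \<alpha>" "\<forall>s\<in>{0..T}. \<alpha> s \<ge> 0"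
  shows "linear_solution \<nu> T \<alpha> (\<lambda>t. heat_flow \<nu> (LINT s:{0..t}|lebesgue. \<alpha> s))"
proof -
  define \<beta> where "\<beta> t = (LINT s:{0..t}|lebesgue. \<alpha> s)" for t
  note clock = clock_substitution[OF \<alpha>, folded \<beta>_def]
  have \<beta>0: "\<beta> t \<ge> 0" if t: "t \<in> {0..T}" for t
    using clock(4)[of "\<lambda>_. 0" t 0] clock(5)[of "\<lambda>_. 0" t 0] t by (auto dest!: mono_onD[of _ _ 0 t])
  have flow: "prob_flow T (\<lambda>t. heat_flow \<nu> (\<beta> t))"
    unfolding prob_flow_def
  proof safe
    fix t assume t: "t \<in> {0..T}"
    show "borel_prob (heat_flow \<nu> (\<beta> t))" by (intro borel_prob_heat_flow \<nu> \<beta>0 t)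
  next
    fix B :: "'a set" assume [measurable]: "B \<in> sets borel"
    show "(\<lambda>t. measure (heat_flow \<nu> (\<beta> t)) B) \<in> borel_measurable (restrict_space borel {0..T})"
    proof (cases "T \<ge> 0")
      case True
      have "\<beta> \<in> borel_measurable (restrict_space borel {0..T})"
        by (rule borel_measurable_continuous_on_restrict) (rule clock(3)[of "\<lambda>_. 0" 0 0]; use True in simp)
      from measurable_compose[OF this measurable_integral_pair_gaussian[OF \<nu>, of "indicator B"]]
      have "(\<lambda>t. LINT p|(\<nu> \<Otimes>\<^sub>M gaussian). indicator B (fst p + sqrt (\<beta> t) *\<^sub>R snd p) :: real) \<in> borel_measurable (restrict_space borel {0..T})"
        by simp
      moreover have "measure (heat_flow \<nu> (\<beta> t)) B = (LINT p|(\<nu> \<Otimes>\<^sub>M gaussian). indicator B (fst p + sqrt (\<beta> t) *\<^sub>R snd p))"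
        if "t \<in> {0..T}" for t
      proof -
        have "space (heat_flow \<nu> (\<beta> t)) = UNIV"
          using borel_prob_heat_flow[OF \<nu> \<beta>0[OF that]] by (simp add: borel_prob_def sets_eq_imp_space_eq[where M' = borel])
        then show ?thesis
          using integral_heat_flow[OF \<nu> \<beta>0[OF that], of "indicator B"] by simp
      qed
      ultimately show ?thesis by (subst measurable_cong) (auto simp: space_restrict_space)
    next
      case False
      then have "space (restrict_space borel {0..T}) = {}" by (simp add: space_restrict_space)
      then show ?thesis by (simp add: measurable_def)
    qed
  qed
  have "(LINT x|heat_flow \<nu> (\<beta> t). \<phi> x) = (LINT x|\<nu>. \<phi> x) +
      (LINT s:{0..t}|lebesgue. \<alpha> s * (LINT x|heat_flow \<nu> (\<beta> s). laplacian \<phi> x))"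
    if \<phi>: "test_function \<phi>" and t: "t \<in> {0..T}" for \<phi> t
  proof -
    define k where "k r = (LINT p|(\<nu> \<Otimes>\<^sub>M gaussian). laplacian \<phi> (fst p + sqrt r *\<^sub>R snd p))" for r
    have Lm: "laplacian \<phi> \<in> borel_measurable borel"
      by (rule test_function_measurable[OF test_function_laplacian[OF \<phi>]])
    have k: "(LINT x|heat_flow \<nu> r. laplacian \<phi> x) = k r" if "r \<ge> 0" for r
      unfolding k_def by (rule integral_heat_flow[OF \<nu> that Lm])
    have km: "k \<in> borel_measurable borel"
      unfolding k_def[abs_def] by (rule measurable_integral_pair_gaussian[OF \<nu> Lm])
    obtain B where B: "\<And>x. \<bar>laplacian \<phi> x\<bar> \<le> B"
      using test_function_bounded[OF test_function_laplacian[OF \<phi>]] by blast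
    \<comment> \<open>Composing with \<open>max 0\<close> gives a bound on the whole line, as
      \<open>clock_substitution\<close> requires, and changes nothing at the nonnegative values of
      the clock.\<close>
    have kB: "\<bar>k (max 0 r)\<bar> \<le> B" for r
      using abs_integral_le_bound[OF borel_prob_heat_flow[OF \<nu>] Lm B, of "max 0 r"] k[of "max 0 r"] by simp
    have km': "(\<lambda>r. k (max 0 r)) \<in> borel_measurable borel" using km by measurable
    have "(LINT s:{0..t}|lebesgue. \<alpha> s * (LINT x|heat_flow \<nu> (\<beta> s). laplacian \<phi> x)) =
        (LINT s:{0..t}|lebesgue. \<alpha> s * k (max 0 (\<beta> s)))"
    proof (rule set_lebesgue_integral_cong)
      show "\<forall>s. s \<in> {0..t} \<longrightarrow> \<alpha> s * (LINT x|heat_flow \<nu> (\<beta> s). laplacian \<phi> x) = \<alpha> s * k (max 0 (\<beta> s))"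
        using \<beta>0 t by (auto simp: k)
    qed simp
    also have "\<dots> = (LINT r:{0..\<beta> t}|lborel. k (max 0 r))"
      by (rule clock(2)[OF km' t kB])
    also have "\<dots> = (LINT r:{0..\<beta> t}|lborel. (LINT x|heat_flow \<nu> r. laplacian \<phi> x))"
      by (rule set_lebesgue_integral_cong) (auto simp: k)
    finally show ?thesis
      using integral_heat_flow_test_function[OF \<nu> \<phi> \<beta>0[OF t]] by simp
  qed
  with flow \<nu> \<alpha> show ?thesis by (simp add: linear_solution_def \<beta>_def)
qed

text \<open>Inserting the equation into itself n times bounds |d(t)| by B (\<kappa> \<beta>(t))^n /
  n!, because the integral of \<alpha> \<beta>^n is \<beta>^(n+1)/(n+1) by substitution. These
  bounds tend to zero.\<close>

lemma linear_volterra_unique: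
  fixes \<alpha> d :: "real \<Rightarrow> real"
  assumes \<alpha>: "set_integrable lebesgue {0..T} \<alpha>" "\<forall>s\<in>{0..T}. \<alpha> s \<ge> 0"
    and d: "\<And>t. t \<in> {0..T} \<Longrightarrow> d t = - \<kappa> * (LINT s:{0..t}|lebesgue. \<alpha> s * d s)"
    and bound: "\<And>t. t \<in> {0..T} \<Longrightarrow> \<bar>d t\<bar> \<le> B" and \<kappa>: "\<kappa> \<ge> 0" and t: "t \<in> {0..T}"
  shows "d t = 0"
proof -
  define \<beta> where "\<beta> t = (LINT s:{0..t}|lebesgue. \<alpha> s)" for t
  note clock = clock_substitution[OF \<alpha>, folded \<beta>_def]
  have T: "0 \<in> {0..T}" "T \<in> {0..T}" using t by auto
  have mono: "mono_on {0..T} \<beta>" and \<beta>0: "\<beta> 0 = 0"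
    using clock(4)[of "\<lambda>_. 0" 0 0] clock(5)[of "\<lambda>_. 0" 0 0] T by auto
  have \<beta>: "0 \<le> \<beta> s" "\<beta> s \<le> \<beta> T" if "s \<in> {0..T}" for s
    using mono_onD[OF mono, of 0 s] mono_onD[OF mono, of s T] that \<beta>0 by auto
  have *: "\<bar>d t\<bar> \<le> B * (\<kappa> * \<beta> t) ^ n / fact n" if "t \<in> {0..T}" for n t
    using that
  proof (induction n arbitrary: t)
    case 0
    then show ?case using bound by simp
  next
    case (Suc n)
    \<comment> \<open>Clamping to [0, \<beta>(T)] makes the power bounded on the line without
      changing it on the range of the clock.\<close>
    define k where "k r = B * (\<kappa> * max 0 (min (\<beta> T) r)) ^ n / fact n" for r
    have km: "k \<in> borel_measurable borel" unfolding k_def[abs_def] by measurable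
    have B: "B \<ge> 0" using bound[OF Suc.prems] by linarith
    have k\<beta>: "k (\<beta> s) = B * (\<kappa> * \<beta> s) ^ n / fact n" if "s \<in> {0..T}" for s
      using \<beta>[OF that] by (simp add: k_def)
    have kb: "\<bar>k r\<bar> \<le> B * (\<kappa> * \<beta> T) ^ n / fact n" for r
    proof -
      have "(\<kappa> * max 0 (min (\<beta> T) r)) ^ n \<le> (\<kappa> * \<beta> T) ^ n"
        using \<kappa> \<beta>[OF T(2)] by (intro power_mono mult_left_mono) auto
      then have "B * (\<kappa> * max 0 (min (\<beta> T) r)) ^ n / fact n \<le> B * (\<kappa> * \<beta> T) ^ n / fact n"
        using B by (intro divide_right_mono mult_left_mono) auto
      moreover have "k r \<ge> 0" using B \<kappa> by (simp add: k_def)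
      ultimately show ?thesis by (simp add: k_def)
    qed
    note c = clock(1)[OF km Suc.prems kb] clock(2)[OF km Suc.prems kb]
    have "\<bar>LINT s:{0..t}|lebesgue. \<alpha> s * d s\<bar> \<le> (LINT s|lebesgue. \<bar>indicator {0..t} s *\<^sub>R (\<alpha> s * d s)\<bar>)"
      unfolding set_lebesgue_integral_def by (rule integral_abs_bound)
    also have "\<dots> \<le> (LINT s:{0..t}|lebesgue. \<alpha> s * k (\<beta> s))"
      unfolding set_lebesgue_integral_def
    proof (rule integral_mono')
      show "integrable lebesgue (\<lambda>s. indicator {0..t} s *\<^sub>R (\<alpha> s * k (\<beta> s)))"
        using c(1) by (simp add: set_integrable_def)
      fix s
      have *: "\<alpha> s \<ge> 0" "\<bar>d s\<bar> \<le> k (\<beta> s)" if "s \<in> {0..t}"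
        using that Suc.prems Suc.IH[of s] k\<beta>[of s] \<alpha>(2) by auto
      show "\<bar>indicator {0..t} s *\<^sub>R (\<alpha> s * d s)\<bar> \<le> indicator {0..t} s *\<^sub>R (\<alpha> s * k (\<beta> s))"
        using * by (auto simp: abs_mult intro: mult_left_mono split: split_indicator)
      show "0 \<le> indicator {0..t} s *\<^sub>R (\<alpha> s * k (\<beta> s))"
        using * order_trans[OF abs_ge_zero *(2)] by (auto split: split_indicator)
    qed
    also have "\<dots> = (LINT r:{0..\<beta> t}|lborel. B * \<kappa> ^ n / fact n * r ^ n)"
      unfolding c(2) using \<beta>[OF Suc.prems]
      by (intro set_lebesgue_integral_cong) (auto simp: k_def power_mult_distrib)
    also have "\<dots> = B * \<kappa> ^ n / fact n * (LINT r|lborel. r ^ n * indicator {0..\<beta> t} r)"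
      unfolding set_integral_mult_right by (simp add: set_lebesgue_integral_def mult.commute)
    also have "\<dots> = B * \<kappa> ^ n * \<beta> t ^ Suc n / fact (Suc n)"
      using \<beta>[OF Suc.prems] by (subst integral_power) (auto simp: mult_ac)
    finally have "\<kappa> * \<bar>LINT s:{0..t}|lebesgue. \<alpha> s * d s\<bar> \<le> \<kappa> * (B * \<kappa> ^ n * \<beta> t ^ Suc n / fact (Suc n))"
      using \<kappa> by (rule mult_left_mono)
    then show ?case
      using \<kappa> by (simp add: d[OF Suc.prems] abs_mult power_mult_distrib mult_ac)
  qed
  have "(\<lambda>n. B * (inverse (fact n) * (\<kappa> * \<beta> t) ^ n)) \<longlonglongrightarrow> B * 0"
    by (intro tendsto_intros summable_LIMSEQ_zero summable_exp)
  then have "\<bar>d t\<bar> \<le> B * 0"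
    by (rule LIMSEQ_le_const) (use *[OF t] in \<open>auto simp: field_simps\<close>)
  then show ?thesis by simp
qed

text \<open>The difference of the cosine integrals of both solutions satisfies a homogeneous
  Volterra equation with constant \<xi> . \<xi> >= 0 and is bounded by 2, so it vanishes; cosine
  integrals determine the measure.\<close>

theorem linear_solution_unique:
  fixes \<nu> :: "'a::euclidean_space measure"
  assumes sol: "linear_solution \<nu> T \<alpha> \<mu>" and t: "t \<in> {0..T}"
  shows "\<mu> t = heat_flow \<nu> (LINT s:{0..t}|lebesgue. \<alpha> s)"
proof -
  have \<nu>: "borel_prob \<nu>" and \<alpha>: "set_integrable lebesgue {0..T} \<alpha>" "\<forall>s\<in>{0..T}. \<alpha> s \<ge> 0"
    using sol by (auto simp: linear_solution_def)
  define h where "h t = heat_flow \<nu> (LINT s:{0..t}|lebesgue. \<alpha> s)" for t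
  have sol': "linear_solution \<nu> T \<alpha> h"
    unfolding h_def by (rule linear_solution_heat_flow[OF \<nu> \<alpha>])
  have bp: "borel_prob (\<mu> s)" "borel_prob (h s)" if "s \<in> {0..T}" for s
    using sol sol' that by (auto simp: linear_solution_def prob_flow_def)
  show ?thesis unfolding h_def[symmetric]
  proof (rule integral_cos_eq_imp_measure_eq)
    fix \<xi> :: 'a and \<theta> :: real
    let ?c = "\<lambda>\<mu> s. LINT x|\<mu> s. cos (x \<bullet> \<xi> + \<theta>)"
    have b: "\<bar>?c \<mu> s\<bar> \<le> 1" "\<bar>?c h s\<bar> \<le> 1" if "s \<in> {0..T}" for s
      using bp[OF that] by (auto intro!: abs_integral_le_bound)
    have i: "set_integrable lebesgue {0..t} (\<lambda>s. \<alpha> s * ?c \<mu> s)" "set_integrable lebesgue {0..t} (\<lambda>s. \<alpha> s * ?c h s)"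
      if "t \<in> {0..T}" for t
      using sol sol' b that
      by (auto intro!: set_integrable_mult_bounded[where B = 1 and T = T] \<alpha> prob_flow_integral_measurable simp: linear_solution_def)
    have "?c \<mu> t - ?c h t = 0"
    proof (rule linear_volterra_unique[where d = "\<lambda>t. ?c \<mu> t - ?c h t", OF \<alpha> _ _ _ t])
      fix s assume s: "s \<in> {0..T}"
      show "?c \<mu> s - ?c h s = - (\<xi> \<bullet> \<xi>) * (LINT s:{0..s}|lebesgue. \<alpha> s * (?c \<mu> s - ?c h s))"
        using linear_solution_cos[OF sol s] linear_solution_cos[OF sol' s] i[OF s]
        by (simp add: right_diff_distrib set_integral_diff)
      show "\<bar>?c \<mu> s - ?c h s\<bar> \<le> 2" using b[OF s] by linarith
    qed simp
    then show "?c \<mu> t = ?c h t" by simp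
  qed (use bp t in auto)
qed

text \<open>For small \<open>\<xi>\<close> the integral of \<open>cos (x \<bullet> \<xi>)\<close> stays positive and so decreases
  strictly along the flow.\<close>

lemma heat_flow_neq:
  fixes \<nu> :: "'a::euclidean_space measure"
  assumes \<nu>: "borel_prob \<nu>" and \<beta>: "\<beta> > 0"
  shows "heat_flow \<nu> \<beta> \<noteq> \<nu>"
proof
  assume eq: "heat_flow \<nu> \<beta> = \<nu>"
  interpret prob_space \<nu> using \<nu> by (simp add: borel_prob_def)
  have [measurable_cong]: "sets \<nu> = sets borel" using \<nu> by (simp add: borel_prob_def)
  obtain b :: 'a where b: "b \<in> Basis" using nonempty_Basis by blast
  define e where "e n = 1 / real (Suc n)" for n
  have e0: "e \<longlonglongrightarrow> 0" unfolding e_def by (rule LIMSEQ_Suc) (rule lim_1_over_n)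
  have "(\<lambda>n. LINT x|\<nu>. cos (x \<bullet> (e n *\<^sub>R b))) \<longlonglongrightarrow> (LINT x|\<nu>. 1)"
  proof (rule integral_dominated_convergence[where w = "\<lambda>_. 1"])
    show "AE x in \<nu>. (\<lambda>n. cos (x \<bullet> (e n *\<^sub>R b))) \<longlonglongrightarrow> 1"
    proof (rule AE_I2)
      fix x
      have "(\<lambda>n. cos (e n * (x \<bullet> b))) \<longlonglongrightarrow> cos (0 * (x \<bullet> b))" by (intro tendsto_intros e0)
      then show "(\<lambda>n. cos (x \<bullet> (e n *\<^sub>R b))) \<longlonglongrightarrow> 1" by simp
    qed
  qed auto
  then have 1: "\<forall>\<^sub>F n in sequentially. (LINT x|\<nu>. cos (x \<bullet> (e n *\<^sub>R b))) > 1 / 2"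
    by (rule order_tendstoD) (simp add: prob_space)
  have "(\<lambda>n. (e n)\<^sup>2 * \<beta>) \<longlonglongrightarrow> 0\<^sup>2 * \<beta>" by (intro tendsto_intros e0)
  then have 2: "\<forall>\<^sub>F n in sequentially. (e n)\<^sup>2 * \<beta> < 1 / 4"
    by (rule order_tendstoD) simp
  \<comment> \<open>The cosine integral starts above 1/2 and, being at most 1 in absolute value, can
    lose at most (e n)^2 \<beta> < 1/4 up to time \<beta>; it therefore stays above 1/4.\<close>
  obtain n where n: "(LINT x|\<nu>. cos (x \<bullet> (e n *\<^sub>R b))) > 1 / 2" "(e n)\<^sup>2 * \<beta> < 1 / 4"
    using eventually_happens[OF eventually_conj[OF 1 2]] by auto
  define c where "c s = (LINT x|heat_flow \<nu> s. cos (x \<bullet> (e n *\<^sub>R b)))" for s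
  \<comment> \<open>With coefficient 1 the clock is the identity, so the results on the linear
    equation describe the heat flow itself.\<close>
  have "set_integrable lebesgue {0..\<beta>} (\<lambda>_. 1 :: real)"
    using \<beta> by (simp add: set_integrable_def)
  then have "linear_solution \<nu> \<beta> (\<lambda>_. 1) (\<lambda>t. heat_flow \<nu> (LINT s:{0..t}|lebesgue. 1))"
    by (intro linear_solution_heat_flow \<nu>) auto
  note sol = this
  have one: "(LINT s:{0..t}|lebesgue. 1 :: real) = t" if "t \<ge> 0" for t
    using that by (simp add: set_lebesgue_integral_def)
  have ct: "c t = c 0 - (e n)\<^sup>2 * (LINT s:{0..t}|lebesgue. c s)" if t: "t \<in> {0..\<beta>}" for t
  proof -
    have "(LINT s:{0..t}|lebesgue. 1 * (LINT x|heat_flow \<nu> (LINT s:{0..s}|lebesgue. 1). cos (x \<bullet> (e n *\<^sub>R b) + 0))) =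
        (LINT s:{0..t}|lebesgue. c s)"
      by (rule set_lebesgue_integral_cong) (auto simp: c_def one)
    then show ?thesis
      using linear_solution_cos[OF sol t, of "e n *\<^sub>R b" 0] t b
      by (simp add: c_def one power2_eq_square heat_flow_def[of \<nu> 0])
  qed
  have c1: "\<bar>c s\<bar> \<le> 1" if "s \<ge> 0" for s
    unfolding c_def by (rule abs_integral_le_bound[OF borel_prob_heat_flow[OF \<nu> that]]) auto
  have flow: "prob_flow \<beta> (\<lambda>t. heat_flow \<nu> (LINT s:{0..t}|lebesgue. 1))"
    using sol by (simp add: linear_solution_def)
  have "(\<lambda>s. indicator {0..\<beta>} s * c s) \<in> borel_measurable borel"
  proof -
    have "(\<lambda>s. indicator {0..\<beta>} s * c s) =
        (\<lambda>s. indicator {0..\<beta>} s * (LINT x|heat_flow \<nu> (LINT s:{0..s}|lebesgue. 1). cos (x \<bullet> (e n *\<^sub>R b))))"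
      by (auto simp: c_def one split: split_indicator)
    then show ?thesis using prob_flow_integral_measurable[OF flow, of "\<lambda>x. cos (x \<bullet> (e n *\<^sub>R b))"] by simp
  qed
  then have i: "set_integrable lebesgue {0..t} c" if "t \<in> {0..\<beta>}" for t
    using set_integrable_mult_bounded[of \<beta> "\<lambda>_. 1" c 1 t] \<open>set_integrable lebesgue {0..\<beta>} (\<lambda>_. 1)\<close> c1 that by simp
  have i1: "set_integrable lebesgue {0..t} (\<lambda>_. k :: real)" for t k :: real
    unfolding set_integrable_def by (intro integrable_scaleR_left integrable_real_indicator) (auto simp: emeasure_lborel_Icc_eq)
  have k: "(LINT s:{0..t}|lebesgue. k :: real) = t * k" if "t \<ge> 0" for t k
    using that by (simp add: set_lebesgue_integral_def)
  have "c t \<ge> 1 / 4" if t: "t \<in> {0..\<beta>}" for t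
  proof -
    have "(LINT s:{0..t}|lebesgue. c s) \<le> (LINT s:{0..t}|lebesgue. 1)"
      using t by (intro set_integral_mono i i1) (auto intro: order_trans[OF abs_ge_self c1])
    then have "(e n)\<^sup>2 * (LINT s:{0..t}|lebesgue. c s) \<le> (e n)\<^sup>2 * t"
      using t by (intro mult_left_mono) (auto simp: one)
    also have "\<dots> \<le> (e n)\<^sup>2 * \<beta>" using t by (intro mult_left_mono) auto
    finally show ?thesis using ct[OF t] n by (simp add: c_def heat_flow_def[of \<nu> 0])
  qed
  then have "(LINT s:{0..\<beta>}|lebesgue. 1 / 4) \<le> (LINT s:{0..\<beta>}|lebesgue. c s)"
    using \<beta> by (intro set_integral_mono i i1) auto
  then have "(LINT s:{0..\<beta>}|lebesgue. c s) > 0"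
    using \<beta> by (subst (asm) k) auto
  moreover have "e n > 0" by (simp add: e_def)
  ultimately have "c \<beta> < c 0" using ct[of \<beta>] \<beta> by simp
  moreover have "c \<beta> = c 0" by (simp add: c_def eq) (simp add: heat_flow_def)
  ultimately show False by simp
qed

section \<open>The nonlinear problem\<close>

lemma spacetime_kernel:
  fixes \<mu> :: "real \<Rightarrow> 'a::euclidean_space measure"
  assumes "prob_flow T \<mu>"
  shows "(\<lambda>t. distr (\<mu> t) borel (\<lambda>x. (x, t))) \<in> restrict_space lborel {0..T} \<rightarrow>\<^sub>M subprob_algebra borel"
proof (rule measurable_distr2[OF _ prob_flow_measurable[OF assms]])
  have "(\<lambda>p. p) \<in> restrict_space lborel {0..T} \<rightarrow>\<^sub>M lborel"
    by (rule measurable_restrict_space1) simp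
  then have [measurable]: "(\<lambda>p. p) \<in> restrict_space lborel {0..T} \<rightarrow>\<^sub>M borel" by simp
  show "(\<lambda>(t, x). (x, t)) \<in> restrict_space lborel {0..T} \<Otimes>\<^sub>M borel \<rightarrow>\<^sub>M (borel :: ('a \<times> real) measure)"
    unfolding borel_prod[symmetric] by measurable
qed

lemma sets_spacetime_measure:
  assumes "prob_flow T \<mu>" "0 \<le> T"
  shows "sets (spacetime_measure T \<mu>) = sets borel"
  unfolding spacetime_measure_def
  by (rule sets_bind_measurable[OF spacetime_kernel[OF assms(1)]]) (use assms(2) in \<open>simp add: space_restrict_space\<close>)

lemma
  fixes \<mu> :: "real \<Rightarrow> 'a::euclidean_space measure" and f :: "'a \<times> real \<Rightarrow> ennreal"
  assumes flow: "prob_flow T \<mu>" and T: "0 \<le> T" and f: "f \<in> borel_measurable borel"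
  shows measurable_spacetime_slices:
      "(\<lambda>t. (\<integral>\<^sup>+x. f (x, t) \<partial>\<mu> t) * indicator {0..T} t) \<in> borel_measurable borel"
    and nn_integral_spacetime:
      "(\<integral>\<^sup>+p. f p \<partial>spacetime_measure T \<mu>) = (\<integral>\<^sup>+t\<in>{0..T}. (\<integral>\<^sup>+x. f (x, t) \<partial>\<mu> t) \<partial>lborel)"
proof -
  let ?R = "restrict_space lborel {0..T}"
  note f[measurable]
  have "(\<lambda>p. p) \<in> ?R \<rightarrow>\<^sub>M lborel"
    by (rule measurable_restrict_space1) simp
  then have [measurable]: "(\<lambda>p. p) \<in> ?R \<rightarrow>\<^sub>M borel" by simp
  have sw: "(\<lambda>(t, x). (x, t)) \<in> ?R \<Otimes>\<^sub>M borel \<rightarrow>\<^sub>M (borel :: ('a \<times> real) measure)"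
    unfolding borel_prod[symmetric] by measurable
  have "(\<lambda>(t, x). f (x, t)) \<in> borel_measurable (?R \<Otimes>\<^sub>M borel)"
    using measurable_compose[OF sw f] by (simp add: case_prod_beta')
  from nn_integral_measurable_subprob_algebra2[OF this prob_flow_measurable[OF flow]]
  show "(\<lambda>t. (\<integral>\<^sup>+x. f (x, t) \<partial>\<mu> t) * indicator {0..T} t) \<in> borel_measurable borel"
    by (simp add: borel_measurable_restrict_space_iff_ennreal)
  have "(\<integral>\<^sup>+p. f p \<partial>spacetime_measure T \<mu>) = (\<integral>\<^sup>+t. (\<integral>\<^sup>+p. f p \<partial>distr (\<mu> t) borel (\<lambda>x. (x, t))) \<partial>?R)"
    unfolding spacetime_measure_def by (rule nn_integral_bind[OF f spacetime_kernel[OF flow]])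
  also have "\<dots> = (\<integral>\<^sup>+t. (\<integral>\<^sup>+x. f (x, t) \<partial>\<mu> t) \<partial>?R)"
  proof (rule nn_integral_cong)
    fix t assume "t \<in> space ?R"
    then have s: "sets (\<mu> t) = sets borel"
      using flow by (auto simp: prob_flow_def borel_prob_def space_restrict_space)
    have "(\<lambda>x. (x, t)) \<in> \<mu> t \<rightarrow>\<^sub>M borel"
      unfolding measurable_cong_sets[OF s refl] borel_prod[symmetric] by measurable
    then show "(\<integral>\<^sup>+p. f p \<partial>distr (\<mu> t) borel (\<lambda>x. (x, t))) = (\<integral>\<^sup>+x. f (x, t) \<partial>\<mu> t)"
      by (rule nn_integral_distr) (simp add: f)
  qed
  also have "\<dots> = (\<integral>\<^sup>+t\<in>{0..T}. (\<integral>\<^sup>+x. f (x, t) \<partial>\<mu> t) \<partial>lborel)"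
    by (rule nn_integral_restrict_space) simp
  finally show "(\<integral>\<^sup>+p. f p \<partial>spacetime_measure T \<mu>) = (\<integral>\<^sup>+t\<in>{0..T}. (\<integral>\<^sup>+x. f (x, t) \<partial>\<mu> t) \<partial>lborel)" .
qed

text \<open>Choose a Borel g equal to the integrand outside a null set N of the spacetime measure.
  At almost every time the slice of N is null for \<mu>(t), so the slice of g agrees almost surely
  with \<alpha>(t) times the indicator of U. Integrating |g| over space gives a Borel representative
  of the claimed function and so its measurability in time.\<close>

lemma set_integrable_spacetimeD:
  fixes \<mu> :: "real \<Rightarrow> 'a::euclidean_space measure" and \<alpha> :: "real \<Rightarrow> real"
  assumes flow: "prob_flow T \<mu>" and T: "0 \<le> T" and nonneg: "\<forall>t\<in>{0..T}. \<alpha> t \<ge> 0"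
    and U[measurable]: "U \<in> sets borel"
    and int: "set_integrable (completion (spacetime_measure T \<mu>)) (U \<times> {0..T}) (\<lambda>(x, t). \<alpha> t)"
  shows "set_integrable lebesgue {0..T} (\<lambda>t. \<alpha> t * measure (\<mu> t) U)"
proof -
  let ?S = "spacetime_measure T \<mu>"
  note [measurable_cong] = sets_spacetime_measure[OF flow T]
  have spS: "space ?S = UNIV" using sets_eq_imp_space_eq[OF sets_spacetime_measure[OF flow T]] by simp
  define G where "G p = indicator (U \<times> {0..T}) p *\<^sub>R (case p of (x, t) \<Rightarrow> \<alpha> t)" for p
  have G: "integrable (completion ?S) G" using int by (simp add: set_integrable_def G_def[abs_def])
  then have "G \<in> borel_measurable (completion ?S)" by (rule borel_measurable_integrable)
  then obtain g where g: "g \<in> borel_measurable ?S" and ae: "AE p in ?S. G p = g p"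
    using completion_ex_borel_measurable_real by blast
  have [measurable]: "g \<in> borel_measurable borel" using g by simp
  have "integrable (completion ?S) g"
    using G ae g by (subst integrable_cong_AE[of g _ G]) (auto intro!: AE_completion measurable_completion elim: AE_mp)
  then have "integrable ?S g" using g by (simp add: integrable_completion)
  then have fin: "(\<integral>\<^sup>+p. ennreal (norm (g p)) \<partial>?S) < \<infinity>" by (simp add: integrable_iff_bounded)
  from ae obtain N where N: "N \<in> null_sets ?S" "{p. G p \<noteq> g p} \<subseteq> N"
    using spS by (auto simp: eventually_ae_filter)
  have Nb[measurable]: "N \<in> sets borel" using N(1) sets_spacetime_measure[OF flow T] by auto
  define F where "F t = (\<integral>\<^sup>+x. ennreal (norm (g (x, t))) \<partial>\<mu> t)" for t
  have Fm: "(\<lambda>t. F t * indicator {0..T} t) \<in> borel_measurable borel"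
    unfolding F_def by (rule measurable_spacetime_slices[OF flow T, of "\<lambda>p. ennreal (norm (g p))"]) measurable
  have Ffin: "(\<integral>\<^sup>+t\<in>{0..T}. F t \<partial>lborel) < \<infinity>"
    using fin nn_integral_spacetime[OF flow T, of "\<lambda>p. ennreal (norm (g p))"] by (simp add: F_def)
  have "(\<integral>\<^sup>+t\<in>{0..T}. (\<integral>\<^sup>+x. indicator N (x, t) \<partial>\<mu> t) \<partial>lborel) = (\<integral>\<^sup>+p. indicator N p \<partial>?S)"
    by (rule nn_integral_spacetime[OF flow T, symmetric]) measurable
  also have "\<dots> = 0" using N(1) by (subst nn_integral_indicator) auto
  finally have "AE t in lborel. (\<integral>\<^sup>+x. indicator N (x, t) \<partial>\<mu> t) * indicator {0..T} t = 0"
    using measurable_spacetime_slices[OF flow T, of "indicator N"] by (subst (asm) nn_integral_0_iff_AE) auto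
  then have aeF: "AE t in lborel. t \<in> {0..T} \<longrightarrow> F t = ennreal (\<alpha> t * measure (\<mu> t) U)"
  proof eventually_elim
    case (elim t)
    show ?case
    proof
      assume t: "t \<in> {0..T}"
      then have "borel_prob (\<mu> t)" using flow by (auto simp: prob_flow_def)
      then interpret prob_space "\<mu> t" by (simp add: borel_prob_def)
      have s[measurable_cong]: "sets (\<mu> t) = sets borel" using \<open>borel_prob (\<mu> t)\<close> by (simp add: borel_prob_def)
      have sl[measurable]: "(\<lambda>x. (x, t)) \<in> \<mu> t \<rightarrow>\<^sub>M borel"
        unfolding measurable_cong_sets[OF s refl] borel_prod[symmetric] by measurable
      have "(\<integral>\<^sup>+x. indicator N (x, t) \<partial>\<mu> t) = 0" using elim t by simp
      then have "AE x in \<mu> t. indicator N (x, t) = (0 :: ennreal)"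
        by (subst (asm) nn_integral_0_iff_AE) auto
      then have "AE x in \<mu> t. ennreal (norm (g (x, t))) = ennreal (\<alpha> t) * indicator U x"
      proof eventually_elim
        case (elim x)
        then have "(x, t) \<notin> N" by (auto split: split_indicator_asm)
        then have "(x, t) \<notin> {p. G p \<noteq> g p}" using N(2) by blast
        then have "g (x, t) = G (x, t)" by simp
        then show ?case using t nonneg by (auto simp: G_def split: split_indicator)
      qed
      then have "F t = (\<integral>\<^sup>+x. ennreal (\<alpha> t) * indicator U x \<partial>\<mu> t)"
        unfolding F_def by (rule nn_integral_cong_AE)
      also have "\<dots> = ennreal (\<alpha> t) * emeasure (\<mu> t) U"
        by (subst nn_integral_cmult_indicator) auto
      also have "\<dots> = ennreal (\<alpha> t * measure (\<mu> t) U)"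
        using t nonneg by (simp add: emeasure_eq_measure ennreal_mult)
      finally show "F t = ennreal (\<alpha> t * measure (\<mu> t) U)" .
    qed
  qed
  show ?thesis
  proof (rule set_integral_lebesgue_AE(1))
    show "set_integrable lborel {0..T} (\<lambda>t. enn2real (F t))"
      unfolding set_integrable_def
    proof (rule integrableI_bounded)
      have e: "indicator {0..T} t *\<^sub>R enn2real (F t) = enn2real (F t * indicator {0..T} t)" for t
        by (auto split: split_indicator)
      show "(\<lambda>t. indicator {0..T} t *\<^sub>R enn2real (F t)) \<in> borel_measurable lborel"
        unfolding e using Fm by simp
      have "(\<integral>\<^sup>+t. ennreal (norm (indicator {0..T} t *\<^sub>R enn2real (F t))) \<partial>lborel) \<le> (\<integral>\<^sup>+t\<in>{0..T}. F t \<partial>lborel)"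
        by (intro nn_integral_mono) (auto simp: ennreal_enn2real_if split: split_indicator)
      then show "(\<integral>\<^sup>+t. ennreal (norm (indicator {0..T} t *\<^sub>R enn2real (F t))) \<partial>lborel) < \<infinity>"
        using Ffin by (rule order.strict_trans1)
    qed
    show "AE t in lborel. t \<in> {0..T} \<longrightarrow> enn2real (F t) = \<alpha> t * measure (\<mu> t) U"
      using aeF by eventually_elim (use nonneg in auto)
  qed
qed

text \<open>The time marginal of the spacetime measure is Lebesgue measure on [0,T]. Hence the times
  at which a Borel representative differs from \<alpha> pull back under \<open>snd\<close> to a null
  set.\<close>

lemma set_integrable_spacetimeI:
  fixes \<mu> :: "real \<Rightarrow> 'a::euclidean_space measure" and \<alpha> :: "real \<Rightarrow> real"
  assumes flow: "prob_flow T \<mu>" and T: "0 \<le> T" and nonneg: "\<forall>t\<in>{0..T}. \<alpha> t \<ge> 0"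
    and U[measurable]: "U \<in> sets borel" and \<alpha>: "set_integrable lebesgue {0..T} \<alpha>"
  shows "set_integrable (completion (spacetime_measure T \<mu>)) (U \<times> {0..T}) (\<lambda>(x, t). \<alpha> t)"
proof -
  let ?S = "spacetime_measure T \<mu>"
  note [measurable_cong] = sets_spacetime_measure[OF flow T]
  have spS: "space ?S = UNIV" using sets_eq_imp_space_eq[OF sets_spacetime_measure[OF flow T]] by simp
  obtain w where w[measurable]: "w \<in> borel_measurable borel" and w0: "\<And>s. w s \<ge> 0" and wi: "integrable lborel w"
    and "\<And>s. s \<notin> {0..T} \<Longrightarrow> w s = 0" and ae: "AE s in lborel. s \<in> {0..T} \<longrightarrow> w s = \<alpha> s"
    by (rule set_integrable_lebesgue_borel_version[OF \<alpha> atLeastAtMost_borel nonneg]) (rule that; assumption)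
  have snd_m[measurable]: "snd \<in> borel_measurable (borel :: ('a \<times> real) measure)"
    unfolding borel_prod[symmetric] by measurable
  have UT[measurable]: "U \<times> {0..T} \<in> sets (borel :: ('a \<times> real) measure)"
    unfolding borel_prod[symmetric] by measurable
  define g where "g p = indicator (U \<times> {0..T}) p * w (snd p)" for p :: "'a \<times> real"
  have gm[measurable]: "g \<in> borel_measurable borel" unfolding g_def[abs_def] by measurable
  have gi: "integrable ?S g"
  proof (rule integrableI_bounded)
    show "g \<in> borel_measurable ?S" by measurable
    have "(\<integral>\<^sup>+p. ennreal (norm (g p)) \<partial>?S) = (\<integral>\<^sup>+t\<in>{0..T}. (\<integral>\<^sup>+x. ennreal (norm (g (x, t))) \<partial>\<mu> t) \<partial>lborel)"
      by (rule nn_integral_spacetime[OF flow T]) measurable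
    also have "\<dots> \<le> (\<integral>\<^sup>+t. ennreal (w t) \<partial>lborel)"
    proof (rule nn_integral_mono)
      fix t
      show "(\<integral>\<^sup>+x. ennreal (norm (g (x, t))) \<partial>\<mu> t) * indicator {0..T} t \<le> ennreal (w t)"
      proof (cases "t \<in> {0..T}")
        case True
        then interpret prob_space "\<mu> t" using flow by (auto simp: prob_flow_def borel_prob_def)
        have "(\<integral>\<^sup>+x. ennreal (norm (g (x, t))) \<partial>\<mu> t) \<le> (\<integral>\<^sup>+x. ennreal (w t) \<partial>\<mu> t)"
          by (intro nn_integral_mono) (auto simp: g_def w0 split: split_indicator)
        then show ?thesis using True by (simp add: emeasure_space_1)
      qed simp
    qed
    also have "\<dots> < \<infinity>" using wi w0 by (simp add: integrable_iff_bounded)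
    finally show "(\<integral>\<^sup>+p. ennreal (norm (g p)) \<partial>?S) < \<infinity>" .
  qed
  from ae obtain N where N: "N \<in> null_sets lborel" "{s. \<not> (s \<in> {0..T} \<longrightarrow> w s = \<alpha> s)} \<subseteq> N"
    by (auto simp: eventually_ae_filter)
  have [measurable]: "N \<in> sets borel" using N(1) by auto
  have "AE p in ?S. g p = indicator (U \<times> {0..T}) p *\<^sub>R (case p of (x, t) \<Rightarrow> \<alpha> t)"
  proof (rule AE_I[where N = "snd -` N"])
    have Nm: "snd -` N \<in> sets (borel :: ('a \<times> real) measure)"
      using measurable_sets[OF snd_m, of N] by simp
    have "emeasure ?S (snd -` N) = (\<integral>\<^sup>+t\<in>{0..T}. emeasure (\<mu> t) {x. (x, t) \<in> snd -` N} \<partial>lborel)"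
      by (rule emeasure_spacetime_measure[OF flow T Nm])
    also have "\<dots> = (\<integral>\<^sup>+t. 0 \<partial>(lborel :: real measure))"
    proof (rule nn_integral_cong_AE)
      show "AE t in lborel. emeasure (\<mu> t) {x. (x, t) \<in> snd -` N} * indicator {0..T} t = 0"
        using AE_not_in[OF N(1)] by eventually_elim simp
    qed
    finally show "emeasure ?S (snd -` N) = 0" by simp
    show "snd -` N \<in> sets ?S" using Nm sets_spacetime_measure[OF flow T] by simp
    show "{p \<in> space ?S. \<not> g p = indicator (U \<times> {0..T}) p *\<^sub>R (case p of (x, t) \<Rightarrow> \<alpha> t)} \<subseteq> snd -` N"
      using N(2) by (auto simp: g_def split: split_indicator_asm)
  qed
  with gi show ?thesis
    unfolding set_integrable_def
    using has_bochner_integral_completion_AE[of ?S g "integral\<^sup>L ?S g"] by (auto simp: has_bochner_integral_iff)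
qed

text \<open>The hypotheses only control the coefficient weighted by the mass of balls.  Since
  \<open>\<integral>\<phi> d\<mu>\<^sub>t\<close> is continuous in \<open>t\<close>, compactness of \<open>[0,T]\<close> yields a single ball
  whose mass stays away from zero.\<close>

lemma is_solution_imp_linear_solution:
  fixes \<nu> :: "'a::euclidean_space measure"
  assumes sol: "is_solution D a \<nu> T \<mu>" and T: "0 \<le> T" and \<nu>: "borel_prob \<nu>"
    and a: "\<And>M. M \<in> D \<Longrightarrow> a M \<ge> 0"
  shows "linear_solution \<nu> T (\<lambda>t. a (\<mu> t)) \<mu>"
proof -
  have flow: "prob_flow T \<mu>" and D: "\<And>t. t \<in> {0..T} \<Longrightarrow> \<mu> t \<in> D"
    and int: "\<And>c r. set_integrable (completion (spacetime_measure T \<mu>)) (ball c r \<times> {0..T}) (\<lambda>(x, t). a (\<mu> t))"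
    and weak: "\<And>\<phi> t. test_function \<phi> \<Longrightarrow> t \<in> {0..T} \<Longrightarrow> (LINT x|\<mu> t. \<phi> x) = (LINT x|\<nu>. \<phi> x)
          + (LINT s:{0..t}|lebesgue. a (\<mu> s) * (LINT x|\<mu> s. laplacian \<phi> x))"
    using sol by (auto simp: is_solution_def)
  define \<alpha> where "\<alpha> t = a (\<mu> t)" for t
  have nonneg: "\<forall>t\<in>{0..T}. \<alpha> t \<ge> 0" using D a by (simp add: \<alpha>_def)
  define m where "m r t = measure (\<mu> t) (ball 0 r)" for r t
  have \<alpha>m: "set_integrable lebesgue {0..T} (\<lambda>t. \<alpha> t * m r t)" for r
    unfolding m_def by (rule set_integrable_spacetimeD[OF flow T nonneg]) (use int in \<open>auto simp: \<alpha>_def\<close>)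
  have ps: "prob_space (\<mu> t)" "sets (\<mu> t) = sets borel" if "t \<in> {0..T}" for t
    using flow that by (auto simp: prob_flow_def borel_prob_def)
  have mm: "(\<lambda>t. indicator {0..T} t * m r t) \<in> borel_measurable borel" for r
  proof -
    have "(\<lambda>t. indicator {0..T} t * (LINT x|\<mu> t. indicator (ball 0 r) x :: real)) \<in> borel_measurable borel"
      by (rule prob_flow_integral_measurable[OF flow], rule borel_measurable_indicator) simp
    also have "(\<lambda>t. indicator {0..T} t * (LINT x|\<mu> t. indicator (ball 0 r) x :: real)) = (\<lambda>t. indicator {0..T} t * m r t)"
    proof
      fix t
      show "indicator {0..T} t * (LINT x|\<mu> t. indicator (ball 0 r) x :: real) = indicator {0..T} t * m r t"
        using sets_eq_imp_space_eq[OF ps(2)[of t]] by (cases "t \<in> {0..T}") (simp_all add: m_def)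
    qed
    finally show ?thesis .
  qed
  have mass_bound: "\<bar>LINT x|\<mu> t. h x\<bar> \<le> B * m r t"
    if t: "t \<in> {0..T}" and [measurable]: "h \<in> borel_measurable borel"
      and h: "\<And>x. \<bar>h x\<bar> \<le> B" "\<And>x. h x \<noteq> 0 \<Longrightarrow> x \<in> ball 0 r" for t h B r
  proof -
    interpret prob_space "\<mu> t" by (rule ps[OF t])
    note [measurable_cong] = ps(2)[OF t]
    have [measurable]: "ball (0 :: 'a) r \<in> sets borel" by simp
    have im: "(\<lambda>x. B * indicator (ball 0 r) x) \<in> borel_measurable (\<mu> t)" by measurable
    have "\<bar>LINT x|\<mu> t. h x\<bar> \<le> (LINT x|\<mu> t. \<bar>h x\<bar>)" by (rule integral_abs_bound)
    also have "\<dots> \<le> (LINT x|\<mu> t. B * indicator (ball 0 r) x)"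
      using h order_trans[OF abs_ge_zero h(1)] im
      by (intro integral_mono integrable_const_bound[where B = B]) (auto split: split_indicator)
    also have "\<dots> = B * m r t" using sets_eq_imp_space_eq[OF ps(2)[OF t]] by (simp add: m_def)
    finally show ?thesis .
  qed
  have cont: "continuous_on {0..T} (\<lambda>t. LINT x|\<mu> t. \<phi> x)" if \<phi>: "test_function \<phi>" for \<phi>
  proof -
    have L: "test_function (laplacian \<phi>)" using \<phi> by (rule test_function_laplacian)
    obtain B where B: "B > 0" "\<And>x. \<bar>laplacian \<phi> x\<bar> \<le> B" using test_function_bounded[OF L] by blast
    obtain r where "{x. laplacian \<phi> x \<noteq> 0} \<subseteq> ball 0 r"
      using L bounded_subset_ballD[of "{x. laplacian \<phi> x \<noteq> 0}" 0] by (auto simp: test_function_iff)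
    then have r: "x \<in> ball 0 r" if "laplacian \<phi> x \<noteq> 0" for x using that by blast
    define l where "l s = (LINT x|\<mu> s. laplacian \<phi> x)" for s
    have lb: "\<bar>l s\<bar> \<le> B * m r s" if "s \<in> {0..T}" for s
      unfolding l_def by (rule mass_bound[OF that test_function_measurable[OF L] B(2) r])
    have lm: "(\<lambda>s. indicator {0..T} s * l s) \<in> borel_measurable borel"
      unfolding l_def by (rule prob_flow_integral_measurable[OF flow test_function_measurable[OF L]])
    \<comment> \<open>The coefficient alone is not yet known to be integrable. Since the Laplacian
      of \<phi> is supported in a ball, its integral is at most a constant times the mass of that
      ball, so the product splits into the controlled weight and a bounded quotient.\<close>
    have "set_integrable lebesgue {0..T} (\<lambda>s. (\<alpha> s * m r s) * (l s / m r s))"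
    proof (rule set_integrable_mult_bounded[OF \<alpha>m, where B = B])
      have "(\<lambda>s. indicator {0..T} s * (l s / m r s)) = (\<lambda>s. (indicator {0..T} s * l s) / (indicator {0..T} s * m r s))"
        by (auto split: split_indicator)
      then show "(\<lambda>s. indicator {0..T} s * (l s / m r s)) \<in> borel_measurable borel"
        by (simp only: borel_measurable_divide[OF lm mm])
      show "\<bar>l s / m r s\<bar> \<le> B" if "s \<in> {0..T}" for s
      proof (cases "m r s = 0")
        case False
        then have "m r s > 0" by (simp add: m_def zero_less_measure_iff)
        then show ?thesis using lb[OF that] by (simp add: divide_le_eq)
      qed (use B(1) in simp)
    qed (use T in auto)
    \<comment> \<open>Where the ball has mass zero, \<open>lb\<close> forces \<open>l s\<close> to
      vanish, so the convention for division by zero is harmless.\<close>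
    moreover have "(\<alpha> s * m r s) * (l s / m r s) = \<alpha> s * l s" if "s \<in> {0..T}" for s
      using lb[OF that] by (cases "m r s = 0") auto
    ultimately have i: "set_integrable lebesgue {0..T} (\<lambda>s. \<alpha> s * l s)"
      by (subst (asm) set_integrable_cong[OF refl refl]) auto
    have it: "(LINT s:{0..t}|lebesgue. \<alpha> s * l s) = integral {0..t} (\<lambda>s. \<alpha> s * l s)" if "t \<in> {0..T}" for t
      by (rule set_lebesgue_integral_eq_integral(2)[OF set_integrable_subset[OF i]]) (use that in auto)
    have "continuous_on {0..T} (\<lambda>t. integral {0..t} (\<lambda>s. \<alpha> s * l s))"
      by (rule indefinite_integral_continuous_1) (rule set_lebesgue_integral_eq_integral(1)[OF i])
    then have "continuous_on {0..T} (\<lambda>t. (LINT x|\<nu>. \<phi> x) + integral {0..t} (\<lambda>s. \<alpha> s * l s))"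
      by (intro continuous_intros)
    then show ?thesis
      by (rule continuous_on_eq) (use weak[OF \<phi>] it in \<open>simp add: \<alpha>_def l_def\<close>)
  qed
  obtain \<eta> :: "'a \<Rightarrow> real" where \<eta>: "test_function \<eta>" "\<eta> 0 = 1" using ex_bump by blast
  obtain B where B: "B > 0" "\<And>x. \<bar>\<eta> x\<bar> \<le> B" using test_function_bounded[OF \<eta>(1)] by blast
  obtain R where R: "\<And>x. \<eta> x \<noteq> 0 \<Longrightarrow> x \<in> ball 0 R" "R > 0"
  proof -
    obtain r where r: "{x. \<eta> x \<noteq> 0} \<subseteq> ball 0 r"
      using \<eta>(1) bounded_subset_ballD[of "{x. \<eta> x \<noteq> 0}" 0] by (auto simp: test_function_iff)
    moreover have "0 \<in> {x. \<eta> x \<noteq> 0}" using \<eta>(2) by simp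
    ultimately have "(0::'a) \<in> ball 0 r" by blast
    with r show ?thesis by (intro that[of r]) auto
  qed
  define e where "e n = 1 / real (Suc n)" for n
  have e: "e n > 0" for n by (simp add: e_def)
  have e0: "e \<longlonglongrightarrow> 0" unfolding e_def by (rule LIMSEQ_Suc) (rule lim_1_over_n)
  define c where "c n t = (LINT x|\<mu> t. \<eta> (e n *\<^sub>R x))" for n t
  have tn: "test_function (\<lambda>x. \<eta> (e n *\<^sub>R x))" for n
    using \<eta>(1) e[of n] by (intro test_function_scale) auto
  have c_cont: "continuous_on {0..T} (c n)" for n unfolding c_def by (rule cont[OF tn])
  have ex: "\<exists>n. c n t > 1 / 2" if t: "t \<in> {0..T}" for t
  proof -
    interpret prob_space "\<mu> t" by (rule ps[OF t])
    note [measurable_cong] = ps(2)[OF t]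
    note [measurable] = test_function_measurable[OF \<eta>(1)]
    have "(\<lambda>n. c n t) \<longlonglongrightarrow> (LINT x|\<mu> t. 1)"
      unfolding c_def
    proof (rule integral_dominated_convergence[where w = "\<lambda>_. B"])
      show "AE x in \<mu> t. (\<lambda>n. \<eta> (e n *\<^sub>R x)) \<longlonglongrightarrow> 1"
      proof (rule AE_I2)
        fix x :: 'a
        have "isCont \<eta> 0"
          using test_function_continuous[OF \<eta>(1), of UNIV] by (simp add: continuous_on_eq_continuous_at)
        moreover have "(\<lambda>n. e n *\<^sub>R x) \<longlonglongrightarrow> 0" using tendsto_scaleR[OF e0 tendsto_const[of x]] by simp
        ultimately show "(\<lambda>n. \<eta> (e n *\<^sub>R x)) \<longlonglongrightarrow> 1"
          using \<eta>(2) isCont_tendsto_compose by fastforce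
      qed
    qed (use B(2) in auto)
    then have "\<forall>\<^sub>F n in sequentially. c n t > 1 / 2"
      by (rule order_tendstoD) (simp add: prob_space)
    from eventually_happens[OF this] show ?thesis by simp
  qed
  \<comment> \<open>At each time the integrals of the dilated bumps tend to 1, so these relatively
    open sets cover [0,T].\<close>
  have "\<forall>n. \<exists>A. open A \<and> A \<inter> {0..T} = c n -` {1 / 2<..} \<inter> {0..T}"
    using c_cont unfolding continuous_on_open_invariant by simp
  from choice[OF this] obtain A where "\<forall>n. open (A n) \<and> A n \<inter> {0..T} = c n -` {1 / 2<..} \<inter> {0..T}" ..
  then have A: "\<And>n. open (A n)" "\<And>n. A n \<inter> {0..T} = c n -` {1 / 2<..} \<inter> {0..T}" by auto
  have "{0..T} \<subseteq> (\<Union>n\<in>UNIV. A n)"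
  proof
    fix t assume t: "t \<in> {0..T}"
    then obtain n where "c n t > 1 / 2" using ex by blast
    with t have "t \<in> A n \<inter> {0..T}" unfolding A by simp
    then show "t \<in> (\<Union>n\<in>UNIV. A n)" by blast
  qed
  then obtain K where K: "finite K" "{0..T} \<subseteq> (\<Union>n\<in>K. A n)"
    using compactE_image[of "{0..T}" UNIV A] A(1) by auto
  \<comment> \<open>The n-th dilated bump lives in the ball of radius R (n+1); the sum over the
    finite subcover dominates all these radii at once.\<close>
  define r where "r = R * (1 + (\<Sum>n\<in>K. real (Suc n)))"
  have mr: "1 / (2 * B) \<le> m r t" if t: "t \<in> {0..T}" for t
  proof -
    obtain n where n: "n \<in> K" "t \<in> A n" using K t by blast
    then have "c n t > 1 / 2" using A(2)[of n] t by auto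
    moreover have "\<bar>c n t\<bar> \<le> B * m r t"
      unfolding c_def
    proof (rule mass_bound[OF t test_function_measurable[OF tn] B(2)])
      fix x assume "\<eta> (e n *\<^sub>R x) \<noteq> 0"
      then have "norm (e n *\<^sub>R x) < R" using R(1) by fastforce
      then have "norm x < R * real (Suc n)" by (simp add: e_def field_simps)
      also have "real (Suc n) \<le> (\<Sum>n\<in>K. real (Suc n))"
        using n(1) K(1) by (intro member_le_sum) auto
      then have "R * real (Suc n) \<le> r" using R(2) by (simp add: r_def)
      finally show "x \<in> ball 0 r" by simp
    qed
    ultimately have "1 / 2 \<le> B * m r t" by linarith
    then show ?thesis using B(1) by (simp add: field_simps)
  qed
  \<comment> \<open>The mass is now bounded below uniformly in time, so dividing the weighted
    coefficient by it preserves integrability.\<close>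
  have "set_integrable lebesgue {0..T} (\<lambda>s. (\<alpha> s * m r s) * (1 / m r s))"
  proof (rule set_integrable_mult_bounded[OF \<alpha>m, where B = "2 * B"])
    have "(\<lambda>s. indicator {0..T} s * (1 / m r s)) = (\<lambda>s. 1 / (indicator {0..T} s * m r s))"
      by (auto split: split_indicator)
    then show "(\<lambda>s. indicator {0..T} s * (1 / m r s)) \<in> borel_measurable borel"
      by (simp only: borel_measurable_divide[OF borel_measurable_const mm])
    show "\<bar>1 / m r s\<bar> \<le> 2 * B" if "s \<in> {0..T}" for s
    proof -
      have "0 < 1 / (2 * B)" using B(1) by simp
      moreover from this have pos: "0 < m r s" using mr[OF that] by linarith
      ultimately have "1 / m r s \<le> 1 / (1 / (2 * B))"
        using mr[OF that] by (intro divide_left_mono mult_pos_pos) auto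
      with pos show ?thesis using B(1) by simp
    qed
  qed (use T in auto)
  moreover have "(\<alpha> s * m r s) * (1 / m r s) = \<alpha> s" if "s \<in> {0..T}" for s
  proof -
    have "0 < 1 / (2 * B)" using B(1) by simp
    then have "m r s \<noteq> 0" using mr[OF that] by linarith
    then show ?thesis by simp
  qed
  ultimately have "set_integrable lebesgue {0..T} \<alpha>"
    by (subst (asm) set_integrable_cong[OF refl refl]) auto
  then show ?thesis
    using flow \<nu> nonneg weak by (simp add: linear_solution_def \<alpha>_def[abs_def])
qed


section \<open>Splitting time integrals, and the equivalence\<close>

lemma set_integral_lebesgue_combine:
  fixes \<alpha> :: "real \<Rightarrow> real"
  assumes "set_integrable lebesgue {p..q} \<alpha>" "p \<le> s" "s \<le> t" "t \<le> q"
  shows "(LINT u:{p..t}|lebesgue. \<alpha> u) = (LINT u:{p..s}|lebesgue. \<alpha> u) + (LINT u:{s..t}|lebesgue. \<alpha> u)"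
proof -
  have i: "set_integrable lebesgue {u..v} \<alpha>" if "p \<le> u" "v \<le> q" for u v
    using assms(1) by (rule set_integrable_subset) (use that in auto)
  have "integral {p..s} \<alpha> + integral {s..t} \<alpha> = integral {p..t} \<alpha>"
    by (rule Henstock_Kurzweil_Integration.integral_combine[OF assms(2,3) set_lebesgue_integral_eq_integral(1)[OF i]])
       (use assms in auto)
  then show ?thesis
    using assms by (simp add: set_lebesgue_integral_eq_integral(2)[OF i])
qed

lemma is_solution_stationary:
  assumes "borel_prob \<nu>" "\<nu> \<in> D" "a \<nu> = 0"
  shows "is_solution D a \<nu> T (\<lambda>_. \<nu>)"
  using assms by (simp add: is_solution_def prob_flow_def set_integrable_def set_lebesgue_integral_def)

text \<open>Integrability of 1/f includes its Lebesgue measurability near zero. From left to right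
  this is a conclusion, which the inverse clock of a nontrivial solution provides.\<close>

theorem theorem6p1:
  fixes \<nu> :: "'a::euclidean_space measure"
    and D :: "'a measure set"
    and a :: "'a measure \<Rightarrow> real"
    and f :: "real \<Rightarrow> real"
  assumes "borel_prob \<nu>"
    and "\<And>M. M \<in> D \<Longrightarrow> borel_prob M"
    and "\<nu> \<in> D"
    and "\<And>\<beta>. \<beta> > 0 \<Longrightarrow> heat_flow \<nu> \<beta> \<in> D"
    and "\<And>M. M \<in> D \<Longrightarrow> a M \<ge> 0"
    and "\<And>M. M \<in> D \<Longrightarrow> a M = 0 \<longleftrightarrow> M = \<nu>"
    and "\<And>\<beta>. \<beta> \<ge> 0 \<Longrightarrow> f \<beta> = a (heat_flow \<nu> \<beta>)"
  shows "(\<forall>T>0. is_solution D a \<nu> T (\<lambda>_. \<nu>)) \<and>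
    ((\<forall>T>0. \<exists>\<mu>\<^sub>1 \<mu>\<^sub>2. is_solution D a \<nu> T \<mu>\<^sub>1 \<and> is_solution D a \<nu> T \<mu>\<^sub>2 \<and>
        (\<exists>t\<in>{0..T}. \<mu>\<^sub>1 t \<noteq> \<mu>\<^sub>2 t))
      \<longleftrightarrow> (\<forall>\<^sub>F \<epsilon> in at_right 0. set_integrable lebesgue {0<..<\<epsilon>} (\<lambda>t. 1 / f t)))"
proof (intro conjI allI impI iffI)
  note \<nu> = assms(1)
  have a\<nu>: "a \<nu> = 0" using assms(3,6) by simp
  show stat: "is_solution D a \<nu> T (\<lambda>_. \<nu>)" for T
    by (intro is_solution_stationary \<nu> assms(3) a\<nu>)
  have f0: "f 0 = 0" using assms(7)[of 0] a\<nu> by (simp add: heat_flow_def)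
  have fpos: "f \<beta> > 0" if "\<beta> > 0" for \<beta>
    using assms(5)[OF assms(4)[OF that]] assms(6)[OF assms(4)[OF that]] assms(7)[of \<beta>] heat_flow_neq[OF \<nu> that] that
    by simp
  {
    assume "\<forall>T>0. \<exists>\<mu>\<^sub>1 \<mu>\<^sub>2. is_solution D a \<nu> T \<mu>\<^sub>1 \<and> is_solution D a \<nu> T \<mu>\<^sub>2 \<and> (\<exists>t\<in>{0..T}. \<mu>\<^sub>1 t \<noteq> \<mu>\<^sub>2 t)"
    then obtain \<mu>\<^sub>1 \<mu>\<^sub>2 t where "is_solution D a \<nu> 1 \<mu>\<^sub>1" "is_solution D a \<nu> 1 \<mu>\<^sub>2" "t \<in> {0..1}" "\<mu>\<^sub>1 t \<noteq> \<mu>\<^sub>2 t"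
      by (meson zero_less_one)
    \<comment> \<open>Of two solutions that differ at some time, at least one differs there from
      \<nu>.\<close>
    then obtain \<mu> q where sol: "is_solution D a \<nu> 1 \<mu>" and q: "q \<in> {0..1}" "\<mu> q \<noteq> \<nu>"
      by metis
    define \<alpha> where "\<alpha> t = a (\<mu> t)" for t
    define \<beta> where "\<beta> t = (LINT s:{0..t}|lebesgue. \<alpha> s)" for t
    have lin: "linear_solution \<nu> 1 \<alpha> \<mu>"
      unfolding \<alpha>_def[abs_def] by (rule is_solution_imp_linear_solution[OF sol _ \<nu> assms(5)]) auto
    have \<mu>: "\<mu> t = heat_flow \<nu> (\<beta> t)" if "t \<in> {0..1}" for t
      unfolding \<beta>_def by (rule linear_solution_unique[OF lin that])
    have \<alpha>: "set_integrable lebesgue {0..1} \<alpha>" "\<forall>s\<in>{0..1}. \<alpha> s \<ge> 0"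
      using lin by (auto simp: linear_solution_def)
    note clock = clock_substitution[OF \<alpha>, folded \<beta>_def, of "\<lambda>_. 0" 0 0, simplified]
    have mono: "mono_on {0..1} \<beta>" and \<beta>0: "\<beta> 0 = 0" and cont: "continuous_on {0..1} \<beta>"
      using clock by auto
    have \<beta>_nonneg: "\<beta> s \<ge> 0" if "s \<in> {0..1}" for s
      using mono_onD[OF mono, of 0 s] that \<beta>0 by auto
    have \<beta>q: "\<beta> q > 0"
      using \<mu>[OF q(1)] q(2) \<beta>_nonneg[OF q(1)] by (cases "\<beta> q = 0") (auto simp: heat_flow_def)
    \<comment> \<open>The last zero p of the clock before q marks the departure: on (p,q] the clock
      is positive, hence so is the coefficient, which equals f of the clock.\<close>
    let ?Z = "{0..q} \<inter> \<beta> -` {0}"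
    have "compact ?Z"
    proof -
      have "closed ?Z"
        by (rule continuous_closed_preimage[OF continuous_on_subset[OF cont]]) (use q in auto)
      moreover have "bounded ?Z" by (rule bounded_subset[of "{0..q}"]) auto
      ultimately show ?thesis by (simp add: compact_eq_bounded_closed)
    qed
    moreover have "?Z \<noteq> {}" using \<beta>0 q by auto
    ultimately obtain p where p: "p \<in> ?Z" "\<forall>s\<in>?Z. s \<le> p" using compact_attains_sup by blast
    then have pq: "p < q" using \<beta>q by (cases "p = q") auto
    have \<beta>pos: "\<beta> s > 0" if "s \<in> {p<..q}" for s
    proof -
      have "s \<notin> ?Z" using bspec[OF p(2), of s] that by auto
      then have "\<beta> s \<noteq> 0" using that p(1) by auto
      then show ?thesis using \<beta>_nonneg[of s] that p(1) q(1) by auto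
    qed
    have \<alpha>f: "\<alpha> s = f (\<beta> s)" if "s \<in> {0..1}" for s
      using \<mu>[OF that] assms(7)[OF \<beta>_nonneg[OF that]] by (simp add: \<alpha>_def)
    have p01: "0 \<le> p" "q \<le> 1" using p q by auto
    have \<alpha>pos: "\<forall>s\<in>{p<..q}. \<alpha> s > 0"
      using \<beta>pos fpos \<alpha>f p01 by auto
    have \<alpha>i: "set_integrable lebesgue {p..q} \<alpha>"
      using \<alpha>(1) by (rule set_integrable_subset) (use p01 in auto)
    have \<alpha>p: "\<alpha> p \<ge> 0" using \<alpha>(2) p01 pq by auto
    obtain V where "continuous_on {0..0 + (LINT s:{p..q}|lebesgue. \<alpha> s)} V"
      "\<And>s. s \<in> {p..q} \<Longrightarrow> V (0 + (LINT s:{p..s}|lebesgue. \<alpha> s)) = s"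
      "\<And>s. s \<in> {p..q} \<Longrightarrow> 0 + (LINT s:{p..s}|lebesgue. \<alpha> s) \<in> {0..0 + (LINT s:{p..q}|lebesgue. \<alpha> s)}"
      and V: "\<And>r. r \<in> {0..0 + (LINT s:{p..q}|lebesgue. \<alpha> s)} \<Longrightarrow> V r \<in> {p..q} \<and> 0 + (LINT s:{p..V r}|lebesgue. \<alpha> s) = r"
        "set_integrable lebesgue {0..0 + (LINT s:{p..q}|lebesgue. \<alpha> s)} (\<lambda>r. 1 / \<alpha> (V r))"
      and "\<And>t. t \<in> {p..q} \<Longrightarrow> (LINT r:{0..0 + (LINT s:{p..t}|lebesgue. \<alpha> s)}|lebesgue. 1 / \<alpha> (V r)) = t - p"
      by (rule inverse_clock[OF pq \<alpha>i \<alpha>pos \<alpha>p, of 0]) (rule that; assumption)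
    \<comment> \<open>No time has accumulated by p, so the clock restarted at p is the original
      one.\<close>
    have \<beta>p: "(LINT s:{p..t}|lebesgue. \<alpha> s) = \<beta> t" if "t \<in> {p..q}" for t
      using set_integral_lebesgue_combine[OF \<alpha>(1), of p t] that p p01 by (simp add: \<beta>_def)
    have V': "V r \<in> {p..q}" "\<beta> (V r) = r" if "r \<in> {0..\<beta> q}" for r
      using V(1)[of r] that \<beta>p[of q] \<beta>p[of "V r"] pq by auto
    have "set_integrable lebesgue {0..\<beta> q} (\<lambda>r. 1 / \<alpha> (V r))"
      using V(2) \<beta>p[of q] pq by simp
    \<comment> \<open>At the time \<open>V r\<close> the clock shows r, so the coefficient there is
      f(r): the integrable function delivered by the inversion is 1/f.\<close>
    moreover have "1 / \<alpha> (V r) = 1 / f r" if "r \<in> {0..\<beta> q}" for r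
      using \<alpha>f[of "V r"] V'[OF that] p01 by auto
    ultimately have fi: "set_integrable lebesgue {0..\<beta> q} (\<lambda>r. 1 / f r)"
      by (subst (asm) set_integrable_cong[OF refl refl]) auto
    show "\<forall>\<^sub>F \<epsilon> in at_right 0. set_integrable lebesgue {0<..<\<epsilon>} (\<lambda>t. 1 / f t)"
      unfolding eventually_at_right_field
    proof (intro exI conjI allI impI)
      show "\<beta> q > 0" by (rule \<beta>q)
      fix \<epsilon> assume "0 < \<epsilon>" "\<epsilon> < \<beta> q"
      then show "set_integrable lebesgue {0<..<\<epsilon>} (\<lambda>t. 1 / f t)"
        by (intro set_integrable_subset[OF fi]) auto
    qed
  }
  {
    fix T :: real
    assume "\<forall>\<^sub>F \<epsilon> in at_right 0. set_integrable lebesgue {0<..<\<epsilon>} (\<lambda>t. 1 / f t)" and T: "T > 0"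
    then obtain e where e: "e > 0" "\<And>\<epsilon>. 0 < \<epsilon> \<Longrightarrow> \<epsilon> < e \<Longrightarrow> set_integrable lebesgue {0<..<\<epsilon>} (\<lambda>t. 1 / f t)"
      unfolding eventually_at_right_field by blast
    \<comment> \<open>As e/4 < e/2 < e, the closed end point q lies inside an open interval on which
      1/f is integrable.\<close>
    define q where "q = e / 4"
    have q: "0 < q" using e by (simp add: q_def)
    define w where "w t = 1 / f t" for t
    have wi: "set_integrable lebesgue {0..q} w"
    proof -
      have "set_integrable lebesgue {0<..<e / 2} w" unfolding w_def using e by simp
      then have "set_integrable lebesgue {0<..q} w"
        by (rule set_integrable_subset) (use e in \<open>auto simp: q_def\<close>)
      \<comment> \<open>At t = 0 both sides vanish, because \<open>1 / f 0\<close> is a division by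
        zero.\<close>
      moreover have "indicator {0<..q} t *\<^sub>R w t = indicator {0..q} t *\<^sub>R w t" for t
        by (cases "t = 0") (auto simp: w_def f0 split: split_indicator)
      ultimately show ?thesis unfolding set_integrable_def by (simp only:)
    qed
    have wpos: "\<forall>s\<in>{0<..q}. w s > 0" using fpos by (simp add: w_def)
    \<comment> \<open>The nontrivial solution leaves \<open>\<nu>\<close> only at time \<open>p\<close>, so that its lifetime \<open>\<delta>\<close> after
      departure reaches up to \<open>T\<close>.\<close>
    define \<delta> where "\<delta> = (LINT s:{0..q}|lebesgue. w s)"
    define p where "p = max 0 (T - \<delta>)"
    have w00: "w 0 \<ge> 0" by (simp add: w_def f0)
    \<comment> \<open>The roles are now exchanged: the density 1/f measures the time spent per unit
      of level, starting from time p, and V gives the level reached at a time.\<close>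
    obtain V where "continuous_on {p..p + (LINT s:{0..q}|lebesgue. w s)} V"
      and VW: "\<And>s. s \<in> {0..q} \<Longrightarrow> V (p + (LINT s:{0..s}|lebesgue. w s)) = s"
      and W: "\<And>s. s \<in> {0..q} \<Longrightarrow> p + (LINT s:{0..s}|lebesgue. w s) \<in> {p..p + (LINT s:{0..q}|lebesgue. w s)}"
      and WV: "\<And>r. r \<in> {p..p + (LINT s:{0..q}|lebesgue. w s)} \<Longrightarrow> V r \<in> {0..q} \<and> p + (LINT s:{0..V r}|lebesgue. w s) = r"
      and Vi: "set_integrable lebesgue {p..p + (LINT s:{0..q}|lebesgue. w s)} (\<lambda>r. 1 / w (V r))"
      and VI: "\<And>t. t \<in> {0..q} \<Longrightarrow> (LINT r:{p..p + (LINT s:{0..t}|lebesgue. w s)}|lebesgue. 1 / w (V r)) = t - 0"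
      by (rule inverse_clock[OF q wi wpos w00, of p]) (rule that; assumption)
    note W = W[folded \<delta>_def] and WV = WV[folded \<delta>_def] and Vi = Vi[folded \<delta>_def]
    have w0: "(LINT s:{0..0}|lebesgue. w s) = 0"
      using set_lebesgue_integral_eq_integral(2)[of "{0..0}" w] set_integrable_subset[OF wi, of "{0..0}"] q by simp
    have Vp: "V p = 0" using VW[of 0] w0 q by simp
    have "\<delta> > 0"
    proof -
      have "\<delta> \<ge> 0" using W[of 0] w0 q by simp
      moreover have "\<delta> \<noteq> 0" using VW[of q] Vp q by (auto simp: \<delta>_def)
      ultimately show ?thesis by simp
    qed
    then have p: "0 \<le> p" "p < T" "T \<le> p + \<delta>" using T by (auto simp: p_def)
    define \<alpha> where "\<alpha> t = (if t \<le> p then 0 else f (V t))" for t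
    define \<beta> where "\<beta> t = (LINT s:{0..t}|lebesgue. \<alpha> s)" for t
    \<comment> \<open>At t = p both formulas for the coefficient give zero, because
      \<open>V p\<close> is 0 and f vanishes there.\<close>
    have \<alpha>V: "\<alpha> t = 1 / w (V t)" if "t \<in> {p..T}" for t
      using that Vp by (auto simp: \<alpha>_def w_def f0)
    have V0: "V t \<in> {0..q}" if "t \<in> {p..T}" for t using WV[of t] that p by auto
    have \<alpha>1: "set_integrable lebesgue {0..p} \<alpha>"
    proof -
      have "indicator {0..p} t *\<^sub>R \<alpha> t = 0" for t by (auto simp: \<alpha>_def split: split_indicator)
      then show ?thesis unfolding set_integrable_def by (simp only: integrable_zero)
    qed
    have \<alpha>2: "set_integrable lebesgue {p..T} \<alpha>"
    proof -
      have "set_integrable lebesgue {p..T} (\<lambda>r. 1 / w (V r))"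
        by (rule set_integrable_subset[OF Vi]) (use p in auto)
      then show ?thesis using \<alpha>V by (subst set_integrable_cong[OF refl refl]) auto
    qed
    have "{0..p} \<union> {p..T} = {0..T}" using p by auto
    then have \<alpha>i: "set_integrable lebesgue {0..T} \<alpha>"
      using set_integrable_Un[OF \<alpha>1 \<alpha>2] by simp
    have \<alpha>0: "\<forall>s\<in>{0..T}. \<alpha> s \<ge> 0"
    proof
      fix s assume "s \<in> {0..T}"
      then show "\<alpha> s \<ge> 0"
        using V0[of s] fpos[of "V s"] f0 by (cases "s \<le> p"; cases "V s = 0") (auto simp: \<alpha>_def)
    qed
    have \<beta>1: "\<beta> t = 0" if "t \<le> p" for t
    proof -
      have "indicator {0..t} s *\<^sub>R \<alpha> s = 0" for s using that by (auto simp: \<alpha>_def split: split_indicator)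
      then show ?thesis unfolding \<beta>_def set_lebesgue_integral_def by (simp only: integral_zero)
    qed
    \<comment> \<open>The last conclusion of the inversion, taken at the level \<open>V t\<close>,
      says that the integral of f(V) from p to t is \<open>V t\<close>; thus V is the clock of the
      coefficient that it defines.\<close>
    have \<beta>2: "\<beta> t = V t" if t: "t \<in> {p..T}" for t
    proof -
      have "\<beta> t = \<beta> p + (LINT s:{p..t}|lebesgue. \<alpha> s)"
        unfolding \<beta>_def by (rule set_integral_lebesgue_combine[OF \<alpha>i]) (use t p in auto)
      also have "(LINT s:{p..t}|lebesgue. \<alpha> s) = (LINT s:{p..t}|lebesgue. 1 / w (V s))"
        by (rule set_lebesgue_integral_cong) (use t \<alpha>V in auto)
      also have "\<dots> = V t"
        using WV[of t] VI[of "V t"] t p by simp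
      finally show ?thesis by (simp add: \<beta>1)
    qed
    define \<mu> where "\<mu> t = heat_flow \<nu> (\<beta> t)" for t
    have lin: "linear_solution \<nu> T \<alpha> \<mu>"
      unfolding \<mu>_def[abs_def] \<beta>_def by (rule linear_solution_heat_flow[OF \<nu> \<alpha>i \<alpha>0])
    have \<beta>_nonneg: "\<beta> t \<ge> 0" if "t \<in> {0..T}" for t
      using \<beta>1[of t] \<beta>2[of t] V0[of t] that by (cases "t \<le> p") auto
    have \<mu>D: "\<mu> t \<in> D" if "t \<in> {0..T}" for t
      using \<beta>_nonneg[OF that] assms(3,4) by (cases "\<beta> t = 0") (auto simp: \<mu>_def heat_flow_def[of \<nu> 0])
    \<comment> \<open>This closes the loop: the prescribed coefficient is the value of
      \<open>a\<close> along the flow that it generates, so the linear solution solves the nonlinear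
      problem.\<close>
    have a\<mu>: "a (\<mu> t) = \<alpha> t" if "t \<in> {0..T}" for t
      using assms(7)[OF \<beta>_nonneg[OF that]] \<beta>1[of t] \<beta>2[of t] that f0
      by (cases "t \<le> p") (auto simp: \<mu>_def \<alpha>_def)
    have flow: "prob_flow T \<mu>" using lin by (simp add: linear_solution_def)
    have sol: "is_solution D a \<nu> T \<mu>"
      unfolding is_solution_def
    proof (intro conjI allI ballI impI)
      show "prob_flow T \<mu>" by (rule flow)
      show "\<mu> t \<in> D" if "t \<in> {0..T}" for t by (rule \<mu>D[OF that])
      show "set_integrable (completion (spacetime_measure T \<mu>)) (ball c r \<times> {0..T}) (\<lambda>(x, t). a (\<mu> t))" for c r
      proof -
        have "set_integrable (completion (spacetime_measure T \<mu>)) (ball c r \<times> {0..T}) (\<lambda>(x, t). \<alpha> t)"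
          using T by (intro set_integrable_spacetimeI[OF flow _ \<alpha>0 _ \<alpha>i]) auto
        moreover have "indicator (ball c r \<times> {0..T}) z *\<^sub>R (case z of (x, t) \<Rightarrow> \<alpha> t) =
            indicator (ball c r \<times> {0..T}) z *\<^sub>R (case z of (x, t) \<Rightarrow> a (\<mu> t))" for z
          using a\<mu> by (auto split: split_indicator)
        ultimately show ?thesis unfolding set_integrable_def by (simp only:)
      qed
      fix \<phi> :: "'a \<Rightarrow> real" and t assume \<phi>: "test_function \<phi>" and t: "t \<in> {0..T}"
      have "(LINT s:{0..t}|lebesgue. (LINT x|\<mu> s. a (\<mu> s) * laplacian \<phi> x)) =
          (LINT s:{0..t}|lebesgue. \<alpha> s * (LINT x|\<mu> s. laplacian \<phi> x))"
        by (rule set_lebesgue_integral_cong) (use t a\<mu> in auto)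
      then show "(LINT x|\<mu> t. \<phi> x) = (LINT x|\<nu>. \<phi> x) + (LINT s:{0..t}|lebesgue. (LINT x|\<mu> s. a (\<mu> s) * laplacian \<phi> x))"
        using lin \<phi> t by (simp add: linear_solution_def)
    qed
    have TT: "T \<in> {p..T}" "T \<in> {0..T}" using p by auto
    \<comment> \<open>Level zero is reached at time p only, and p < T.\<close>
    have "V T \<noteq> 0"
      using WV[of T] w0 p by auto
    then have "\<beta> T > 0" using \<beta>2[OF TT(1)] V0[OF TT(1)] by auto
    then have "\<mu> T \<noteq> \<nu>" unfolding \<mu>_def by (rule heat_flow_neq[OF \<nu>])
    then show "\<exists>\<mu>\<^sub>1 \<mu>\<^sub>2. is_solution D a \<nu> T \<mu>\<^sub>1 \<and> is_solution D a \<nu> T \<mu>\<^sub>2 \<and> (\<exists>t\<in>{0..T}. \<mu>\<^sub>1 t \<noteq> \<mu>\<^sub>2 t)"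
      using sol stat TT(2) by (intro exI[of _ \<mu>] exI[of _ "\<lambda>_. \<nu>"]) auto
  }
qed

end
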